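(* Let $Y^*_{\nu}$, $\nu>2$, be a standard $t$ process with $\nu$ degrees of freedom and underlying correlation $\rho(\boldsymbol{h})$, i.e. $Y^*_{\nu}(\boldsymbol{s})=W_{\nu}(\boldsymbol{s})^{-1/2}G(\boldsymbol{s})$ with $G$ a standard Gaussian process with correlation function $\rho(\boldsymbol{h})$ and $W_\nu$ the independent Gamma mixing process built from $\rho$. Let $\boldsymbol{s}_i\ne\boldsymbol{s}_j$, $\boldsymbol{h}=\boldsymbol{s}_i-\boldsymbol{s}_j$, with $|\rho(\boldsymbol{h})|<1$. Then the probability density function of the bivariate vector $\boldsymbol{Y}^*_{\nu;ij}=(Y^*_\nu(\boldsymbol{s}_i),Y^*_\nu(\boldsymbol{s}_j))^T$ is $$\begin{aligned} f_{\boldsymbol{Y}^*_{\nu;ij}}(y_{i},y_j)&=\frac{\nu^{\nu}\,l_{ij}^{-\frac{\nu+1}{2}}\,\Gamma^2\left(\frac{\nu+1}{2}\right)}{\pi\,\Gamma^2\left(\frac{\nu}{2}\right)(1-\rho^2(\boldsymbol{h}))^{-(\nu+1)/2}}\,F_4\left(\frac{\nu+1}{2},\frac{\nu+1}{2};\frac{1}{2},\frac{\nu}{2};\frac{\rho^2(\boldsymbol{h})y_i^2y_j^2}{l_{ij}},\frac{\nu^2\rho^2(\boldsymbol{h})}{l_{ij}}\right)\\ &\quad+\frac{\rho(\boldsymbol{h})\,y_iy_j\,\nu^{\nu+2}\,l_{ij}^{-\frac{\nu}{2}-1}}{2\pi(1-\rho^2(\boldsymbol{h}))^{-\frac{\nu+1}{2}}}\,F_4\left(\frac{\nu}{2}+1,\frac{\nu}{2}+1;\frac{3}{2},\frac{\nu}{2};\frac{\rho^2(\boldsymbol{h})y_i^2y_j^2}{l_{ij}},\frac{\nu^2\rho^2(\boldsymbol{h})}{l_{ij}}\right),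 \end{aligned}$$ where $l_{ij}=(y_i^2+\nu)(y_j^2+\nu)$.
   Context: Parent process: $G=\{G(\boldsymbol{s}),\boldsymbol{s}\in A\}$, $A\subseteq\mathbb{R}^d$, is a weakly stationary Gaussian process with zero mean, unit variance and correlation function $\rho(\boldsymbol{h})=\mathrm{Corr}(G(\boldsymbol{s}_i),G(\boldsymbol{s}_j))$, $\boldsymbol{h}=\boldsymbol{s}_i-\boldsymbol{s}_j$. Mixing process: for an integer $\nu$, $W_{\nu}(\boldsymbol{s}):=\frac1\nu\sum_{i=1}^{\nu}G_i(\boldsymbol{s})^2$, where $G_1,\dots,G_\nu$ are independent copies of $G$, also independent of $G$. The marginals of $W_\nu$ are $\Gamma(\nu/2,\nu/2)$ (shape, rate). For non-integer $\nu>2$, the bivariate vector $(W_\nu(\boldsymbol{s}_i),W_\nu(\boldsymbol{s}_j))$ is a positive random vector independent of $G$ with density (where $\rho=\rho(\boldsymbol{h})$, $|\rho|<1$) $$f(w_i,w_j)=\frac{2^{-\nu}\nu^{\nu}(w_iw_j)^{\nu/2-1}}{\Gamma^2(\nu/2)(1-\rho^2)^{\nu/2}}\,e^{-\frac{\nu(w_i+w_j)}{2(1-\rho^2)}}\,{}_0F_1\left(;\frac{\nu}{2};\frac{\nu^2\rho^2w_iw_j}{4(1-\rho^2)^2}\right),\quad w_i,w_j>0,$$ with ${}_0F_1(;b;x)=\sum_{k\ge0}\frac{x^k}{k!(b)_k}$; the same formula holds for integer $\nu$. The bivariate law is defined for every real $\nu>2$, irrespective of the correlation function. The Appell hypergeometric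 function of the fourth type is $$F_4(a,b;c,c';w,z)=\sum_{k=0}^{\infty}\sum_{m=0}^{\infty}\frac{(a)_{k+m}(b)_{k+m}\,w^kz^m}{k!\,m!\,(c)_k(c')_m},\qquad |\sqrt{w}|+|\sqrt{z}|<1,$$ with $(s)_k=\Gamma(s+k)/\Gamma(s)$. *)

theory Defs
  imports "HOL-Probability.Probability"
begin

definition sample_path :: "'s set \<Rightarrow> ('s \<Rightarrow> 'w \<Rightarrow> real) \<Rightarrow> 'w \<Rightarrow> 's \<Rightarrow> real" where
  "sample_path A X \<omega> = (\<lambda>s\<in>A. X s \<omega>)"

text \<open>Every finite subfamily is multivariate normal, i.e. distributed as \<open>\<mu> + L Z\<close> where
  \<open>Z\<close> is a vector of independent standard normals. \<open>L\<close> can be taken square (a root of the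
  covariance matrix) and may be singular, so degenerate normal laws are included.\<close>

definition gaussian_process :: "'w measure \<Rightarrow> 's set \<Rightarrow> ('s \<Rightarrow> 'w \<Rightarrow> real) \<Rightarrow> bool" where
  "gaussian_process M A X \<longleftrightarrow>
     (\<forall>s\<in>A. X s \<in> borel_measurable M) \<and>
     (\<forall>J. finite J \<and> J \<subseteq> A \<longrightarrow>
        (\<exists>\<mu> L. distr M (PiM J (\<lambda>_. borel)) (sample_path J X) =
               distr (PiM J (\<lambda>_. std_normal_distribution)) (PiM J (\<lambda>_. borel))
                 (\<lambda>z. \<lambda>s\<in>J. \<mu> s + (\<Sum>t\<in>J. L s t * z t))))"

definition correlation :: "'w measure \<Rightarrow> ('w \<Rightarrow> real) \<Rightarrow> ('w \<Rightarrow> real) \<Rightarrow> real" where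
  "correlation M X Y =
     (\<integral>\<omega>. (X \<omega> - (\<integral>x. X x \<partial>M)) * (Y \<omega> - (\<integral>x. Y x \<partial>M)) \<partial>M) /
     sqrt (prob_space.variance M X * prob_space.variance M Y)"

text \<open>Weak stationarity is the combination of constant mean, constant variance and a
  correlation depending on the lag only. The values of \<open>\<rho>\<close> off the differences of
  points of \<open>A\<close> are irrelevant.\<close>

definition parent_process ::
    "'w measure \<Rightarrow> 's::euclidean_space set \<Rightarrow> ('s \<Rightarrow> real) \<Rightarrow> ('s \<Rightarrow> 'w \<Rightarrow> real) \<Rightarrow> bool" where
  "parent_process M A \<rho> G \<longleftrightarrow>
     gaussian_process M A G \<and>
     (\<forall>s\<in>A. prob_space.expectation M (G s) = 0) \<and>
     (\<forall>s\<in>A. prob_space.variance M (G s) = 1) \<and>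
     (\<forall>s\<in>A. \<forall>t\<in>A. correlation M (G s) (G t) = \<rho> (s - t))"

definition hyp0F1 :: "real \<Rightarrow> real \<Rightarrow> real" where
  "hyp0F1 b x = (\<Sum>k. x ^ k / (fact k * pochhammer b k))"

definition appell_F4 ::
    "real \<Rightarrow> real \<Rightarrow> real \<Rightarrow> real \<Rightarrow> real \<Rightarrow> real \<Rightarrow> real" where
  "appell_F4 a b c c' w z =
     (\<Sum>k. \<Sum>m. pochhammer a (k + m) * pochhammer b (k + m) * w ^ k * z ^ m /
              (fact k * fact m * pochhammer c k * pochhammer c' m))"

definition bivariate_gamma_density :: "real \<Rightarrow> real \<Rightarrow> real \<times> real \<Rightarrow> real" where
  "bivariate_gamma_density \<nu> r = (\<lambda>(u, v).
     if 0 < u \<and> 0 < v then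
       2 powr (- \<nu>) * \<nu> powr \<nu> * (u * v) powr (\<nu> / 2 - 1) /
         ((Gamma (\<nu> / 2))\<^sup>2 * (1 - r\<^sup>2) powr (\<nu> / 2)) *
       exp (- (\<nu> * (u + v) / (2 * (1 - r\<^sup>2)))) *
       hyp0F1 (\<nu> / 2) (\<nu>\<^sup>2 * r\<^sup>2 * u * v / (4 * (1 - r\<^sup>2)\<^sup>2))
     else 0)"

text \<open>For integer \<open>n\<close>: the average of \<open>n\<close> squared independent copies \<open>H 1, \<dots>, H n\<close> of
  \<open>G = H 0\<close>, all of them (including \<open>G\<close>) jointly independent as processes on \<open>A\<close>.\<close>

definition chi_square_mixing ::
    "'w measure \<Rightarrow> 's set \<Rightarrow> nat \<Rightarrow> ('s \<Rightarrow> 'w \<Rightarrow> real) \<Rightarrow> ('s \<Rightarrow> 'w \<Rightarrow> real) \<Rightarrow> bool" where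
  "chi_square_mixing M A n G W \<longleftrightarrow>
     (\<exists>H. H 0 = G \<and>
        prob_space.indep_vars M (\<lambda>_. PiM A (\<lambda>_. borel)) (\<lambda>i. sample_path A (H i)) {0..n} \<and>
        (\<forall>i\<in>{1..n}. distr M (PiM A (\<lambda>_. borel)) (sample_path A (H i)) =
                     distr M (PiM A (\<lambda>_. borel)) (sample_path A G)) \<and>
        (\<forall>s\<in>A. \<forall>\<omega>\<in>space M. W s \<omega> = (1 / real n) * (\<Sum>i=1..n. (H i s \<omega>)\<^sup>2)))"

text \<open>For non-integer \<open>\<nu>\<close> only the bivariate laws of the mixing process are specified (a
  process having all of them need not exist), so the condition concerns the pair of sites
  \<open>s\<close>, \<open>t\<close> at hand. Independence from \<open>G\<close> is stated for the generated sigma-algebras, as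
  \<open>indep_var\<close> only relates random variables of the same type.\<close>

definition gamma_mixing ::
    "'w measure \<Rightarrow> 's::euclidean_space set \<Rightarrow> ('s \<Rightarrow> real) \<Rightarrow> real \<Rightarrow>
     ('s \<Rightarrow> 'w \<Rightarrow> real) \<Rightarrow> ('s \<Rightarrow> 'w \<Rightarrow> real) \<Rightarrow> 's \<Rightarrow> 's \<Rightarrow> bool" where
  "gamma_mixing M A \<rho> \<nu> G W s t \<longleftrightarrow>
     (if \<nu> \<in> \<nat> then (\<exists>n. \<nu> = real n \<and> chi_square_mixing M A n G W)
      else
        prob_space.indep_set M
          (sets (vimage_algebra (space M) (\<lambda>\<omega>. (W s \<omega>, W t \<omega>)) borel))
          (sets (vimage_algebra (space M) (sample_path A G) (PiM A (\<lambda>_. borel)))) \<and>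
        distributed M lborel (\<lambda>\<omega>. (W s \<omega>, W t \<omega>))
          (\<lambda>w. ennreal (bivariate_gamma_density \<nu> (\<rho> (s - t)) w)))"

definition t_process ::
    "('s \<Rightarrow> 'w \<Rightarrow> real) \<Rightarrow> ('s \<Rightarrow> 'w \<Rightarrow> real) \<Rightarrow> 's \<Rightarrow> 'w \<Rightarrow> real" where
  "t_process W G s \<omega> = W s \<omega> powr (- 1 / 2) * G s \<omega>"

end

(* The even and odd parts in the correlation term separate the integral of the scaled binormal density
   against the mixing density into two integrals of products of two 0F1 functions, since
   exp x = cosh x + sinh x, and cosh and sinh are 0F1 functions of x^2/4 with parameters 1/2 and 3/2
   (the latter up to the factor x). Integrating the two power series termwise against gamma weights
   gives exactly the two F4 series. Up to the sign of rho y_i y_j all terms are nonnegative, so only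
   finiteness is left to check, and it follows from |y_i y_j| + nu <= sqrt l.

   For integer nu the law of the mixing pair has to be computed first. The density in question is a
   negative binomial mixture, over k, of products of two gamma densities of the same shape nu/2 + k.
   Such mixtures are closed under convolution, by the Beta integral and the Vandermonde identity, and
   the squares of a binormal pair give the case nu = 1. *)

theory Submission
  imports Defs
begin

section \<open>Hypergeometric functions and gamma densities\<close>

text \<open>Sums and integrals are interchanged in \<open>ennreal\<close>, where Tonelli needs no
  convergence. The obstacle is the return to the reals: \<open>appell_F4\<close> is an iterated real
  \<open>suminf\<close>, whose value means something only if the series converge, so an F4 value can
  be read off only from an integral known to be finite. The square roots of the two arguments of F4
  add up to |\<rho>| (|y_i y_j| + \<nu>) / sqrt l. The inequality of the overview is Cauchy-Schwarz
  for (|y_i|, sqrt \<nu>) and (|y_j|, sqrt \<nu>), and the factor |\<rho>| < 1 then leaves a margin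
  inside the region of convergence. If \<rho> y_i y_j < 0, the odd part is subtracted; sinh <= cosh
  both keeps the difference nonnegative and bounds the subtrahend by the finite even part.

  Integer and non-integer \<nu> meet in one statement, namely that the mixing pair is independent of
  the Gaussian pair and has the bivariate gamma density; the computation of the mixed density starts
  from there.\<close>

lemma pochhammer_ge_min_1:
  assumes "(b::real) > 0"
  shows "min b 1 \<le> pochhammer b k"
proof (cases k)
  case (Suc n)
  have "1 \<le> pochhammer (b + 1) n"
  proof (induction n)
    case (Suc n)
    have "1 * 1 \<le> pochhammer (b + 1) n * (b + 1 + real n)"
      using Suc assms by (intro mult_mono) auto
    then show ?case by (simp add: pochhammer_Suc)
  qed simp
  then have "b * 1 \<le> b * pochhammer (b + 1) n"
    using assms by (intro mult_left_mono) auto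
  then show ?thesis by (simp add: Suc pochhammer_rec)
qed simp

text \<open>The rising factorials are bounded below by \<open>min b 1\<close> uniformly in
  \<open>k\<close>, so the exponential series of |x| dominates.\<close>

lemma summable_hyp0F1:
  assumes "(b::real) > 0"
  shows "summable (\<lambda>k. x ^ k / (fact k * pochhammer b k))"
proof (rule summable_comparison_test')
  show "summable (\<lambda>k. 1 / min b 1 * (inverse (fact k) * \<bar>x\<bar> ^ k))"
    by (intro summable_mult summable_exp)
  fix k :: nat
  have "\<bar>x\<bar> ^ k / (fact k * pochhammer b k) \<le> \<bar>x\<bar> ^ k / (fact k * min b 1)"
    using assms pochhammer_ge_min_1[OF assms, of k] pochhammer_pos[OF assms, of k]
    by (intro divide_left_mono mult_left_mono mult_pos_pos) auto
  then show "norm (x ^ k / (fact k * pochhammer b k)) \<le> 1 / min b 1 * (inverse (fact k) * \<bar>x\<bar> ^ k)"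
    using pochhammer_pos[OF assms, of k] by (simp add: field_simps abs_mult power_abs)
qed

lemma hyp0F1_nonneg: "b > 0 \<Longrightarrow> x \<ge> 0 \<Longrightarrow> 0 \<le> hyp0F1 b x"
  unfolding hyp0F1_def
  by (intro suminf_nonneg summable_hyp0F1 divide_nonneg_nonneg mult_nonneg_nonneg pochhammer_nonneg) auto

text \<open>Rising factorials in the denominators grow with the parameter. Together with the closed
  form at parameter 1/2 this bounds every \<open>hyp0F1 b\<close> with b >= 1/2 by a cosh on
  nonnegative arguments.\<close>

lemma hyp0F1_antimono:
  assumes "0 < a" "a \<le> b" "0 \<le> x"
  shows "hyp0F1 b x \<le> hyp0F1 a x"
  unfolding hyp0F1_def
proof (rule suminf_le)
  fix k
  have "pochhammer a k \<le> pochhammer b k"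
    unfolding pochhammer_prod by (rule prod_mono) (use assms in auto)
  then show "x ^ k / (fact k * pochhammer b k) \<le> x ^ k / (fact k * pochhammer a k)"
    using assms pochhammer_pos[of a k] pochhammer_pos[of b k]
    by (intro divide_left_mono mult_left_mono mult_pos_pos) auto
qed (use assms in \<open>auto intro!: summable_hyp0F1\<close>)

lemma hyp0F1_ennreal:
  assumes "b > 0" "x \<ge> 0"
  shows "ennreal (hyp0F1 b x) = (\<Sum>k. ennreal (x ^ k / (fact k * pochhammer b k)))"
  unfolding hyp0F1_def
  by (rule suminf_ennreal2[symmetric])
    (use assms in \<open>auto intro!: summable_hyp0F1 divide_nonneg_nonneg mult_nonneg_nonneg pochhammer_nonneg\<close>)

text \<open>Only the even terms of the exponential series contribute, and (2n)! = 4^n n!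
  (1/2)_n.\<close>

lemma hyp0F1_cosh: "hyp0F1 (1 / 2) (x\<^sup>2) = cosh (2 * x)"
proof -
  have "(\<lambda>n. if even n then (2 * x) ^ n /\<^sub>R fact n else 0) sums cosh (2 * x)"
    by (rule cosh_converges)
  then have "(\<lambda>n. if even (2 * n) then (2 * x) ^ (2 * n) /\<^sub>R fact (2 * n) else 0) sums cosh (2 * x)"
    by (subst sums_mono_reindex[where g = "\<lambda>n. 2 * n" and f = "\<lambda>n. if even n then (2 * x) ^ n /\<^sub>R fact n else 0"])
      (auto simp: strict_mono_def elim!: evenE)
  moreover have "(2 * x) ^ (2 * n) /\<^sub>R fact (2 * n) = (x\<^sup>2) ^ n / (fact n * pochhammer (1 / 2) n)" for n
  proof -
    have p: "(2 * x) ^ (2 * n) = 2 ^ (2 * n) * (x\<^sup>2) ^ n"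
      by (simp add: power_mult_distrib power_mult)
    show ?thesis unfolding p fact_double by (simp add: divide_simps)
  qed
  ultimately show ?thesis
    unfolding hyp0F1_def by (auto dest: sums_unique[symmetric])
qed

text \<open>The odd counterpart rests on (2n+1)! = 4^n n! (3/2)_n.\<close>

lemma hyp0F1_sinh: "2 * x * hyp0F1 (3 / 2) (x\<^sup>2) = sinh (2 * x)"
proof -
  have "(\<lambda>n. if even n then 0 else (2 * x) ^ n /\<^sub>R fact n) sums sinh (2 * x)"
    by (rule sinh_converges)
  then have "(\<lambda>n. if even (2 * n + 1) then 0 else (2 * x) ^ (2 * n + 1) /\<^sub>R fact (2 * n + 1)) sums sinh (2 * x)"
    by (subst sums_mono_reindex[where g = "\<lambda>n. 2 * n + 1" and f = "\<lambda>n. if even n then 0 else (2 * x) ^ n /\<^sub>R fact n"])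
      (auto simp: strict_mono_def elim!: oddE)
  moreover have "(2 * x) ^ (2 * n + 1) /\<^sub>R fact (2 * n + 1) = 2 * x * ((x\<^sup>2) ^ n / (fact n * pochhammer (3 / 2) n))" for n
  proof -
    \<comment> \<open>Splitting off the last and the first factor of (1/2)_{n+1} gives (3/2)_n =
      (2n+1) (1/2)_n, which reduces the claim to the formula for (2n)!.\<close>
    have "pochhammer (1 / 2 :: real) (Suc n) = pochhammer (1 / 2) n * (1 / 2 + real n)"
      by (rule pochhammer_Suc)
    moreover have "pochhammer (1 / 2 :: real) (Suc n) = 1 / 2 * pochhammer (3 / 2) n"
      by (simp add: pochhammer_rec)
    ultimately have p: "pochhammer (3 / 2 :: real) n = pochhammer (1 / 2) n * (2 * real n + 1)"
      by (simp add: algebra_simps)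
    have f: "fact (2 * n + 1) = (2 * real n + 1) * fact (2 * n)"
      by simp
    have "pochhammer (1 / 2 :: real) n > 0" by (rule pochhammer_pos) simp
    then show ?thesis unfolding p f
      by (simp add: fact_double power_mult_distrib power_mult divide_simps del: fact_Suc)
  qed
  ultimately have "(\<lambda>n. 2 * x * ((x\<^sup>2) ^ n / (fact n * pochhammer (3 / 2) n))) sums sinh (2 * x)"
    by simp
  then show ?thesis
    unfolding hyp0F1_def
    by (subst suminf_mult[symmetric]) (auto dest: sums_unique[symmetric] intro!: summable_hyp0F1)
qed

section \<open>Gamma integrals and convolution of gamma densities\<close>

lemma Gamma_plus_nat:
  assumes "(a::real) > 0"
  shows "Gamma (a + real k) = Gamma a * pochhammer a k"
proof -
  have "Gamma a \<noteq> 0" using Gamma_real_pos[OF assms] by simp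
  moreover have "a \<notin> \<int>\<^sub>\<le>\<^sub>0" using nonpos_Ints_nonpos[of a] assms by auto
  ultimately show ?thesis by (simp add: pochhammer_Gamma)
qed

text \<open>Euler's integral after the substitution t = a x. The endpoint is harmless, since 0
  raised to any power by \<open>powr\<close> is 0.\<close>

lemma nn_integral_Gamma:
  assumes p: "(p::real) > 0" and a: "a > 0"
  shows "(\<integral>\<^sup>+x. ennreal (indicator {0<..} x * (x powr (p - 1) * exp (- (a * x)))) \<partial>lborel) = ennreal (Gamma p / a powr p)"
proof -
  have "ennreal (Gamma p) = (\<integral>\<^sup>+t. ennreal (indicator {0..} t * t powr (p - 1) / exp t) \<partial>lborel)"
    using Gamma_conv_nn_integral_real[OF p] by simp
  also have "\<dots> = ennreal a * (\<integral>\<^sup>+x. ennreal (indicator {0..} (a * x) * (a * x) powr (p - 1) / exp (a * x)) \<partial>lborel)"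
    using a by (subst nn_integral_real_affine[where c = a and t = 0]) auto
  also have "\<dots> = (\<integral>\<^sup>+x. ennreal (a powr p) * ennreal (indicator {0<..} x * (x powr (p - 1) * exp (- (a * x)))) \<partial>lborel)"
    using a
    by (subst nn_integral_cmult[symmetric])
      (auto intro!: nn_integral_cong simp: ennreal_mult'[symmetric] indicator_def powr_mult zero_le_mult_iff
        exp_minus powr_diff field_simps)
  also have "\<dots> = ennreal (a powr p) * (\<integral>\<^sup>+x. ennreal (indicator {0<..} x * (x powr (p - 1) * exp (- (a * x)))) \<partial>lborel)"
    by (rule nn_integral_cmult) auto
  finally have *: "ennreal (Gamma p) = ennreal (a powr p) * (\<integral>\<^sup>+x. ennreal (indicator {0<..} x * (x powr (p - 1) * exp (- (a * x)))) \<partial>lborel)" .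
  have "ennreal (Gamma p / a powr p) = ennreal (1 / a powr p) * ennreal (Gamma p)"
    using a Gamma_real_pos[OF p] by (simp add: ennreal_mult'[symmetric])
  also have "\<dots> = ennreal (1 / a powr p) * ennreal (a powr p) * (\<integral>\<^sup>+x. ennreal (indicator {0<..} x * (x powr (p - 1) * exp (- (a * x)))) \<partial>lborel)"
    unfolding * by (simp add: mult.assoc)
  also have "ennreal (1 / a powr p) * ennreal (a powr p) = 1"
    using a by (simp add: ennreal_mult'[symmetric])
  finally show ?thesis by simp
qed

text \<open>Shape \<open>a\<close> and rate \<open>c\<close>; the extension by zero lets
  convolutions run over the whole line.\<close>

definition gamma_density :: "real \<Rightarrow> real \<Rightarrow> real \<Rightarrow> real" where
  "gamma_density a c x = (if 0 < x then c powr a / Gamma a * x powr (a - 1) * exp (- (c * x)) else 0)"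

lemma gamma_density_measurable [measurable]: "gamma_density a c \<in> borel_measurable borel"
  unfolding gamma_density_def[abs_def] by measurable

lemma gamma_density_nonneg: "a > 0 \<Longrightarrow> 0 \<le> gamma_density a c x"
  by (auto simp: gamma_density_def Gamma_real_pos less_imp_le)

text \<open>Because the rates agree, the exponentials combine to exp (- c x), which is constant in
  the variable of integration; with y = x t the rest is the Beta integral with parameters
  \<open>b\<close> and \<open>a\<close>. For x <= 0 the arguments x - y and y cannot both be
  positive.\<close>

lemma gamma_density_convolution:
  assumes a: "a > 0" and b: "b > 0" and c: "c > 0"
  shows "(\<integral>\<^sup>+y. ennreal (gamma_density a c (x - y)) * ennreal (gamma_density b c y) \<partial>lborel) =
    ennreal (gamma_density (a + b) c x)"
proof (cases "x > 0")
  case False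
  then have "(\<integral>\<^sup>+y. ennreal (gamma_density a c (x - y)) * ennreal (gamma_density b c y) \<partial>lborel) = (\<integral>\<^sup>+(y::real). 0 \<partial>lborel)"
    by (intro nn_integral_cong) (auto simp: gamma_density_def)
  with False show ?thesis by (simp add: gamma_density_def)
next
  case x: True
  \<comment> \<open>Everything except the Beta integrand; \<open>K\<close> times
    \<open>Beta b a\<close> is the claimed value.\<close>
  define K where "K = c powr (a + b) / (Gamma a * Gamma b) * x powr (a + b - 1) * exp (- (c * x))"
  have K: "K \<ge> 0" unfolding K_def using a b by (auto simp: Gamma_real_pos less_imp_le)
  have "(\<integral>\<^sup>+y. ennreal (gamma_density a c (x - y)) * ennreal (gamma_density b c y) \<partial>lborel) =
     ennreal x * (\<integral>\<^sup>+t. ennreal (gamma_density a c (x - x * t)) * ennreal (gamma_density b c (x * t)) \<partial>lborel)"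
    using x by (subst nn_integral_real_affine[where c = x and t = 0]) auto
  also have "\<dots> = (\<integral>\<^sup>+t. ennreal x * (ennreal (gamma_density a c (x - x * t)) * ennreal (gamma_density b c (x * t))) \<partial>lborel)"
    by (rule nn_integral_cmult[symmetric]) measurable
  also have "\<dots> = (\<integral>\<^sup>+t. ennreal K * ennreal (indicator {0..1} t * (t powr (b - 1) * (1 - t) powr (a - 1))) \<partial>lborel)"
  proof (intro nn_integral_cong)
    fix t :: real
    show "ennreal x * (ennreal (gamma_density a c (x - x * t)) * ennreal (gamma_density b c (x * t))) =
      ennreal K * ennreal (indicator {0..1} t * (t powr (b - 1) * (1 - t) powr (a - 1)))"
    proof (cases "0 < t \<and> t < 1")
      case True
      have eq: "x - x * t = x * (1 - t)" by (simp add: algebra_simps)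
      have "x * (gamma_density a c (x - x * t) * gamma_density b c (x * t)) =
        K * (t powr (b - 1) * (1 - t) powr (a - 1))"
      proof -
        have e: "exp (- (c * (x * (1 - t)))) * exp (- (c * (x * t))) = exp (- (c * x))"
          by (simp add: exp_add[symmetric] algebra_simps)
        have p: "x * ((x * (1 - t)) powr (a - 1) * (x * t) powr (b - 1)) = x powr (a + b - 1) * (t powr (b - 1) * (1 - t) powr (a - 1))"
        proof -
          have "x * (x powr (a - 1) * x powr (b - 1)) = x powr 1 * (x powr (a - 1) * x powr (b - 1))"
            using x by simp
          also have "\<dots> = x powr (a + b - 1)"
            by (simp only: powr_add[symmetric]) (simp add: algebra_simps)
          finally show ?thesis
            using True x by (simp add: powr_mult ac_simps)
        qed
        have q: "c powr a * c powr b = c powr (a + b)" by (simp add: powr_add)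
        have "x * (gamma_density a c (x - x * t) * gamma_density b c (x * t)) =
          (c powr a * c powr b) / (Gamma a * Gamma b) * (x * ((x * (1 - t)) powr (a - 1) * (x * t) powr (b - 1))) *
          (exp (- (c * (x * (1 - t)))) * exp (- (c * (x * t))))"
          unfolding eq using True x by (simp add: gamma_density_def)
        then show ?thesis unfolding e p q K_def by simp
      qed
      then show ?thesis
        using True x K a b
        by (simp add: ennreal_mult'[symmetric] ennreal_mult''[symmetric] gamma_density_nonneg)
    next
      case False
      then have "t \<le> 0 \<or> t \<ge> 1" by auto
      then show ?thesis
        using x by (auto simp: gamma_density_def indicator_def mult_le_0_iff zero_less_mult_iff)
    qed
  qed
  also have "\<dots> = ennreal K * (\<integral>\<^sup>+t. ennreal (indicator {0..1} t * (t powr (b - 1) * (1 - t) powr (a - 1))) \<partial>lborel)"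
    by (rule nn_integral_cmult) measurable
  also have "(\<integral>\<^sup>+t. ennreal (indicator {0..1} t * (t powr (b - 1) * (1 - t) powr (a - 1))) \<partial>lborel) = ennreal (Beta b a)"
    using nn_integral_has_integral_lebesgue[OF _ has_integral_Beta_real[OF b a]] by simp
  also have "ennreal K * ennreal (Beta b a) = ennreal (gamma_density (a + b) c x)"
    using K x Gamma_real_pos[OF a, THEN less_imp_neq] Gamma_real_pos[OF b, THEN less_imp_neq]
    by (simp add: ennreal_mult'[symmetric] gamma_density_def K_def Beta_def add.commute mult.assoc)
  finally show ?thesis .
qed

section \<open>The integral representation of the Appell function\<close>

lemma nn_integral_lborel_prod_mult:
  fixes f g :: "real \<Rightarrow> ennreal"
  assumes [measurable]: "f \<in> borel_measurable borel" "g \<in> borel_measurable borel"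
  shows "(\<integral>\<^sup>+w. f (fst w) * g (snd w) \<partial>lborel) = (\<integral>\<^sup>+u. f u \<partial>lborel) * (\<integral>\<^sup>+v. g v \<partial>lborel)"
proof -
  have "(\<integral>\<^sup>+w. f (fst w) * g (snd w) \<partial>lborel) = (\<integral>\<^sup>+u. \<integral>\<^sup>+v. f u * g v \<partial>lborel \<partial>lborel)"
    unfolding lborel_prod[symmetric] by (subst lborel.nn_integral_fst[symmetric]) auto
  then show ?thesis
    by (simp add: nn_integral_cmult nn_integral_multc)
qed

text \<open>The common form of the even and the odd integrand in the mixing variables:
  \<open>a\<^sub>1\<close> and \<open>a\<^sub>2\<close> are exponential rates, \<open>X\<close> and
  \<open>Z\<close> the coefficients of u v in the arguments of the two series.\<close>

definition hyp0F1_kernel :: "real \<Rightarrow> real \<Rightarrow> real \<Rightarrow> real \<Rightarrow> real \<Rightarrow> real \<Rightarrow> real \<Rightarrow> real \<times> real \<Rightarrow> real" where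
  "hyp0F1_kernel p a\<^sub>1 a\<^sub>2 b X b' Z = (\<lambda>(u, v).
     if 0 < u \<and> 0 < v then
       (u * v) powr (p - 1) * exp (- (a\<^sub>1 * u + a\<^sub>2 * v)) * hyp0F1 b (X * (u * v)) * hyp0F1 b' (Z * (u * v))
     else 0)"

lemma hyp0F1_measurable [measurable]: "hyp0F1 b \<in> borel_measurable borel"
  unfolding hyp0F1_def[abs_def] by measurable

lemma hyp0F1_kernel_measurable [measurable]:
  "hyp0F1_kernel p a\<^sub>1 a\<^sub>2 b X b' Z \<in> borel_measurable borel"
  unfolding hyp0F1_kernel_def[abs_def] case_prod_beta borel_prod[symmetric] by measurable

text \<open>A finite double sum in \<open>ennreal\<close> forces each inner series, and with them
  the outer one, to be summable over the reals. This is what gives the iterated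
  \<open>suminf\<close> in \<open>appell_F4\<close> its intended value.\<close>

lemma suminf_suminf_ennreal:
  fixes t :: "nat \<Rightarrow> nat \<Rightarrow> real"
  assumes t: "\<And>k m. 0 \<le> t k m" and fin: "(\<Sum>k. \<Sum>m. ennreal (t k m)) \<noteq> \<top>"
  shows "(\<Sum>k. \<Sum>m. ennreal (t k m)) = ennreal (\<Sum>k. \<Sum>m. t k m)" "0 \<le> (\<Sum>k. \<Sum>m. t k m)"
proof -
  have inner_fin: "(\<Sum>m. ennreal (t k m)) \<noteq> \<top>" for k
  proof
    assume *: "(\<Sum>m. ennreal (t k m)) = \<top>"
    have "(\<Sum>m. ennreal (t k m)) \<le> (\<Sum>k. \<Sum>m. ennreal (t k m))"
      using sum_le_suminf[of "\<lambda>k. \<Sum>m. ennreal (t k m)" "{k}"] by simp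
    with * fin show False by (simp add: top_unique)
  qed
  have sm: "summable (t k)" for k
    by (rule summable_suminf_not_top[OF t inner_fin])
  have inner: "(\<Sum>m. ennreal (t k m)) = ennreal (\<Sum>m. t k m)" for k
    by (rule suminf_ennreal2[OF t sm])
  have nn: "0 \<le> (\<Sum>m. t k m)" for k
    by (rule suminf_nonneg[OF sm t])
  have so: "summable (\<lambda>k. \<Sum>m. t k m)"
    using fin unfolding inner by (rule summable_suminf_not_top[OF nn])
  show "(\<Sum>k. \<Sum>m. ennreal (t k m)) = ennreal (\<Sum>k. \<Sum>m. t k m)"
    unfolding inner by (rule suminf_ennreal2[OF nn so])
  show "0 \<le> (\<Sum>k. \<Sum>m. t k m)"
    by (rule suminf_nonneg[OF so nn])
qed

text \<open>A term of the first series times a term of the second is a constant times (u v)^(k+m),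
  so its integral factors into two gamma integrals of shape p + k + m. The factor Gamma (p + k +
  m)^2 = (Gamma p)^2 ((p)_{k+m})^2 is why both upper parameters of F4 equal \<open>p\<close>. Both
  sides may be infinite.\<close>

lemma nn_integral_hyp0F1_kernel_series:
  assumes p: "p > 0" and a: "a\<^sub>1 > 0" "a\<^sub>2 > 0" and b: "b > 0" "b' > 0" and XZ: "X \<ge> 0" "Z \<ge> 0"
  shows "(\<integral>\<^sup>+w. ennreal (hyp0F1_kernel p a\<^sub>1 a\<^sub>2 b X b' Z w) \<partial>lborel) =
    (\<Sum>k. \<Sum>m. ennreal ((Gamma p)\<^sup>2 / (a\<^sub>1 * a\<^sub>2) powr p *
       (pochhammer p (k + m) * pochhammer p (k + m) * (X / (a\<^sub>1 * a\<^sub>2)) ^ k * (Z / (a\<^sub>1 * a\<^sub>2)) ^ m /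
              (fact k * fact m * pochhammer b k * pochhammer b' m))))"
proof -
  \<comment> \<open>\<open>q\<close> holds the coefficients; \<open>g\<close> is the gamma weight
    that has absorbed the power k + m.\<close>
  define q where "q k m = X ^ k / (fact k * pochhammer b k) * (Z ^ m / (fact m * pochhammer b' m))" for k m
  define g where "g a n u = indicator {0<..} u * (u powr (p + real n - 1) * exp (- (a * u)))" for a n u
  have g_nn: "0 \<le> g a n u" for a n u by (simp add: g_def)
  have [measurable]: "g a n \<in> borel_measurable borel" for a n unfolding g_def[abs_def] by measurable
  have q_nn: "0 \<le> q k m" for k m
    using b XZ by (auto simp: q_def intro!: mult_nonneg_nonneg divide_nonneg_nonneg pochhammer_nonneg)
  have expand: "ennreal (hyp0F1_kernel p a\<^sub>1 a\<^sub>2 b X b' Z w) =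
    (\<Sum>k. \<Sum>m. ennreal (q k m) * (ennreal (g a\<^sub>1 (k + m) (fst w)) * ennreal (g a\<^sub>2 (k + m) (snd w))))" for w
  proof (cases "0 < fst w \<and> 0 < snd w")
    case True
    define u v where "u = fst w" and "v = snd w"
    have uv: "0 < u" "0 < v" using True by (auto simp: u_def v_def)
    define E where "E = (u * v) powr (p - 1) * exp (- (a\<^sub>1 * u + a\<^sub>2 * v))"
    have E: "E \<ge> 0" by (simp add: E_def)
    have "ennreal (hyp0F1_kernel p a\<^sub>1 a\<^sub>2 b X b' Z w) =
       ennreal E * (ennreal (hyp0F1 b (X * (u * v))) * ennreal (hyp0F1 b' (Z * (u * v))))"
      using uv XZ b E hyp0F1_nonneg
      by (simp add: hyp0F1_kernel_def case_prod_beta u_def[symmetric] v_def[symmetric] E_def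
          ennreal_mult'[symmetric] ennreal_mult''[symmetric] mult.assoc)
    also have "\<dots> = (\<Sum>k. \<Sum>m. ennreal E * (ennreal ((X * (u * v)) ^ k / (fact k * pochhammer b k)) *
        ennreal ((Z * (u * v)) ^ m / (fact m * pochhammer b' m))))"
      using uv XZ b by (subst (1 2) hyp0F1_ennreal) auto
    also have "\<dots> = (\<Sum>k. \<Sum>m. ennreal (q k m) * (ennreal (g a\<^sub>1 (k + m) (fst w)) * ennreal (g a\<^sub>2 (k + m) (snd w))))"
    proof (intro suminf_cong)
      fix k m
      have nn: "0 \<le> (X * (u * v)) ^ k / (fact k * pochhammer b k)" "0 \<le> (Z * (u * v)) ^ m / (fact m * pochhammer b' m)"
        using b XZ uv by (auto intro!: mult_nonneg_nonneg divide_nonneg_nonneg pochhammer_nonneg)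
      have em: "ennreal x * (ennreal y * ennreal z) = ennreal (x * (y * z))" if "0 \<le> x" "0 \<le> y" "0 \<le> z" for x y z
        using that by (simp add: ennreal_mult)
      have "E * ((X * (u * v)) ^ k / (fact k * pochhammer b k) * ((Z * (u * v)) ^ m / (fact m * pochhammer b' m))) =
        q k m * (g a\<^sub>1 (k + m) u * g a\<^sub>2 (k + m) v)"
      proof -
        have g: "g a (k + m) x = x powr (p - 1) * x ^ k * x ^ m * exp (- (a * x))" if "x > 0" for a x
        proof -
          have "x powr (p + real (k + m) - 1) = x powr ((p - 1) + real (k + m))" by (simp add: algebra_simps)
          also have "\<dots> = x powr (p - 1) * x ^ (k + m)"
            by (subst powr_add) (use that in \<open>simp add: powr_realpow del: of_nat_add\<close>)
          finally show ?thesis using that by (simp add: g_def power_add)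
        qed
        show ?thesis
        proof -
          have "exp (- (a\<^sub>1 * u + a\<^sub>2 * v)) = exp (- (a\<^sub>1 * u)) * exp (- (a\<^sub>2 * v))"
            unfolding exp_add[symmetric] by simp
          then show ?thesis
            using uv unfolding E_def by (simp add: g q_def power_mult_distrib powr_mult)
        qed
      qed
      then show "ennreal E * (ennreal ((X * (u * v)) ^ k / (fact k * pochhammer b k)) *
        ennreal ((Z * (u * v)) ^ m / (fact m * pochhammer b' m))) =
        ennreal (q k m) * (ennreal (g a\<^sub>1 (k + m) (fst w)) * ennreal (g a\<^sub>2 (k + m) (snd w)))"
        using E g_nn q_nn nn by (simp add: em u_def v_def)
    qed
    finally show ?thesis .
  next
    case False
    then show ?thesis by (auto simp: hyp0F1_kernel_def case_prod_beta g_def)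
  qed
  have "(\<integral>\<^sup>+w. ennreal (hyp0F1_kernel p a\<^sub>1 a\<^sub>2 b X b' Z w) \<partial>lborel) =
    (\<Sum>k. \<Sum>m. \<integral>\<^sup>+w. ennreal (q k m) * (ennreal (g a\<^sub>1 (k + m) (fst w)) * ennreal (g a\<^sub>2 (k + m) (snd w))) \<partial>lborel)"
    unfolding expand borel_prod[symmetric]
    by (subst nn_integral_suminf, simp add: borel_prod[symmetric])
      (subst nn_integral_suminf, auto simp: borel_prod[symmetric])
  also have "\<dots> = (\<Sum>k. \<Sum>m. ennreal (q k m) * (ennreal (Gamma (p + real (k + m)) / a\<^sub>1 powr (p + real (k + m))) *
      ennreal (Gamma (p + real (k + m)) / a\<^sub>2 powr (p + real (k + m)))))"
  proof (intro suminf_cong)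
    fix k m
    have gi: "(\<integral>\<^sup>+u. ennreal (g a n u) \<partial>lborel) = ennreal (Gamma (p + real n) / a powr (p + real n))" if "a > 0" for a n
      unfolding g_def using p that by (intro nn_integral_Gamma) auto
    have "(\<integral>\<^sup>+w. ennreal (q k m) * (ennreal (g a\<^sub>1 (k + m) (fst w)) * ennreal (g a\<^sub>2 (k + m) (snd w))) \<partial>lborel) =
      ennreal (q k m) * (\<integral>\<^sup>+w. ennreal (g a\<^sub>1 (k + m) (fst w)) * ennreal (g a\<^sub>2 (k + m) (snd w)) \<partial>lborel)"
      by (rule nn_integral_cmult) (simp add: borel_prod[symmetric])
    then show "(\<integral>\<^sup>+w. ennreal (q k m) * (ennreal (g a\<^sub>1 (k + m) (fst w)) * ennreal (g a\<^sub>2 (k + m) (snd w))) \<partial>lborel) =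
      ennreal (q k m) * (ennreal (Gamma (p + real (k + m)) / a\<^sub>1 powr (p + real (k + m))) *
      ennreal (Gamma (p + real (k + m)) / a\<^sub>2 powr (p + real (k + m))))"
      using a nn_integral_lborel_prod_mult[of "\<lambda>u. ennreal (g a\<^sub>1 (k + m) u)" "\<lambda>v. ennreal (g a\<^sub>2 (k + m) v)"]
      by (simp add: gi del: of_nat_add)
  qed
  also have "\<dots> = (\<Sum>k. \<Sum>m. ennreal ((Gamma p)\<^sup>2 / (a\<^sub>1 * a\<^sub>2) powr p *
       (pochhammer p (k + m) * pochhammer p (k + m) * (X / (a\<^sub>1 * a\<^sub>2)) ^ k * (Z / (a\<^sub>1 * a\<^sub>2)) ^ m /
              (fact k * fact m * pochhammer b k * pochhammer b' m))))"
  proof (intro suminf_cong)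
    fix k m
    have pw: "a powr (p + real (k + m)) = a powr p * a ^ k * a ^ m" if "a > 0" for a
      by (subst powr_add) (use that in \<open>simp add: powr_realpow power_add del: of_nat_add\<close>)
    have "q k m * (Gamma (p + real (k + m)) / a\<^sub>1 powr (p + real (k + m)) *
      (Gamma (p + real (k + m)) / a\<^sub>2 powr (p + real (k + m)))) = (Gamma p)\<^sup>2 / (a\<^sub>1 * a\<^sub>2) powr p *
       (pochhammer p (k + m) * pochhammer p (k + m) * (X / (a\<^sub>1 * a\<^sub>2)) ^ k * (Z / (a\<^sub>1 * a\<^sub>2)) ^ m /
              (fact k * fact m * pochhammer b k * pochhammer b' m))"
      unfolding Gamma_plus_nat[OF p] pw[OF a(1)] pw[OF a(2)] q_def
      using a by (simp add: powr_mult power_mult_distrib power_divide power2_eq_square ac_simps)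
    moreover have "0 \<le> Gamma (p + real (k + m)) / a powr (p + real (k + m))" for a
      using p by (intro divide_nonneg_nonneg less_imp_le[OF Gamma_real_pos]) auto
    ultimately show "ennreal (q k m) * (ennreal (Gamma (p + real (k + m)) / a\<^sub>1 powr (p + real (k + m))) *
      ennreal (Gamma (p + real (k + m)) / a\<^sub>2 powr (p + real (k + m)))) = ennreal ((Gamma p)\<^sup>2 / (a\<^sub>1 * a\<^sub>2) powr p *
       (pochhammer p (k + m) * pochhammer p (k + m) * (X / (a\<^sub>1 * a\<^sub>2)) ^ k * (Z / (a\<^sub>1 * a\<^sub>2)) ^ m /
              (fact k * fact m * pochhammer b k * pochhammer b' m)))"
      using q_nn by (simp add: ennreal_mult'[symmetric] del: of_nat_add)
  qed
  finally show ?thesis .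
qed

text \<open>Dividing the finite integral by the positive constant \<open>C\<close> shows that the
  double series of nonnegative terms is finite, hence equal to its real counterpart.\<close>

lemma nn_integral_hyp0F1_kernel:
  assumes p: "p > 0" and a: "a\<^sub>1 > 0" "a\<^sub>2 > 0" and b: "b > 0" "b' > 0" and XZ: "X \<ge> 0" "Z \<ge> 0"
    and fin: "(\<integral>\<^sup>+w. ennreal (hyp0F1_kernel p a\<^sub>1 a\<^sub>2 b X b' Z w) \<partial>lborel) \<noteq> \<top>"
  shows "(\<integral>\<^sup>+w. ennreal (hyp0F1_kernel p a\<^sub>1 a\<^sub>2 b X b' Z w) \<partial>lborel) =
      ennreal ((Gamma p)\<^sup>2 / (a\<^sub>1 * a\<^sub>2) powr p * appell_F4 p p b b' (X / (a\<^sub>1 * a\<^sub>2)) (Z / (a\<^sub>1 * a\<^sub>2)))"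
    and "0 \<le> appell_F4 p p b b' (X / (a\<^sub>1 * a\<^sub>2)) (Z / (a\<^sub>1 * a\<^sub>2))"
proof -
  define C where "C = (Gamma p)\<^sup>2 / (a\<^sub>1 * a\<^sub>2) powr p"
  have C: "C > 0"
    unfolding C_def by (intro divide_pos_pos zero_less_power Gamma_real_pos p) (use a in simp)
  define t where "t k m = pochhammer p (k + m) * pochhammer p (k + m) * (X / (a\<^sub>1 * a\<^sub>2)) ^ k * (Z / (a\<^sub>1 * a\<^sub>2)) ^ m /
              (fact k * fact m * pochhammer b k * pochhammer b' m)" for k m
  have t: "0 \<le> t k m" for k m
    unfolding t_def using p a b XZ
    by (intro mult_nonneg_nonneg divide_nonneg_nonneg pochhammer_nonneg zero_le_power) auto
  have eq: "(\<integral>\<^sup>+w. ennreal (hyp0F1_kernel p a\<^sub>1 a\<^sub>2 b X b' Z w) \<partial>lborel) = ennreal C * (\<Sum>k. \<Sum>m. ennreal (t k m))"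
    unfolding nn_integral_hyp0F1_kernel_series[OF p a b XZ] C_def[symmetric] t_def[symmetric]
    using C t by (simp add: ennreal_mult)
  have "(\<Sum>k. \<Sum>m. ennreal (t k m)) \<noteq> \<top>"
    using fin C unfolding eq by (auto simp: ennreal_mult_eq_top_iff)
  note s = suminf_suminf_ennreal[OF t this]
  have F: "appell_F4 p p b b' (X / (a\<^sub>1 * a\<^sub>2)) (Z / (a\<^sub>1 * a\<^sub>2)) = (\<Sum>k. \<Sum>m. t k m)"
    by (simp add: appell_F4_def t_def)
  show "0 \<le> appell_F4 p p b b' (X / (a\<^sub>1 * a\<^sub>2)) (Z / (a\<^sub>1 * a\<^sub>2))"
    using s(2) F by simp
  show "(\<integral>\<^sup>+w. ennreal (hyp0F1_kernel p a\<^sub>1 a\<^sub>2 b X b' Z w) \<partial>lborel) =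
      ennreal ((Gamma p)\<^sup>2 / (a\<^sub>1 * a\<^sub>2) powr p * appell_F4 p p b b' (X / (a\<^sub>1 * a\<^sub>2)) (Z / (a\<^sub>1 * a\<^sub>2)))"
    unfolding eq s(1) F C_def[symmetric] using C s(2) by (simp add: ennreal_mult)
qed

section \<open>Binormal laws\<close>

definition binormal_density :: "real \<Rightarrow> real \<times> real \<Rightarrow> real" where
  "binormal_density r = (\<lambda>(x, y).
     1 / (2 * pi * sqrt (1 - r\<^sup>2)) * exp (- ((x\<^sup>2 - 2 * r * x * y + y\<^sup>2) / (2 * (1 - r\<^sup>2)))))"

lemma binormal_density_measurable [measurable]: "binormal_density r \<in> borel_measurable borel"
  unfolding binormal_density_def[abs_def] case_prod_beta borel_prod[symmetric] by measurable

section \<open>Linear changes of variables in the plane\<close>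

lemma nn_integral_lborel_iterated:
  fixes K :: "real \<times> real \<Rightarrow> ennreal"
  assumes [measurable]: "K \<in> borel_measurable borel"
  shows "(\<integral>\<^sup>+z. K z \<partial>lborel) = (\<integral>\<^sup>+x. \<integral>\<^sup>+y. K (x, y) \<partial>lborel \<partial>lborel)"
    and "(\<integral>\<^sup>+z. K z \<partial>lborel) = (\<integral>\<^sup>+y. \<integral>\<^sup>+x. K (x, y) \<partial>lborel \<partial>lborel)"
proof -
  have [measurable]: "K \<in> borel_measurable (lborel \<Otimes>\<^sub>M lborel)"
    by (simp add: lborel_prod)
  show *: "(\<integral>\<^sup>+z. K z \<partial>lborel) = (\<integral>\<^sup>+x. \<integral>\<^sup>+y. K (x, y) \<partial>lborel \<partial>lborel)"
    by (subst lborel.nn_integral_fst) (simp_all add: lborel_prod)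
  show "(\<integral>\<^sup>+z. K z \<partial>lborel) = (\<integral>\<^sup>+y. \<integral>\<^sup>+x. K (x, y) \<partial>lborel \<partial>lborel)"
    unfolding * by (rule lborel_pair.Fubini'[symmetric]) simp
qed

lemma nn_integral_lborel_swap:
  fixes K :: "real \<times> real \<Rightarrow> ennreal"
  assumes [measurable]: "K \<in> borel_measurable borel"
  shows "(\<integral>\<^sup>+z. K (snd z, fst z) \<partial>lborel) = (\<integral>\<^sup>+z. K z \<partial>lborel)"
proof -
  have "(\<lambda>z. K (snd z, fst z)) \<in> borel_measurable borel"
    unfolding borel_prod[symmetric] by measurable
  from nn_integral_lborel_iterated(1)[OF this] show ?thesis
    by (simp add: nn_integral_lborel_iterated(2)[of K])
qed

text \<open>The substitution w = (a x + b y, c x + d y) is made one coordinate at a time: for fixed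
  y the first coordinate is replaced, which needs the pivot \<open>a\<close>, and for fixed first
  coordinate of w the second one is. The Jacobians 1/|a| and |a/D| combine to 1/|D|, and the inverse
  map is Cramer's rule.\<close>

lemma nn_integral_lborel_linear_pivot:
  fixes K :: "real \<times> real \<Rightarrow> ennreal"
  assumes [measurable]: "K \<in> borel_measurable borel"
    and D: "D = a * d - b * c" "D \<noteq> 0" and a: "a \<noteq> 0"
  shows "(\<integral>\<^sup>+z. K z \<partial>lborel) =
    ennreal (1 / \<bar>D\<bar>) * (\<integral>\<^sup>+w. K ((d * fst w - b * snd w) / D, (a * snd w - c * fst w) / D) \<partial>lborel)"
proof -
  have [measurable]: "K \<in> borel_measurable (borel \<Otimes>\<^sub>M borel)"
    by (simp add: borel_prod)
  have [measurable]: "(\<lambda>w. K ((d * fst w - b * snd w) / D, (a * snd w - c * fst w) / D)) \<in> borel_measurable borel"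
    unfolding borel_prod[symmetric] by measurable
  have "(\<integral>\<^sup>+z. K z \<partial>lborel) = (\<integral>\<^sup>+y. \<integral>\<^sup>+x. K (x, y) \<partial>lborel \<partial>lborel)"
    by (rule nn_integral_lborel_iterated) simp
  also have "\<dots> = (\<integral>\<^sup>+y. ennreal \<bar>1 / a\<bar> * (\<integral>\<^sup>+x. K (- (b * y / a) + 1 / a * x, y) \<partial>lborel) \<partial>lborel)"
    using a by (intro nn_integral_cong nn_integral_real_affine) auto
  also have "\<dots> = ennreal \<bar>1 / a\<bar> * (\<integral>\<^sup>+y. \<integral>\<^sup>+x. K (- (b * y / a) + 1 / a * x, y) \<partial>lborel \<partial>lborel)"
    by (rule nn_integral_cmult) measurable
  also have "(\<integral>\<^sup>+y. \<integral>\<^sup>+x. K (- (b * y / a) + 1 / a * x, y) \<partial>lborel \<partial>lborel) =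
    (\<integral>\<^sup>+x. \<integral>\<^sup>+y. K (- (b * y / a) + 1 / a * x, y) \<partial>lborel \<partial>lborel)"
    by (rule lborel_pair.Fubini') measurable
  also have "\<dots> = (\<integral>\<^sup>+x. ennreal \<bar>a / D\<bar> * (\<integral>\<^sup>+y. K (- (b * (- (c * x / D) + a / D * y) / a) + 1 / a * x, - (c * x / D) + a / D * y) \<partial>lborel) \<partial>lborel)"
    using a D by (intro nn_integral_cong nn_integral_real_affine) auto
  also have "\<dots> = ennreal \<bar>a / D\<bar> * (\<integral>\<^sup>+x. \<integral>\<^sup>+y. K (- (b * (- (c * x / D) + a / D * y) / a) + 1 / a * x, - (c * x / D) + a / D * y) \<partial>lborel \<partial>lborel)"
    by (rule nn_integral_cmult) measurable
  also have "(\<integral>\<^sup>+x. \<integral>\<^sup>+y. K (- (b * (- (c * x / D) + a / D * y) / a) + 1 / a * x, - (c * x / D) + a / D * y) \<partial>lborel \<partial>lborel) =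
    (\<integral>\<^sup>+x. \<integral>\<^sup>+y. K ((d * x - b * y) / D, (a * y - c * x) / D) \<partial>lborel \<partial>lborel)"
  proof (intro nn_integral_cong arg_cong[where f = K])
    fix x y
    have "- (b * (- (c * x / D) + a / D * y) / a) + 1 / a * x = (b * c * x - a * b * y + D * x) / (D * a)"
      using a D(2) by (simp add: field_simps)
    also have "b * c * x - a * b * y + D * x = (d * x - b * y) * a" unfolding D(1) by (simp add: algebra_simps)
    also have "(d * x - b * y) * a / (D * a) = (d * x - b * y) / D" using a by simp
    finally show "(- (b * (- (c * x / D) + a / D * y) / a) + 1 / a * x, - (c * x / D) + a / D * y) =
      ((d * x - b * y) / D, (a * y - c * x) / D)" using D(2) by (simp add: field_simps)
  qed
  also have "\<dots> = (\<integral>\<^sup>+w. K ((d * fst w - b * snd w) / D, (a * snd w - c * fst w) / D) \<partial>lborel)"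
    by (subst nn_integral_lborel_iterated(1)[of "\<lambda>w. K ((d * fst w - b * snd w) / D, (a * snd w - c * fst w) / D)"]) auto
  also have "ennreal \<bar>1 / a\<bar> * (ennreal \<bar>a / D\<bar> * (\<integral>\<^sup>+w. K ((d * fst w - b * snd w) / D, (a * snd w - c * fst w) / D) \<partial>lborel)) =
    ennreal (1 / \<bar>D\<bar>) * (\<integral>\<^sup>+w. K ((d * fst w - b * snd w) / D, (a * snd w - c * fst w) / D) \<partial>lborel)"
    using a by (simp add: mult.assoc[symmetric] ennreal_mult'[symmetric] abs_mult)
  finally show ?thesis .
qed

text \<open>If a = 0, then b is nonzero and exchanging the two coordinates makes it the pivot. The
  determinant changes sign, which the absolute value absorbs.\<close>

lemma nn_integral_lborel_linear:
  fixes K :: "real \<times> real \<Rightarrow> ennreal"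
  assumes [measurable]: "K \<in> borel_measurable borel"
    and D: "D = a * d - b * c" "D \<noteq> 0"
  shows "(\<integral>\<^sup>+z. K z \<partial>lborel) =
    ennreal (1 / \<bar>D\<bar>) * (\<integral>\<^sup>+w. K ((d * fst w - b * snd w) / D, (a * snd w - c * fst w) / D) \<partial>lborel)"
proof (cases "a = 0")
  case False
  from nn_integral_lborel_linear_pivot[OF assms this] show ?thesis .
next
  case True
  have b: "b \<noteq> 0" using D True by auto
  have [measurable]: "(\<lambda>z. K (snd z, fst z)) \<in> borel_measurable borel"
    unfolding borel_prod[symmetric] by measurable
  have "(\<integral>\<^sup>+z. K (snd z, fst z) \<partial>lborel) = ennreal (1 / \<bar>- D\<bar>) *
    (\<integral>\<^sup>+w. K (snd ((c * fst w - a * snd w) / (- D), (b * snd w - d * fst w) / (- D)),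
           fst ((c * fst w - a * snd w) / (- D), (b * snd w - d * fst w) / (- D))) \<partial>lborel)"
    by (rule nn_integral_lborel_linear_pivot[where K = "\<lambda>z. K (snd z, fst z)"]) (use D b in auto)
  moreover have "(b * snd w - d * fst w) / (- D) = (d * fst w - b * snd w) / D"
    "(c * fst w - a * snd w) / (- D) = (a * snd w - c * fst w) / D" for w
    using D(2) by (simp_all add: field_simps)
  ultimately show ?thesis
    by (simp add: nn_integral_lborel_swap)
qed

text \<open>For rows (a, b) and (c, d) of norm one with inner product r, Lagrange's identity gives
  D^2 = 1 - r^2. The image law therefore depends on the rows only through r.\<close>

lemma std_normal_pair_to_binormal:
  fixes F :: "real \<times> real \<Rightarrow> ennreal"
  assumes [measurable]: "F \<in> borel_measurable borel"
    and ab: "a\<^sup>2 + b\<^sup>2 = 1" and cd: "c\<^sup>2 + d\<^sup>2 = 1" and r: "a * c + b * d = r" "\<bar>r\<bar> < 1"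
  shows "(\<integral>\<^sup>+z. F (a * fst z + b * snd z, c * fst z + d * snd z) \<partial>(std_normal_distribution \<Otimes>\<^sub>M std_normal_distribution)) =
    (\<integral>\<^sup>+w. ennreal (binormal_density r w) * F w \<partial>lborel)"
proof -
  define D where "D = a * d - b * c"
  have DD: "D\<^sup>2 = 1 - r\<^sup>2"
  proof -
    have "D\<^sup>2 + r\<^sup>2 = (a\<^sup>2 + b\<^sup>2) * (c\<^sup>2 + d\<^sup>2)"
      unfolding D_def r(1)[symmetric] by (simp add: power2_eq_square algebra_simps)
    then show ?thesis using ab cd by simp
  qed
  have r1: "1 - r\<^sup>2 > 0" using r(2) by (simp add: abs_square_less_1)
  then have D: "D \<noteq> 0" using DD by auto
  have absD: "\<bar>D\<bar> = sqrt (1 - r\<^sup>2)" using DD by (metis real_sqrt_abs)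
  have [measurable]: "F \<in> borel_measurable (borel \<Otimes>\<^sub>M borel)" by (simp add: borel_prod)
  define K where "K z = ennreal (std_normal_density (fst z) * std_normal_density (snd z)) * F (a * fst z + b * snd z, c * fst z + d * snd z)" for z
  have [measurable]: "K \<in> borel_measurable borel"
    unfolding K_def[abs_def] borel_prod[symmetric] by measurable
  have N: "std_normal_distribution \<Otimes>\<^sub>M std_normal_distribution =
    density lborel (\<lambda>z. ennreal (std_normal_density (fst z) * std_normal_density (snd z)))"
  proof -
    interpret N: prob_space std_normal_distribution
      by (rule prob_space_normal_density) simp
    have "std_normal_distribution \<Otimes>\<^sub>M std_normal_distribution =
      density (lborel \<Otimes>\<^sub>M lborel) (\<lambda>(x, y). ennreal (std_normal_density x) * ennreal (std_normal_density y))"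
      by (intro pair_measure_density) (auto intro!: N.sigma_finite_measure_axioms lborel.sigma_finite_measure_axioms)
    then show ?thesis by (simp add: lborel_prod case_prod_beta' ennreal_mult)
  qed
  have "(\<integral>\<^sup>+z. F (a * fst z + b * snd z, c * fst z + d * snd z) \<partial>(std_normal_distribution \<Otimes>\<^sub>M std_normal_distribution)) = (\<integral>\<^sup>+z. K z \<partial>lborel)"
    unfolding N K_def
    by (rule nn_integral_density) (unfold lborel_prod[symmetric], measurable)
  also have "\<dots> = ennreal (1 / \<bar>D\<bar>) * (\<integral>\<^sup>+w. K ((d * fst w - b * snd w) / D, (a * snd w - c * fst w) / D) \<partial>lborel)"
    by (rule nn_integral_lborel_linear) (use D D_def in auto)
  also have "\<dots> = (\<integral>\<^sup>+w. ennreal (1 / \<bar>D\<bar>) * K ((d * fst w - b * snd w) / D, (a * snd w - c * fst w) / D) \<partial>lborel)"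
    by (rule nn_integral_cmult[symmetric]) (unfold lborel_prod[symmetric], measurable)
  also have "\<dots> = (\<integral>\<^sup>+w. ennreal (binormal_density r w) * F w \<partial>lborel)"
  proof (intro nn_integral_cong)
    fix w :: "real \<times> real"
    define x y where "x = fst w" and "y = snd w"
    define z1 z2 where "z1 = (d * x - b * y) / D" and "z2 = (a * y - c * x) / D"
    have "a * z1 + b * z2 = ((a * d - b * c) * x) / D"
      unfolding z1_def z2_def by (simp add: add_divide_distrib[symmetric] algebra_simps)
    then have 1: "a * z1 + b * z2 = x" using D by (simp add: D_def[symmetric])
    have "c * z1 + d * z2 = ((a * d - b * c) * y) / D"
      unfolding z1_def z2_def by (simp add: add_divide_distrib[symmetric] algebra_simps)
    then have 2: "c * z1 + d * z2 = y" using D by (simp add: D_def[symmetric])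
    \<comment> \<open>The standard normal exponent at the preimage: its quadratic form has the
      squared norms of the rows and their inner product as coefficients.\<close>
    have "z1\<^sup>2 + z2\<^sup>2 = ((d * x - b * y)\<^sup>2 + (a * y - c * x)\<^sup>2) / D\<^sup>2"
      by (simp add: z1_def z2_def power_divide add_divide_distrib)
    also have "(d * x - b * y)\<^sup>2 + (a * y - c * x)\<^sup>2 = (c\<^sup>2 + d\<^sup>2) * x\<^sup>2 - 2 * (a * c + b * d) * x * y + (a\<^sup>2 + b\<^sup>2) * y\<^sup>2"
      by (simp add: power2_eq_square algebra_simps)
    also have "\<dots> = x\<^sup>2 - 2 * r * x * y + y\<^sup>2" unfolding ab cd r(1) by simp
    finally have q: "z1\<^sup>2 + z2\<^sup>2 = (x\<^sup>2 - 2 * r * x * y + y\<^sup>2) / (1 - r\<^sup>2)" unfolding DD .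
    have "std_normal_density z1 * std_normal_density z2 = 1 / (2 * pi) * exp (- ((z1\<^sup>2 + z2\<^sup>2) / 2))"
      unfolding std_normal_density_def by (simp add: exp_add[symmetric] field_simps)
    also have "\<dots> = 1 / (2 * pi) * exp (- ((x\<^sup>2 - 2 * r * x * y + y\<^sup>2) / (2 * (1 - r\<^sup>2))))"
      unfolding q by (simp add: mult.commute)
    finally have "1 / \<bar>D\<bar> * (std_normal_density z1 * std_normal_density z2) = binormal_density r w"
      unfolding absD binormal_density_def case_prod_beta x_def y_def by simp
    then show "ennreal (1 / \<bar>D\<bar>) * K ((d * fst w - b * snd w) / D, (a * snd w - c * fst w) / D) =
       ennreal (binormal_density r w) * F w"
      unfolding K_def fst_conv snd_conv x_def[symmetric] y_def[symmetric] z1_def[symmetric] z2_def[symmetric] 1 2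
      by (simp add: mult.assoc[symmetric] ennreal_mult'[symmetric] x_def y_def)
  qed
  finally show ?thesis .
qed

section \<open>The law of the parent process at two sites\<close>

lemma integral_pair_mult:
  fixes f g :: "real \<Rightarrow> real"
  assumes "pair_sigma_finite M N" and f: "integrable M f" and g: "integrable N g"
  shows "integrable (M \<Otimes>\<^sub>M N) (\<lambda>z. f (fst z) * g (snd z))"
    and "(\<integral>z. f (fst z) * g (snd z) \<partial>(M \<Otimes>\<^sub>M N)) = (\<integral>x. f x \<partial>M) * (\<integral>y. g y \<partial>N)"
proof -
  interpret pair_sigma_finite M N by fact
  have [measurable]: "f \<in> borel_measurable M" "g \<in> borel_measurable N" using f g by auto
  show *: "integrable (M \<Otimes>\<^sub>M N) (\<lambda>z. f (fst z) * g (snd z))"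
    using f g by (intro Fubini_integrable) (auto simp: abs_mult)
  show "(\<integral>z. f (fst z) * g (snd z) \<partial>(M \<Otimes>\<^sub>M N)) = (\<integral>x. f x \<partial>M) * (\<integral>y. g y \<partial>N)"
    using integral_fst'[OF *] by simp
qed

text \<open>Serves to turn the prescribed mean, variance and correlation into equations for the
  coefficients of an affine image of a standard normal pair.\<close>

lemma std_normal_pair_moments:
  fixes \<mu> a b \<mu>' c d :: real
  defines "N \<equiv> std_normal_distribution \<Otimes>\<^sub>M std_normal_distribution"
  shows "(\<integral>z. \<mu> + (a * fst z + b * snd z) \<partial>N) = \<mu>"
    and "(\<integral>z. (a * fst z + b * snd z) * (c * fst z + d * snd z) \<partial>N) = a * c + b * d"
proof -
  interpret N: prob_space std_normal_distribution
    by (rule prob_space_normal_density) simp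
  have psf: "pair_sigma_finite std_normal_distribution std_normal_distribution"
    by (simp add: pair_sigma_finite_def N.sigma_finite_measure_axioms)
  interpret P: pair_prob_space std_normal_distribution std_normal_distribution ..
  have prob: "prob_space N" unfolding N_def by (rule P.prob_space_axioms)
  interpret NN: prob_space N by (rule prob)
  have i: "integrable std_normal_distribution (\<lambda>x. x)" "integrable std_normal_distribution (\<lambda>x. x\<^sup>2)"
    "integrable std_normal_distribution (\<lambda>x. 1 :: real)"
    using integrable_std_normal_distribution_moment[of 1] integrable_std_normal_distribution_moment[of 2] by auto
  have e: "(\<integral>x. x \<partial>std_normal_distribution) = 0" "(\<integral>x. x\<^sup>2 \<partial>std_normal_distribution) = 1"
    "(\<integral>x. (1::real) \<partial>std_normal_distribution) = 1"
    using integral_std_normal_distribution_moment_odd[of 1] std_normal_distribution_even_moments(1)[of 1] N.prob_space by simp_all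
  note m = integral_pair_mult[OF psf, folded N_def]
  have 1: "integrable N fst" "(\<integral>z. fst z \<partial>N) = 0" using m[OF i(1) i(3)] e by auto
  have 2: "integrable N snd" "(\<integral>z. snd z \<partial>N) = 0" using m[OF i(3) i(1)] e by auto
  have 3: "integrable N (\<lambda>z. (fst z)\<^sup>2)" "(\<integral>z. (fst z)\<^sup>2 \<partial>N) = 1" using m[OF i(2) i(3)] e by auto
  have 4: "integrable N (\<lambda>z. (snd z)\<^sup>2)" "(\<integral>z. (snd z)\<^sup>2 \<partial>N) = 1" using m[OF i(3) i(2)] e by auto
  have 5: "integrable N (\<lambda>z. fst z * snd z)" "(\<integral>z. fst z * snd z \<partial>N) = 0" using m[OF i(1) i(1)] e by auto
  show "(\<integral>z. \<mu> + (a * fst z + b * snd z) \<partial>N) = \<mu>"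
    using 1 2 by (simp add: NN.prob_space)
  have "(\<lambda>z. (a * fst z + b * snd z) * (c * fst z + d * snd z)) =
    (\<lambda>z. (a * c) * (fst z)\<^sup>2 + (a * d + b * c) * (fst z * snd z) + (b * d) * (snd z)\<^sup>2)"
    by (simp add: fun_eq_iff power2_eq_square algebra_simps)
  then show "(\<integral>z. (a * fst z + b * snd z) * (c * fst z + d * snd z) \<partial>N) = a * c + b * d"
    using 3 4 5 by simp
qed

lemma emeasure_distr_conv_nn_integral:
  assumes g: "g \<in> measurable M N" and X: "X \<in> sets N"
  shows "emeasure (distr M N g) X = (\<integral>\<^sup>+x. indicator X (g x) \<partial>M)"
proof -
  have "emeasure (distr M N g) X = (\<integral>\<^sup>+y. indicator X y \<partial>distr M N g)"
    using X by simp
  also have "\<dots> = (\<integral>\<^sup>+x. indicator X (g x) \<partial>M)"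
    using g X by (intro nn_integral_distr) auto
  finally show ?thesis .
qed

text \<open>Trades the product spaces indexed by the sites for pairs; distinct sites make the index
  set \<open>{s, t}\<close> a two-element one. The numbers a, b and c, d are the rows of the matrix
  \<open>L\<close>.\<close>

lemma gaussian_process_pair_law:
  assumes "prob_space M" and "gaussian_process M A G" and st: "s \<in> A" "t \<in> A" "s \<noteq> t"
  obtains \<mu> a b \<mu>' c d :: real where
    "distr M borel (\<lambda>\<omega>. (G s \<omega>, G t \<omega>)) = distr (std_normal_distribution \<Otimes>\<^sub>M std_normal_distribution) borel
       (\<lambda>z. (\<mu> + (a * fst z + b * snd z), \<mu>' + (c * fst z + d * snd z)))"
proof -
  interpret prob_space M by fact
  have [measurable]: "G s \<in> borel_measurable M" "G t \<in> borel_measurable M"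
    using assms(2) st by (auto simp: gaussian_process_def)
  let ?J = "{s, t}"
  obtain \<mu> L where law: "distr M (PiM ?J (\<lambda>_. borel)) (sample_path ?J G) =
    distr (PiM ?J (\<lambda>_. std_normal_distribution)) (PiM ?J (\<lambda>_. borel))
                 (\<lambda>z. \<lambda>u\<in>?J. \<mu> u + (\<Sum>v\<in>?J. L u v * z v))"
    using assms(2) st unfolding gaussian_process_def by (meson empty_subsetI finite.intros insert_subset)
  interpret N: prob_space std_normal_distribution
    by (rule prob_space_normal_density) simp
  interpret product_sigma_finite "\<lambda>_. std_normal_distribution"
    by standard
  define T where "T z = (\<mu> s + (L s s * fst z + L s t * snd z), \<mu> t + (L t s * fst z + L t t * snd z))" for z
  have T [measurable]: "T \<in> borel_measurable (std_normal_distribution \<Otimes>\<^sub>M std_normal_distribution)"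
    unfolding T_def[abs_def] borel_prod[symmetric] by measurable
  have [measurable]: "(\<lambda>\<omega>. (G s \<omega>, G t \<omega>)) \<in> borel_measurable M"
    unfolding borel_prod[symmetric] by measurable
  have path [measurable]: "sample_path ?J G \<in> measurable M (PiM ?J (\<lambda>_. borel))"
    unfolding sample_path_def[abs_def] by (rule measurable_restrict) auto
  have lin [measurable]: "(\<lambda>z. \<lambda>u\<in>?J. \<mu> u + (\<Sum>v\<in>?J. L u v * z v)) \<in> measurable (PiM ?J (\<lambda>_. std_normal_distribution)) (PiM ?J (\<lambda>_. borel))"
    by (rule measurable_restrict) measurable
  have int: "(\<integral>\<^sup>+\<omega>. F (G s \<omega>, G t \<omega>) \<partial>M) = (\<integral>\<^sup>+z. F (T z) \<partial>(std_normal_distribution \<Otimes>\<^sub>M std_normal_distribution))"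
    if F: "F \<in> borel_measurable borel" for F :: "real \<times> real \<Rightarrow> ennreal"
  proof -
    have [measurable]: "F \<in> borel_measurable (borel \<Otimes>\<^sub>M borel)" using F by (simp add: borel_prod)
    have [measurable]: "(\<lambda>h. F (h s, h t)) \<in> borel_measurable (PiM ?J (\<lambda>_. borel))"
      by measurable
    have "(\<integral>\<^sup>+\<omega>. F (G s \<omega>, G t \<omega>) \<partial>M) = (\<integral>\<^sup>+h. F (h s, h t) \<partial>distr M (PiM ?J (\<lambda>_. borel)) (sample_path ?J G))"
      by (subst nn_integral_distr) (auto simp: sample_path_def)
    also have "\<dots> = (\<integral>\<^sup>+z. F (T (z s, z t)) \<partial>PiM ?J (\<lambda>_. std_normal_distribution))"
      unfolding law using st by (subst nn_integral_distr) (auto simp: T_def)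
    also have "\<dots> = (\<integral>\<^sup>+z. F (T (fst z, snd z)) \<partial>(std_normal_distribution \<Otimes>\<^sub>M std_normal_distribution))"
      using st(3) F by (subst product_nn_integral_pair[where f = "\<lambda>x y. F (T (x, y))"]) auto
    finally show ?thesis by simp
  qed
  have "distr M borel (\<lambda>\<omega>. (G s \<omega>, G t \<omega>)) = distr (std_normal_distribution \<Otimes>\<^sub>M std_normal_distribution) borel T"
  proof (rule measure_eqI)
    fix X assume "X \<in> sets (distr M borel (\<lambda>\<omega>. (G s \<omega>, G t \<omega>)))"
    then have X [measurable]: "X \<in> sets borel" by simp
    have "emeasure (distr M borel (\<lambda>\<omega>. (G s \<omega>, G t \<omega>))) X = (\<integral>\<^sup>+\<omega>. indicator X (G s \<omega>, G t \<omega>) \<partial>M)"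
      by (rule emeasure_distr_conv_nn_integral) simp_all
    also have "\<dots> = (\<integral>\<^sup>+z. indicator X (T z) \<partial>(std_normal_distribution \<Otimes>\<^sub>M std_normal_distribution))"
      by (rule int) simp
    also have "\<dots> = emeasure (distr (std_normal_distribution \<Otimes>\<^sub>M std_normal_distribution) borel T) X"
      by (rule emeasure_distr_conv_nn_integral[symmetric]) simp_all
    finally show "emeasure (distr M borel (\<lambda>\<omega>. (G s \<omega>, G t \<omega>))) X =
      emeasure (distr (std_normal_distribution \<Otimes>\<^sub>M std_normal_distribution) borel T) X" .
  qed simp
  from this[unfolded T_def[abs_def]] show ?thesis
    by (rule that[of "\<mu> s" "L s s" "L s t" "\<mu> t" "L t s" "L t t"])
qed

text \<open>The means force the shift to vanish, the variances make the rows of the linear map unit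
  vectors, and the correlation is their inner product. This determines the law, though not the
  matrix.\<close>

lemma parent_process_distributed:
  fixes A :: "'s::euclidean_space set"
  assumes M: "prob_space M" and G: "parent_process M A \<rho> G" and st: "s \<in> A" "t \<in> A" "s \<noteq> t"
    and r: "\<bar>\<rho> (s - t)\<bar> < 1"
  shows "distributed M lborel (\<lambda>\<omega>. (G s \<omega>, G t \<omega>)) (\<lambda>w. ennreal (binormal_density (\<rho> (s - t)) w))"
proof -
  interpret prob_space M by fact
  have gp: "gaussian_process M A G" using G by (simp add: parent_process_def)
  have [measurable]: "G s \<in> borel_measurable M" "G t \<in> borel_measurable M"
    using gp st by (auto simp: gaussian_process_def)
  have GG [measurable]: "(\<lambda>\<omega>. (G s \<omega>, G t \<omega>)) \<in> borel_measurable M"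
    unfolding borel_prod[symmetric] by measurable
  define N where "N = std_normal_distribution \<Otimes>\<^sub>M std_normal_distribution"
  obtain \<mu> \<mu>' a b c d :: real where law0:
    "distr M borel (\<lambda>\<omega>. (G s \<omega>, G t \<omega>)) = distr N borel
       (\<lambda>z. (\<mu> + (a * fst z + b * snd z), \<mu>' + (c * fst z + d * snd z)))"
    unfolding N_def by (rule gaussian_process_pair_law[OF M gp st])
  define T where "T z = (\<mu> + (a * fst z + b * snd z), \<mu>' + (c * fst z + d * snd z))" for z
  have law: "distr M borel (\<lambda>\<omega>. (G s \<omega>, G t \<omega>)) = distr N borel T"
    unfolding law0 T_def[abs_def] ..
  have T [measurable]: "T \<in> borel_measurable N"
    unfolding T_def[abs_def] N_def borel_prod[symmetric] by measurable
  have int: "(\<integral>\<omega>. f (G s \<omega>, G t \<omega>) \<partial>M) = (\<integral>z. f (T z) \<partial>N)"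
    if [measurable]: "f \<in> borel_measurable borel" for f :: "real \<times> real \<Rightarrow> real"
  proof -
    have "(\<integral>\<omega>. f (G s \<omega>, G t \<omega>) \<partial>M) = (\<integral>w. f w \<partial>distr M borel (\<lambda>\<omega>. (G s \<omega>, G t \<omega>)))"
      by (subst integral_distr) auto
    also have "\<dots> = (\<integral>z. f (T z) \<partial>N)"
      unfolding law by (subst integral_distr) auto
    finally show ?thesis .
  qed
  have mean: "expectation (G s) = 0" "expectation (G t) = 0" and var: "variance (G s) = 1" "variance (G t) = 1"
    and cor: "correlation M (G s) (G t) = \<rho> (s - t)"
    using G st by (auto simp: parent_process_def)
  have fs [measurable]: "(fst :: real \<times> real \<Rightarrow> real) \<in> borel_measurable borel" "(snd :: real \<times> real \<Rightarrow> real) \<in> borel_measurable borel"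
    unfolding borel_prod[symmetric] by measurable
  \<comment> \<open>The coordinates and their products serve as test functions that extract the
    moments.\<close>
  have \<mu>: "\<mu> = 0" "\<mu>' = 0"
    using int[of fst] int[of snd] mean std_normal_pair_moments(1)[folded N_def] by (auto simp: T_def)
  have ab: "a\<^sup>2 + b\<^sup>2 = 1"
    using int[of "\<lambda>w. fst w * fst w"] var(1) std_normal_pair_moments(2)[folded N_def, of a b a b]
    unfolding mean by (simp add: T_def \<mu> power2_eq_square)
  have cd: "c\<^sup>2 + d\<^sup>2 = 1"
    using int[of "\<lambda>w. snd w * snd w"] var(2) std_normal_pair_moments(2)[folded N_def, of c d c d]
    unfolding mean by (simp add: T_def \<mu> power2_eq_square)
  have var': "expectation (\<lambda>x. (G s x)\<^sup>2) = 1" "expectation (\<lambda>x. (G t x)\<^sup>2) = 1"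
    using var mean by simp_all
  have r': "a * c + b * d = \<rho> (s - t)"
    using int[of "\<lambda>w. fst w * snd w"] cor std_normal_pair_moments(2)[folded N_def, of a b c d]
    unfolding correlation_def mean by (simp add: T_def \<mu> var')
  have "distr M lborel (\<lambda>\<omega>. (G s \<omega>, G t \<omega>)) = density lborel (\<lambda>w. ennreal (binormal_density (\<rho> (s - t)) w))"
  proof (rule measure_eqI)
    fix X assume "X \<in> sets (distr M lborel (\<lambda>\<omega>. (G s \<omega>, G t \<omega>)))"
    then have X [measurable]: "X \<in> sets borel" by simp
    have "emeasure (distr M lborel (\<lambda>\<omega>. (G s \<omega>, G t \<omega>))) X = emeasure (distr M borel (\<lambda>\<omega>. (G s \<omega>, G t \<omega>))) X"
      by (simp add: emeasure_distr)
    also have "\<dots> = (\<integral>\<^sup>+z. indicator X (T z) \<partial>N)"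
      unfolding law by (rule emeasure_distr_conv_nn_integral) simp_all
    also have "\<dots> = (\<integral>\<^sup>+w. ennreal (binormal_density (\<rho> (s - t)) w) * indicator X w \<partial>lborel)"
      unfolding T_def \<mu> add_0 N_def by (rule std_normal_pair_to_binormal[OF _ ab cd r' r]) simp
    also have "\<dots> = emeasure (density lborel (\<lambda>w. ennreal (binormal_density (\<rho> (s - t)) w))) X"
      by (rule emeasure_density[symmetric]) auto
    finally show "emeasure (distr M lborel (\<lambda>\<omega>. (G s \<omega>, G t \<omega>))) X =
      emeasure (density lborel (\<lambda>w. ennreal (binormal_density (\<rho> (s - t)) w))) X" .
  qed simp
  then show ?thesis
    unfolding distributed_def by simp
qed

section \<open>The bivariate gamma law as a negative binomial mixture\<close>

lemma suminf_swap_ennreal: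
  fixes f :: "nat \<Rightarrow> nat \<Rightarrow> ennreal"
  shows "(\<Sum>i. \<Sum>j. f i j) = (\<Sum>j. \<Sum>i. f i j)"
proof -
  have "(\<Sum>j. \<Sum>i. f i j) = (\<Sum>j. \<integral>\<^sup>+i. f i j \<partial>count_space UNIV)"
    by (simp add: nn_integral_count_space_nat)
  also have "\<dots> = (\<integral>\<^sup>+i. (\<Sum>j. f i j) \<partial>count_space UNIV)"
    by (rule nn_integral_suminf[symmetric]) simp
  finally show ?thesis by (simp add: nn_integral_count_space_nat)
qed

text \<open>Row \<open>i\<close> is shifted by \<open>i\<close> and padded with zeros, so that
  exchanging the two sums collects the diagonals i + j = n.\<close>

lemma suminf_suminf_diagonal_ennreal:
  fixes f :: "nat \<Rightarrow> nat \<Rightarrow> ennreal"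
  shows "(\<Sum>i. \<Sum>j. f i j) = (\<Sum>n. \<Sum>i\<le>n. f i (n - i))"
proof -
  have "(\<Sum>j. f i j) = (\<Sum>n. if i \<le> n then f i (n - i) else 0)" for i
  proof -
    have "(\<lambda>j. if i \<le> j + i then f i (j + i - i) else 0) sums (\<Sum>j. f i j)"
      by (simp add: summable_sums)
    then have "(\<lambda>n. if i \<le> n then f i (n - i) else 0) sums (\<Sum>j. f i j)"
    proof (subst (asm) sums_mono_reindex[where g = "\<lambda>j. j + i" and f = "\<lambda>n. if i \<le> n then f i (n - i) else 0"])
      show "strict_mono (\<lambda>j. j + i)" by (simp add: strict_mono_def)
      show "(if i \<le> n then f i (n - i) else 0) = 0" if "n \<notin> range (\<lambda>j. j + i)" for n
        using that by (metis le_add_diff_inverse2 rangeI)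
    qed
    then show ?thesis by (rule sums_unique)
  qed
  then have "(\<Sum>i. \<Sum>j. f i j) = (\<Sum>n. \<Sum>i. if i \<le> n then f i (n - i) else 0)"
    by (simp add: suminf_swap_ennreal[of "\<lambda>i n. if i \<le> n then f i (n - i) else 0"])
  also have "\<dots> = (\<Sum>n. \<Sum>i\<le>n. f i (n - i))"
    by (intro suminf_cong, subst suminf_finite[where N = "{.._}"]) (auto intro!: sum.cong)
  finally show ?thesis .
qed

text \<open>The bivariate gamma law is a negative binomial mixture of products of gamma laws with equal
  shapes. In this form it is visibly closed under convolution.\<close>

definition neg_binomial_weight :: "real \<Rightarrow> real \<Rightarrow> nat \<Rightarrow> real" where
  "neg_binomial_weight \<alpha> r k = (1 - r\<^sup>2) powr \<alpha> * (pochhammer \<alpha> k / fact k * (r\<^sup>2) ^ k)"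

text \<open>Kibble's bivariate gamma law. Within a component the coordinates are independent; they
  depend on each other only through the shared index \<open>k\<close>. Values in
  \<open>ennreal\<close> allow termwise integration without summability conditions.\<close>

definition kibble_density :: "real \<Rightarrow> real \<Rightarrow> real \<Rightarrow> real \<times> real \<Rightarrow> ennreal" where
  "kibble_density \<alpha> c r w = (\<Sum>k. ennreal (neg_binomial_weight \<alpha> r k) *
     (ennreal (gamma_density (\<alpha> + real k) c (fst w)) * ennreal (gamma_density (\<alpha> + real k) c (snd w))))"

lemma neg_binomial_weight_nonneg: "\<alpha> > 0 \<Longrightarrow> 0 \<le> neg_binomial_weight \<alpha> r k"
  by (simp add: neg_binomial_weight_def pochhammer_nonneg)

text \<open>The weights are the power series coefficients of ((1 - r^2) / (1 - r^2 x))^\<alpha>, and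
  these functions multiply by adding exponents. On coefficients this is Vandermonde's identity for
  rising factorials.\<close>

lemma neg_binomial_weight_convolution:
  "(\<Sum>i\<le>n. neg_binomial_weight \<alpha> r i * neg_binomial_weight \<beta> r (n - i)) = neg_binomial_weight (\<alpha> + \<beta>) r n"
proof -
  have "(\<Sum>i\<le>n. neg_binomial_weight \<alpha> r i * neg_binomial_weight \<beta> r (n - i)) =
    (\<Sum>i\<le>n. (1 - r\<^sup>2) powr (\<alpha> + \<beta>) * (r\<^sup>2) ^ n / fact n * (of_nat (n choose i) * pochhammer \<alpha> i * pochhammer \<beta> (n - i)))"
  proof (intro sum.cong refl)
    fix i assume "i \<in> {..n}"
    then have i: "i \<le> n" by simp
    have "(r\<^sup>2) ^ n = (r\<^sup>2) ^ i * (r\<^sup>2) ^ (n - i)" using i by (simp add: power_add[symmetric])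
    moreover have "real (n choose i) = fact n / (fact i * fact (n - i))" using i by (rule binomial_fact)
    ultimately show "neg_binomial_weight \<alpha> r i * neg_binomial_weight \<beta> r (n - i) =
      (1 - r\<^sup>2) powr (\<alpha> + \<beta>) * (r\<^sup>2) ^ n / fact n * (of_nat (n choose i) * pochhammer \<alpha> i * pochhammer \<beta> (n - i))"
      by (simp add: neg_binomial_weight_def powr_add)
  qed
  also have "\<dots> = (1 - r\<^sup>2) powr (\<alpha> + \<beta>) * (r\<^sup>2) ^ n / fact n * pochhammer (\<alpha> + \<beta>) n"
    by (simp only: sum_distrib_left[symmetric] pochhammer_binomial_sum)
  finally show ?thesis by (simp add: neg_binomial_weight_def)
qed

lemma kibble_density_measurable [measurable]: "kibble_density \<alpha> c r \<in> borel_measurable borel"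
  unfolding kibble_density_def[abs_def] borel_prod[symmetric] by measurable

text \<open>Components \<open>k\<close> and \<open>j\<close> convolve, coordinate by coordinate, to
  gamma densities of shape \<alpha> + \<beta> + (k + j). These depend on k + j only, so each
  diagonal of the double sum contributes one component, with the convolution of the weights as its
  coefficient.\<close>

lemma kibble_density_convolution:
  assumes \<alpha>: "\<alpha> > 0" and \<beta>: "\<beta> > 0" and c: "c > 0"
  shows "(\<integral>\<^sup>+y. kibble_density \<alpha> c r (x - y) * kibble_density \<beta> c r y \<partial>lborel) = kibble_density (\<alpha> + \<beta>) c r x"
proof -
  define g where "g a u = ennreal (gamma_density a c u)" for a u
  have [measurable]: "g a \<in> borel_measurable borel" for a unfolding g_def[abs_def] by measurable
  define wt where "wt a k = ennreal (neg_binomial_weight a r k)" for a k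
  have kd: "kibble_density a c r w = (\<Sum>k. wt a k * (g (a + real k) (fst w) * g (a + real k) (snd w)))" for a w
    by (simp add: kibble_density_def wt_def g_def)
  have expand: "kibble_density \<alpha> c r (x - y) * kibble_density \<beta> c r y =
    (\<Sum>k. \<Sum>j. (wt \<alpha> k * wt \<beta> j) * ((g (\<alpha> + real k) (fst x - fst y) * g (\<beta> + real j) (fst y)) *
       (g (\<alpha> + real k) (snd x - snd y) * g (\<beta> + real j) (snd y))))" for y
  proof -
    have *: "(\<Sum>k. F k) * (\<Sum>j. H j) = (\<Sum>k. \<Sum>j. F k * H j)" for F H :: "nat \<Rightarrow> ennreal"
      by (simp only: ennreal_suminf_cmult ennreal_suminf_multc)
    show ?thesis
      unfolding kd fst_diff snd_diff * by (intro suminf_cong) (simp only: ac_simps)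
  qed
  have g_conv: "(\<integral>\<^sup>+v. g (\<alpha> + real k) (u - v) * g (\<beta> + real j) v \<partial>lborel) = g (\<alpha> + \<beta> + real (k + j)) u" for k j u
  proof -
    have "(\<alpha> + real k) + (\<beta> + real j) = \<alpha> + \<beta> + real (k + j)" by simp
    note * = gamma_density_convolution[of "\<alpha> + real k" "\<beta> + real j" c u, unfolded this]
    show ?thesis
      unfolding g_def by (rule *) (use \<alpha> \<beta> c in auto)
  qed
  have meas: "(\<lambda>y. (wt \<alpha> k * wt \<beta> j) * ((g (\<alpha> + real k) (fst x - fst y) * g (\<beta> + real j) (fst y)) *
       (g (\<alpha> + real k) (snd x - snd y) * g (\<beta> + real j) (snd y)))) \<in> borel_measurable borel" for k j
    unfolding borel_prod[symmetric] by measurable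
  have "(\<integral>\<^sup>+y. kibble_density \<alpha> c r (x - y) * kibble_density \<beta> c r y \<partial>lborel) =
    (\<Sum>k. \<Sum>j. \<integral>\<^sup>+y. (wt \<alpha> k * wt \<beta> j) * ((g (\<alpha> + real k) (fst x - fst y) * g (\<beta> + real j) (fst y)) *
       (g (\<alpha> + real k) (snd x - snd y) * g (\<beta> + real j) (snd y))) \<partial>lborel)"
    unfolding expand using meas by (subst nn_integral_suminf, simp) (subst nn_integral_suminf, auto)
  also have "\<dots> = (\<Sum>k. \<Sum>j. wt \<alpha> k * wt \<beta> j * (g (\<alpha> + \<beta> + real (k + j)) (fst x) * g (\<alpha> + \<beta> + real (k + j)) (snd x)))"
  proof (intro suminf_cong)
    fix k j
    have "(\<integral>\<^sup>+y. (wt \<alpha> k * wt \<beta> j) * ((g (\<alpha> + real k) (fst x - fst y) * g (\<beta> + real j) (fst y)) *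
       (g (\<alpha> + real k) (snd x - snd y) * g (\<beta> + real j) (snd y))) \<partial>lborel) =
       wt \<alpha> k * wt \<beta> j * (\<integral>\<^sup>+y. (g (\<alpha> + real k) (fst x - fst y) * g (\<beta> + real j) (fst y)) *
       (g (\<alpha> + real k) (snd x - snd y) * g (\<beta> + real j) (snd y)) \<partial>lborel)"
      by (rule nn_integral_cmult) (simp add: borel_prod[symmetric])
    also have "(\<integral>\<^sup>+y. (g (\<alpha> + real k) (fst x - fst y) * g (\<beta> + real j) (fst y)) *
       (g (\<alpha> + real k) (snd x - snd y) * g (\<beta> + real j) (snd y)) \<partial>lborel) =
      g (\<alpha> + \<beta> + real (k + j)) (fst x) * g (\<alpha> + \<beta> + real (k + j)) (snd x)"
      by (subst nn_integral_lborel_prod_mult[of "\<lambda>v. g (\<alpha> + real k) (fst x - v) * g (\<beta> + real j) v" "\<lambda>v. g (\<alpha> + real k) (snd x - v) * g (\<beta> + real j) v"])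
        (simp_all only: g_conv, measurable)
    finally show "(\<integral>\<^sup>+y. (wt \<alpha> k * wt \<beta> j) * ((g (\<alpha> + real k) (fst x - fst y) * g (\<beta> + real j) (fst y)) *
       (g (\<alpha> + real k) (snd x - snd y) * g (\<beta> + real j) (snd y))) \<partial>lborel) =
       wt \<alpha> k * wt \<beta> j * (g (\<alpha> + \<beta> + real (k + j)) (fst x) * g (\<alpha> + \<beta> + real (k + j)) (snd x))" .
  qed
  also have "\<dots> = (\<Sum>n. \<Sum>i\<le>n. wt \<alpha> i * wt \<beta> (n - i) * (g (\<alpha> + \<beta> + real (i + (n - i))) (fst x) * g (\<alpha> + \<beta> + real (i + (n - i))) (snd x)))"
    by (rule suminf_suminf_diagonal_ennreal)
  also have "\<dots> = (\<Sum>n. wt (\<alpha> + \<beta>) n * (g (\<alpha> + \<beta> + real n) (fst x) * g (\<alpha> + \<beta> + real n) (snd x)))"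
  proof (intro suminf_cong)
    fix n
    have "(\<Sum>i\<le>n. wt \<alpha> i * wt \<beta> (n - i) * (g (\<alpha> + \<beta> + real (i + (n - i))) (fst x) * g (\<alpha> + \<beta> + real (i + (n - i))) (snd x))) =
      (\<Sum>i\<le>n. wt \<alpha> i * wt \<beta> (n - i)) * (g (\<alpha> + \<beta> + real n) (fst x) * g (\<alpha> + \<beta> + real n) (snd x))"
      unfolding sum_distrib_right by (intro sum.cong refl) simp
    also have "(\<Sum>i\<le>n. wt \<alpha> i * wt \<beta> (n - i)) = wt (\<alpha> + \<beta>) n"
      unfolding wt_def neg_binomial_weight_convolution[symmetric]
      using \<alpha> \<beta> by (simp add: ennreal_mult[symmetric] neg_binomial_weight_nonneg sum_ennreal)
    finally show "(\<Sum>i\<le>n. wt \<alpha> i * wt \<beta> (n - i) * (g (\<alpha> + \<beta> + real (i + (n - i))) (fst x) * g (\<alpha> + \<beta> + real (i + (n - i))) (snd x))) =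
      wt (\<alpha> + \<beta>) n * (g (\<alpha> + \<beta> + real n) (fst x) * g (\<alpha> + \<beta> + real n) (snd x))" .
  qed
  finally show ?thesis unfolding kd .
qed

text \<open>The normalising constants of the two gamma densities put ((\<alpha>)_k)^2 into the
  denominator and the weight puts (\<alpha>)_k into the numerator; what remains is 1 / (k!
  (\<alpha>)_k), the coefficient of 0F1.\<close>

lemma kibble_density_eq:
  assumes \<alpha>: "\<alpha> > 0" and c: "c > 0" and uv: "0 < u" "0 < v"
  shows "kibble_density \<alpha> c r (u, v) = ennreal ((1 - r\<^sup>2) powr \<alpha> * c powr (2 * \<alpha>) / (Gamma \<alpha>)\<^sup>2 * (u * v) powr (\<alpha> - 1) *
     exp (- (c * (u + v))) * hyp0F1 \<alpha> (c\<^sup>2 * r\<^sup>2 * (u * v)))"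
proof -
  define C where "C = (1 - r\<^sup>2) powr \<alpha> * c powr (2 * \<alpha>) / (Gamma \<alpha>)\<^sup>2 * (u * v) powr (\<alpha> - 1) * exp (- (c * (u + v)))"
  have C: "C \<ge> 0" by (simp add: C_def)
  have summand: "neg_binomial_weight \<alpha> r k * (gamma_density (\<alpha> + real k) c u * gamma_density (\<alpha> + real k) c v) =
    C * ((c\<^sup>2 * r\<^sup>2 * (u * v)) ^ k / (fact k * pochhammer \<alpha> k))" for k
  proof -
    have G: "Gamma \<alpha> \<noteq> 0" using Gamma_real_pos[OF \<alpha>] by simp
    have P: "pochhammer \<alpha> k \<noteq> 0" using pochhammer_pos[OF \<alpha>, of k] by simp
    have pw: "c powr (\<alpha> + real k) = c powr \<alpha> * c ^ k" using c by (simp add: powr_add powr_realpow)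
    have pw': "t powr (\<alpha> + real k - 1) = t powr (\<alpha> - 1) * t ^ k" if "t > 0" for t
    proof -
      have "t powr (\<alpha> + real k - 1) = t powr ((\<alpha> - 1) + real k)" by (simp add: algebra_simps)
      then show ?thesis using that by (simp only: powr_add powr_realpow)
    qed
    have c2: "c powr (2 * \<alpha>) = c powr \<alpha> * c powr \<alpha>" by (simp add: powr_add[symmetric])
    have ex: "exp (- (c * (u + v))) = exp (- (c * u)) * exp (- (c * v))"
      by (simp add: exp_add[symmetric] algebra_simps)
    have "(c\<^sup>2 * r\<^sup>2 * (u * v)) ^ k = c ^ k * c ^ k * (r\<^sup>2) ^ k * (u ^ k * v ^ k)"
      by (simp add: power_mult_distrib power2_eq_square)
    then show ?thesis
      using uv G P unfolding gamma_density_def neg_binomial_weight_def C_def Gamma_plus_nat[OF \<alpha>] pw pw'[OF uv(1)] pw'[OF uv(2)] c2 ex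
      by (simp add: powr_mult power2_eq_square ac_simps)
  qed
  have "kibble_density \<alpha> c r (u, v) = (\<Sum>k. ennreal C * ennreal ((c\<^sup>2 * r\<^sup>2 * (u * v)) ^ k / (fact k * pochhammer \<alpha> k)))"
    unfolding kibble_density_def fst_conv snd_conv
  proof (intro suminf_cong)
    fix k
    show "ennreal (neg_binomial_weight \<alpha> r k) * (ennreal (gamma_density (\<alpha> + real k) c u) * ennreal (gamma_density (\<alpha> + real k) c v)) =
      ennreal C * ennreal ((c\<^sup>2 * r\<^sup>2 * (u * v)) ^ k / (fact k * pochhammer \<alpha> k))"
      unfolding ennreal_mult'[OF C, symmetric] summand[symmetric]
      using \<alpha> by (simp add: ennreal_mult gamma_density_nonneg neg_binomial_weight_nonneg)
  qed
  also have "\<dots> = ennreal C * ennreal (hyp0F1 \<alpha> (c\<^sup>2 * r\<^sup>2 * (u * v)))"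
    using \<alpha> uv by (simp add: hyp0F1_ennreal)
  also have "\<dots> = ennreal (C * hyp0F1 \<alpha> (c\<^sup>2 * r\<^sup>2 * (u * v)))"
    by (rule ennreal_mult'[OF C, symmetric])
  finally show ?thesis unfolding C_def .
qed

lemma kibble_density_eq_0: "\<not> (0 < u \<and> 0 < v) \<Longrightarrow> kibble_density \<alpha> c r (u, v) = 0"
  by (auto simp: kibble_density_def gamma_density_def)

text \<open>The mixture lowers the rate of its margins from c to (1 - r^2) c, so margins of rate
  \<nu> / 2 require c = \<nu> / (2 (1 - r^2)).\<close>

lemma kibble_density_bivariate_gamma_density:
  assumes \<nu>: "\<nu> > 0" and r: "\<bar>r\<bar> < 1"
  shows "kibble_density (\<nu> / 2) (\<nu> / (2 * (1 - r\<^sup>2))) r w = ennreal (bivariate_gamma_density \<nu> r w)"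
proof -
  obtain u v where w: "w = (u, v)" by (cases w)
  define D where "D = 1 - r\<^sup>2"
  have D: "D > 0" using r by (simp add: D_def abs_square_less_1)
  have c: "\<nu> / (2 * D) > 0" using \<nu> D by simp
  show ?thesis
  proof (cases "0 < u \<and> 0 < v")
    case True
    \<comment> \<open>The normalisation of the weights cancels half of the power of D that comes
      from the two rates.\<close>
    have "D powr (\<nu> / 2) * (\<nu> / (2 * D)) powr \<nu> = 2 powr (- \<nu>) * \<nu> powr \<nu> / D powr (\<nu> / 2)"
    proof -
      have "D powr \<nu> = D powr (\<nu> / 2) * D powr (\<nu> / 2)" by (simp only: powr_add[symmetric]) simp
      moreover have "D powr (\<nu> / 2) \<noteq> 0" using D by simp
      ultimately show ?thesis
        using D by (simp add: powr_divide powr_mult powr_minus_divide)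
    qed
    then have "D powr (\<nu> / 2) * (\<nu> / (2 * D)) powr (2 * (\<nu> / 2)) / (Gamma (\<nu> / 2))\<^sup>2 * (u * v) powr (\<nu> / 2 - 1) =
       2 powr (- \<nu>) * \<nu> powr \<nu> * (u * v) powr (\<nu> / 2 - 1) / ((Gamma (\<nu> / 2))\<^sup>2 * D powr (\<nu> / 2))"
      by simp
    moreover have "\<nu> / (2 * D) * (u + v) = \<nu> * (u + v) / (2 * D)" by simp
    moreover have "(\<nu> / (2 * D))\<^sup>2 * r\<^sup>2 * (u * v) = \<nu>\<^sup>2 * r\<^sup>2 * u * v / (4 * D\<^sup>2)"
      by (simp add: power_divide power_mult_distrib)
    ultimately show ?thesis
      using kibble_density_eq[of "\<nu> / 2" "\<nu> / (2 * D)" u v r] \<nu> c r True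
      unfolding w D_def[symmetric] by (simp only: bivariate_gamma_density_def D_def[symmetric]) simp
  next
    case False
    then show ?thesis unfolding w by (auto simp: kibble_density_eq_0 bivariate_gamma_density_def)
  qed
qed

section \<open>The mixed density\<close>

lemma bivariate_gamma_density_measurable [measurable]: "bivariate_gamma_density \<nu> r \<in> borel_measurable borel"
  unfolding bivariate_gamma_density_def[abs_def] case_prod_beta borel_prod[symmetric] by measurable

lemma binormal_density_nonneg: "\<bar>r\<bar> < 1 \<Longrightarrow> 0 \<le> binormal_density r w"
  by (auto simp: binormal_density_def case_prod_beta abs_square_le_1)

lemma bivariate_gamma_density_nonneg: "\<nu> > 0 \<Longrightarrow> \<bar>r\<bar> < 1 \<Longrightarrow> 0 \<le> bivariate_gamma_density \<nu> r w"
  by (auto simp: bivariate_gamma_density_def case_prod_beta intro!: mult_nonneg_nonneg hyp0F1_nonneg divide_nonneg_nonneg)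

lemma cosh_le_exp: "0 \<le> x \<Longrightarrow> cosh x \<le> exp (x::real)"
proof -
  assume "0 \<le> x"
  then have "exp (- x) \<le> exp x" by simp
  then show ?thesis unfolding cosh_def scaleR_conv_of_real by simp
qed

text \<open>With t = |x| sqrt (u v) the two sides are sinh (2 t) and cosh (2 t) times the same
  factor; the surplus 1/2 in the exponent supplies sqrt (u v). The even kernel thus controls the odd
  one, both for finiteness and for the sign of their sum.\<close>

lemma hyp0F1_kernel_le_hyp0F1_kernel_half:
  assumes p: "p > 0" and b': "b' > 0" and Z: "Z \<ge> 0"
  shows "2 * \<bar>x\<bar> * hyp0F1_kernel (p + 1 / 2) a\<^sub>1 a\<^sub>2 (3 / 2) (x\<^sup>2) b' Z w \<le> hyp0F1_kernel p a\<^sub>1 a\<^sub>2 (1 / 2) (x\<^sup>2) b' Z w"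
proof (cases "0 < fst w \<and> 0 < snd w")
  case True
  define u v where "u = fst w" and "v = snd w"
  have uv: "0 < u" "0 < v" using True by (auto simp: u_def v_def)
  define s where "s = sqrt (u * v)"
  have s: "s > 0" "u * v = s\<^sup>2" using uv by (auto simp: s_def)
  have pw: "(u * v) powr (p + 1 / 2 - 1) = (u * v) powr (p - 1) * s"
    using uv by (simp add: s_def powr_half_sqrt[symmetric] powr_add[symmetric] algebra_simps del: powr_half_sqrt)
  have "2 * \<bar>x\<bar> * s * hyp0F1 (3 / 2) (x\<^sup>2 * (u * v)) = 2 * (\<bar>x\<bar> * s) * hyp0F1 (3 / 2) ((\<bar>x\<bar> * s)\<^sup>2)"
    unfolding s by (simp add: power_mult_distrib)
  also have "\<dots> = sinh (2 * (\<bar>x\<bar> * s))" by (rule hyp0F1_sinh)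
  also have "\<dots> \<le> cosh (2 * (\<bar>x\<bar> * s))" by (rule sinh_le_cosh_real)
  also have "\<dots> = hyp0F1 (1 / 2) ((\<bar>x\<bar> * s)\<^sup>2)" by (rule hyp0F1_cosh[symmetric])
  also have "(\<bar>x\<bar> * s)\<^sup>2 = x\<^sup>2 * (u * v)" unfolding s by (simp add: power_mult_distrib)
  finally have *: "2 * \<bar>x\<bar> * s * hyp0F1 (3 / 2) (x\<^sup>2 * (u * v)) \<le> hyp0F1 (1 / 2) (x\<^sup>2 * (u * v))" .
  have "((u * v) powr (p - 1) * exp (- (a\<^sub>1 * u + a\<^sub>2 * v)) * hyp0F1 b' (Z * (u * v))) * (2 * \<bar>x\<bar> * s * hyp0F1 (3 / 2) (x\<^sup>2 * (u * v))) \<le>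
    ((u * v) powr (p - 1) * exp (- (a\<^sub>1 * u + a\<^sub>2 * v)) * hyp0F1 b' (Z * (u * v))) * hyp0F1 (1 / 2) (x\<^sup>2 * (u * v))"
    using * uv Z b' by (intro mult_left_mono mult_nonneg_nonneg hyp0F1_nonneg) auto
  then show ?thesis
    using uv unfolding hyp0F1_kernel_def case_prod_beta u_def[symmetric] v_def[symmetric] pw
    by (simp add: ac_simps)
qed (auto simp: hyp0F1_kernel_def case_prod_beta)

text \<open>The two series grow at most like exp (2 |x| sqrt (u v)) and exp (2 |z| sqrt (u v)),
  while 2 sqrt (\<open>a\<^sub>1\<close> \<open>a\<^sub>2\<close> u v) is at most
  \<open>a\<^sub>1\<close> u + \<open>a\<^sub>2\<close> v by the inequality of arithmetic and
  geometric means. The growth thus uses up at most the fraction \<open>q\<close> of the exponential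
  decay, and the remaining fraction 1 - q gives a product of convergent gamma integrals.\<close>

lemma nn_integral_hyp0F1_kernel_finite:
  assumes p: "p > 0" and a: "a\<^sub>1 > 0" "a\<^sub>2 > 0" and b': "b' \<ge> 1 / 2"
    and q: "q < 1" and le: "\<bar>x\<bar> + \<bar>z\<bar> \<le> q * sqrt (a\<^sub>1 * a\<^sub>2)"
  shows "(\<integral>\<^sup>+w. ennreal (hyp0F1_kernel p a\<^sub>1 a\<^sub>2 (1 / 2) (x\<^sup>2) b' (z\<^sup>2) w) \<partial>lborel) \<noteq> \<top>"
proof -
  define d where "d = 1 - q"
  have d: "d > 0" using q by (simp add: d_def)
  have q0: "0 \<le> q * sqrt (a\<^sub>1 * a\<^sub>2)" using le by linarith
  define g where "g a u = indicator {0<..} u * (u powr (p - 1) * exp (- (a * u)))" for a u :: real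
  have [measurable]: "g a \<in> borel_measurable borel" for a unfolding g_def[abs_def] by measurable
  have g_nn: "0 \<le> g a u" for a u by (simp add: g_def)
  have bound: "hyp0F1_kernel p a\<^sub>1 a\<^sub>2 (1 / 2) (x\<^sup>2) b' (z\<^sup>2) w \<le> g (d * a\<^sub>1) (fst w) * g (d * a\<^sub>2) (snd w)" for w
  proof (cases "0 < fst w \<and> 0 < snd w")
    case True
    define u v where "u = fst w" and "v = snd w"
    have uv: "0 < u" "0 < v" using True by (auto simp: u_def v_def)
    define s where "s = sqrt (u * v)"
    have s: "s > 0" "u * v = s\<^sup>2" using uv by (auto simp: s_def)
    have H: "hyp0F1 b (y\<^sup>2 * (u * v)) \<le> exp (2 * (\<bar>y\<bar> * s))" if "b \<ge> 1 / 2" for b y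
    proof -
      have eq: "y\<^sup>2 * (u * v) = (\<bar>y\<bar> * s)\<^sup>2" unfolding s by (simp add: power_mult_distrib)
      have "hyp0F1 b (y\<^sup>2 * (u * v)) \<le> hyp0F1 (1 / 2) (y\<^sup>2 * (u * v))"
        using that uv by (intro hyp0F1_antimono) auto
      also have "\<dots> = cosh (2 * (\<bar>y\<bar> * s))" unfolding eq by (rule hyp0F1_cosh)
      also have "\<dots> \<le> exp (2 * (\<bar>y\<bar> * s))" using s by (intro cosh_le_exp) auto
      finally show ?thesis .
    qed
    have "2 * (sqrt (a\<^sub>1 * a\<^sub>2) * s) = 2 * (sqrt (a\<^sub>1 * u) * sqrt (a\<^sub>2 * v))"
      using a uv by (simp add: s_def real_sqrt_mult)
    also have "\<dots> \<le> a\<^sub>1 * u + a\<^sub>2 * v"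
      using sum_squares_bound[of "sqrt (a\<^sub>1 * u)" "sqrt (a\<^sub>2 * v)"] a uv by simp
    finally have am: "2 * (sqrt (a\<^sub>1 * a\<^sub>2) * s) \<le> a\<^sub>1 * u + a\<^sub>2 * v" .
    \<comment> \<open>Needed to multiply the mean inequality by \<open>q\<close>; it is forced by
      |x| + |z| >= 0.\<close>
    have q': "0 \<le> q" using q0 mult_pos_pos[OF a] by (simp add: zero_le_mult_iff)
    have "2 * (\<bar>x\<bar> * s) + 2 * (\<bar>z\<bar> * s) = 2 * ((\<bar>x\<bar> + \<bar>z\<bar>) * s)" by (simp add: algebra_simps)
    also have "\<dots> \<le> 2 * (q * sqrt (a\<^sub>1 * a\<^sub>2) * s)"
      using le s by (intro mult_left_mono mult_right_mono) auto
    also have "\<dots> = q * (2 * (sqrt (a\<^sub>1 * a\<^sub>2) * s))" by simp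
    also have "\<dots> \<le> q * (a\<^sub>1 * u + a\<^sub>2 * v)"
      using am q' by (rule mult_left_mono)
    finally have ex: "2 * (\<bar>x\<bar> * s) + 2 * (\<bar>z\<bar> * s) \<le> q * (a\<^sub>1 * u + a\<^sub>2 * v)" .
    have "exp (- (a\<^sub>1 * u + a\<^sub>2 * v)) * hyp0F1 (1 / 2) (x\<^sup>2 * (u * v)) * hyp0F1 b' (z\<^sup>2 * (u * v)) \<le>
      exp (- (a\<^sub>1 * u + a\<^sub>2 * v)) * exp (2 * (\<bar>x\<bar> * s)) * exp (2 * (\<bar>z\<bar> * s))"
      using H[of "1 / 2" x] H[OF b', of z] uv b'
      by (intro mult_mono mult_nonneg_nonneg hyp0F1_nonneg) auto
    also have "\<dots> = exp (- (a\<^sub>1 * u + a\<^sub>2 * v) + (2 * (\<bar>x\<bar> * s) + 2 * (\<bar>z\<bar> * s)))"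
      by (simp only: exp_add mult.assoc)
    also have "\<dots> \<le> exp (- (d * a\<^sub>1 * u) + - (d * a\<^sub>2 * v))"
      using ex by (simp add: d_def algebra_simps)
    also have "\<dots> = exp (- (d * a\<^sub>1 * u)) * exp (- (d * a\<^sub>2 * v))" by (rule exp_add)
    finally have "(u * v) powr (p - 1) * (exp (- (a\<^sub>1 * u + a\<^sub>2 * v)) * hyp0F1 (1 / 2) (x\<^sup>2 * (u * v)) * hyp0F1 b' (z\<^sup>2 * (u * v))) \<le>
      (u * v) powr (p - 1) * (exp (- (d * a\<^sub>1 * u)) * exp (- (d * a\<^sub>2 * v)))"
      by (rule mult_left_mono) simp
    then show ?thesis
      using uv unfolding hyp0F1_kernel_def case_prod_beta u_def[symmetric] v_def[symmetric] g_def
      by (simp add: powr_mult ac_simps)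
  qed (auto simp: hyp0F1_kernel_def case_prod_beta g_def)
  have "(\<integral>\<^sup>+w. ennreal (hyp0F1_kernel p a\<^sub>1 a\<^sub>2 (1 / 2) (x\<^sup>2) b' (z\<^sup>2) w) \<partial>lborel) \<le>
    (\<integral>\<^sup>+w. ennreal (g (d * a\<^sub>1) (fst w)) * ennreal (g (d * a\<^sub>2) (snd w)) \<partial>lborel)"
    using bound g_nn by (intro nn_integral_mono) (simp add: ennreal_mult'[symmetric])
  also have "\<dots> = (\<integral>\<^sup>+u. ennreal (g (d * a\<^sub>1) u) \<partial>lborel) * (\<integral>\<^sup>+u. ennreal (g (d * a\<^sub>2) u) \<partial>lborel)"
    by (rule nn_integral_lborel_prod_mult) auto
  also have "\<dots> < \<top>"
    using d a p unfolding g_def by (simp add: nn_integral_Gamma ennreal_mult_less_top)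
  finally show ?thesis by simp
qed

text \<open>The difference of the squares is \<nu> (|x| - |y|)^2.\<close>

lemma abs_mult_add_le_sqrt:
  fixes x y \<nu> :: real
  assumes "\<nu> \<ge> 0"
  shows "\<bar>x * y\<bar> + \<nu> \<le> sqrt ((x\<^sup>2 + \<nu>) * (y\<^sup>2 + \<nu>))"
proof (rule real_le_rsqrt)
  have "0 \<le> \<nu> * (\<bar>x\<bar> - \<bar>y\<bar>)\<^sup>2" using assms by simp
  also have "\<dots> = (x\<^sup>2 + \<nu>) * (y\<^sup>2 + \<nu>) - (\<bar>x * y\<bar> + \<nu>)\<^sup>2"
    by (simp add: power2_eq_square algebra_simps abs_mult)
  finally show "(\<bar>x * y\<bar> + \<nu>)\<^sup>2 \<le> (x\<^sup>2 + \<nu>) * (y\<^sup>2 + \<nu>)" by simp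
qed

text \<open>Conditionally on the mixing variables \<open>(u, v)\<close>, the vector of \<open>t\<close> variables is a scaled
  binormal vector.\<close>

definition bivariate_t_kernel :: "real \<Rightarrow> real \<Rightarrow> real \<times> real \<Rightarrow> real \<times> real \<Rightarrow> real" where
  "bivariate_t_kernel \<nu> r y w =
     sqrt (fst w * snd w) * binormal_density r (sqrt (fst w) * fst y, sqrt (snd w) * snd y) * bivariate_gamma_density \<nu> r w"

text \<open>A verbatim copy of the function in the theorem, so that the final step only has to fold
  it.\<close>

definition bivariate_t_density :: "real \<Rightarrow> real \<Rightarrow> real \<times> real \<Rightarrow> real" where
  "bivariate_t_density \<nu> r = (\<lambda>(y\<^sub>i, y\<^sub>j). let l = (y\<^sub>i\<^sup>2 + \<nu>) * (y\<^sub>j\<^sup>2 + \<nu>) in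
               \<nu> powr \<nu> * l powr (- (\<nu> + 1) / 2) * (Gamma ((\<nu> + 1) / 2))\<^sup>2 /
                 (pi * (Gamma (\<nu> / 2))\<^sup>2 * (1 - r\<^sup>2) powr (- (\<nu> + 1) / 2)) *
                 appell_F4 ((\<nu> + 1) / 2) ((\<nu> + 1) / 2) (1 / 2) (\<nu> / 2)
                   (r\<^sup>2 * y\<^sub>i\<^sup>2 * y\<^sub>j\<^sup>2 / l) (\<nu>\<^sup>2 * r\<^sup>2 / l)
               + r * y\<^sub>i * y\<^sub>j * \<nu> powr (\<nu> + 2) * l powr (- \<nu> / 2 - 1) /
                 (2 * pi * (1 - r\<^sup>2) powr (- (\<nu> + 1) / 2)) *
                 appell_F4 (\<nu> / 2 + 1) (\<nu> / 2 + 1) (3 / 2) (\<nu> / 2)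
                   (r\<^sup>2 * y\<^sub>i\<^sup>2 * y\<^sub>j\<^sup>2 / l) (\<nu>\<^sup>2 * r\<^sup>2 / l))"

text \<open>The exponents of the binormal and the gamma factor add up to -(\<open>a\<^sub>1\<close>
  u + \<open>a\<^sub>2\<close> v) + 2 x sqrt (u v), whose last part splits into the kernels
  \<open>k\<^sub>1\<close> and \<open>k\<^sub>2\<close>. The bound on \<nu> keeps the parameter
  \<nu> / 2 of the second series at or above 1/2, as the exponential estimate requires.\<close>

lemma nn_integral_bivariate_t_kernel:
  assumes \<nu>: "\<nu> \<ge> 1" and r: "\<bar>r\<bar> < 1"
  shows "(\<integral>\<^sup>+w. ennreal (bivariate_t_kernel \<nu> r y w) \<partial>lborel) = ennreal (bivariate_t_density \<nu> r y)"
    and "0 \<le> bivariate_t_density \<nu> r y"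
proof -
  obtain y\<^sub>1 y\<^sub>2 where y: "y = (y\<^sub>1, y\<^sub>2)" by (cases y)
  define D where "D = 1 - r\<^sup>2"
  have D: "D > 0" using r by (simp add: D_def abs_square_less_1)
  define a\<^sub>1 a\<^sub>2 where "a\<^sub>1 = (y\<^sub>1\<^sup>2 + \<nu>) / (2 * D)" and "a\<^sub>2 = (y\<^sub>2\<^sup>2 + \<nu>) / (2 * D)"
  have pos: "y\<^sub>1\<^sup>2 + \<nu> > 0" "y\<^sub>2\<^sup>2 + \<nu> > 0"
    using \<nu> zero_le_power2[of y\<^sub>1] zero_le_power2[of y\<^sub>2] by linarith+
  have a: "a\<^sub>1 > 0" "a\<^sub>2 > 0" using pos D by (auto simp: a\<^sub>1_def a\<^sub>2_def)
  define l where "l = (y\<^sub>1\<^sup>2 + \<nu>) * (y\<^sub>2\<^sup>2 + \<nu>)"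
  have l: "l > 0" using pos by (simp add: l_def)
  \<comment> \<open>The Jacobian sqrt (u v) in the kernel raises the exponent \<nu> / 2 - 1 of the
    mixing density by 1/2, to p - 1.\<close>
  define p where "p = (\<nu> + 1) / 2"
  have p: "p > 0" "p + 1 / 2 > 0" using \<nu> by (auto simp: p_def add_pos_pos)
  \<comment> \<open>2 x is the coefficient of sqrt (u v) in the exponent, and z^2 that of u v in the
    0F1 of the mixing density.\<close>
  define x where "x = r * y\<^sub>1 * y\<^sub>2 / (2 * D)"
  define z where "z = \<nu> * r / (2 * D)"
  have aa: "a\<^sub>1 * a\<^sub>2 = l / (4 * D\<^sup>2)" by (simp add: a\<^sub>1_def a\<^sub>2_def l_def power2_eq_square)
  define C where "C = 1 / (2 * pi * sqrt D) * (2 powr (- \<nu>) * \<nu> powr \<nu> / ((Gamma (\<nu> / 2))\<^sup>2 * D powr (\<nu> / 2)))"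
  have C: "C \<ge> 0" using D by (simp add: C_def)
  define k\<^sub>1 where "k\<^sub>1 = hyp0F1_kernel p a\<^sub>1 a\<^sub>2 (1 / 2) (x\<^sup>2) (\<nu> / 2) (z\<^sup>2)"
  define k\<^sub>2 where "k\<^sub>2 = hyp0F1_kernel (p + 1 / 2) a\<^sub>1 a\<^sub>2 (3 / 2) (x\<^sup>2) (\<nu> / 2) (z\<^sup>2)"
  have [measurable]: "k\<^sub>1 \<in> borel_measurable borel" "k\<^sub>2 \<in> borel_measurable borel"
    by (simp_all add: k\<^sub>1_def k\<^sub>2_def)
  have k_nn: "0 \<le> k\<^sub>1 w" "0 \<le> k\<^sub>2 w" for w
    unfolding k\<^sub>1_def k\<^sub>2_def hyp0F1_kernel_def case_prod_beta
    using \<nu> by (auto intro!: mult_nonneg_nonneg hyp0F1_nonneg)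
  have k_le: "2 * \<bar>x\<bar> * k\<^sub>2 w \<le> k\<^sub>1 w" for w
    unfolding k\<^sub>1_def k\<^sub>2_def using p \<nu> by (intro hyp0F1_kernel_le_hyp0F1_kernel_half) auto
  have kernel: "bivariate_t_kernel \<nu> r y w = C * (k\<^sub>1 w + 2 * x * k\<^sub>2 w)" for w
  proof (cases "0 < fst w \<and> 0 < snd w")
    case True
    define u v where "u = fst w" and "v = snd w"
    have uv: "0 < u" "0 < v" using True by (auto simp: u_def v_def)
    define s where "s = sqrt (u * v)"
    have s: "s > 0" "u * v = s\<^sup>2" "sqrt u * sqrt v = s" using uv by (auto simp: s_def) (simp add: real_sqrt_mult)
    have sq: "(sqrt u * y\<^sub>1)\<^sup>2 = u * y\<^sub>1\<^sup>2" "(sqrt v * y\<^sub>2)\<^sup>2 = v * y\<^sub>2\<^sup>2" using uv by (auto simp: power_mult_distrib)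
    have cr: "2 * r * (sqrt u * y\<^sub>1) * (sqrt v * y\<^sub>2) = 2 * r * y\<^sub>1 * y\<^sub>2 * s"
      unfolding s(3)[symmetric] by simp
    have e1: "exp (- ((u * y\<^sub>1\<^sup>2 - 2 * r * y\<^sub>1 * y\<^sub>2 * s + v * y\<^sub>2\<^sup>2) / (2 * D))) * exp (- (\<nu> * (u + v) / (2 * D))) =
      exp (- (a\<^sub>1 * u + a\<^sub>2 * v)) * exp (2 * (x * s))"
      unfolding exp_add[symmetric] a\<^sub>1_def a\<^sub>2_def x_def using D by (simp add: field_simps)
    have pw1: "s * (u * v) powr (\<nu> / 2 - 1) = (u * v) powr (p - 1)"
    proof -
      have "s * (u * v) powr (\<nu> / 2 - 1) = (u * v) powr (1 / 2) * (u * v) powr (\<nu> / 2 - 1)"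
        using uv by (simp add: s_def powr_half_sqrt)
      also have "\<dots> = (u * v) powr (p - 1)"
        unfolding powr_add[symmetric] by (simp add: p_def field_simps)
      finally show ?thesis .
    qed
    have pw2: "(u * v) powr (p + 1 / 2 - 1) = (u * v) powr (p - 1) * s"
    proof -
      have "(u * v) powr (p - 1) * s = (u * v) powr (p - 1) * (u * v) powr (1 / 2)"
        using uv by (simp add: s_def powr_half_sqrt)
      also have "\<dots> = (u * v) powr (p + 1 / 2 - 1)"
        unfolding powr_add[symmetric] by (simp add: algebra_simps)
      finally show ?thesis by simp
    qed
    have zz: "\<nu>\<^sup>2 * r\<^sup>2 * u * v / (4 * D\<^sup>2) = z\<^sup>2 * (u * v)"
      by (simp add: z_def power_mult_distrib power_divide)
    have xs: "x\<^sup>2 * (u * v) = (x * s)\<^sup>2" unfolding s by (simp add: power_mult_distrib)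
    have ex: "exp (2 * (x * s)) = hyp0F1 (1 / 2) (x\<^sup>2 * (u * v)) + 2 * x * s * hyp0F1 (3 / 2) (x\<^sup>2 * (u * v))"
      unfolding xs hyp0F1_cosh using hyp0F1_sinh[of "x * s"] cosh_plus_sinh[of "2 * (x * s)"] by (simp add: mult.assoc)
    have "bivariate_t_kernel \<nu> r y w = C * ((s * (u * v) powr (\<nu> / 2 - 1)) *
       (exp (- ((u * y\<^sub>1\<^sup>2 - 2 * r * y\<^sub>1 * y\<^sub>2 * s + v * y\<^sub>2\<^sup>2) / (2 * D))) * exp (- (\<nu> * (u + v) / (2 * D)))) *
        hyp0F1 (\<nu> / 2) (\<nu>\<^sup>2 * r\<^sup>2 * u * v / (4 * D\<^sup>2)))"
      using uv
      unfolding bivariate_t_kernel_def binormal_density_def bivariate_gamma_density_def y case_prod_beta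
        fst_conv snd_conv u_def[symmetric] v_def[symmetric] D_def[symmetric] s_def[symmetric] sq cr C_def
      by simp
    also have "\<dots> = C * (k\<^sub>1 w + 2 * x * k\<^sub>2 w)"
      unfolding pw1 e1 ex zz k\<^sub>1_def k\<^sub>2_def hyp0F1_kernel_def case_prod_beta u_def[symmetric] v_def[symmetric] pw2
      using uv by (simp add: algebra_simps)
    finally show ?thesis .
  qed (auto simp: bivariate_t_kernel_def bivariate_gamma_density_def k\<^sub>1_def k\<^sub>2_def hyp0F1_kernel_def case_prod_beta)

  define j\<^sub>1 where "j\<^sub>1 = (Gamma p)\<^sup>2 / (a\<^sub>1 * a\<^sub>2) powr p * appell_F4 p p (1 / 2) (\<nu> / 2) (x\<^sup>2 / (a\<^sub>1 * a\<^sub>2)) (z\<^sup>2 / (a\<^sub>1 * a\<^sub>2))"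
  define j\<^sub>2 where "j\<^sub>2 = (Gamma (p + 1 / 2))\<^sup>2 / (a\<^sub>1 * a\<^sub>2) powr (p + 1 / 2) *
    appell_F4 (p + 1 / 2) (p + 1 / 2) (3 / 2) (\<nu> / 2) (x\<^sup>2 / (a\<^sub>1 * a\<^sub>2)) (z\<^sup>2 / (a\<^sub>1 * a\<^sub>2))"
  \<comment> \<open>|r| is the fraction of the decay that is used up.\<close>
  have fin: "(\<integral>\<^sup>+w. ennreal (k\<^sub>1 w) \<partial>lborel) \<noteq> \<top>"
    unfolding k\<^sub>1_def
  proof (rule nn_integral_hyp0F1_kernel_finite[OF p(1) a _ r])
    show "1 / 2 \<le> \<nu> / 2" using \<nu> by simp
    have "\<bar>x\<bar> + \<bar>z\<bar> = \<bar>r\<bar> * (\<bar>y\<^sub>1 * y\<^sub>2\<bar> + \<nu>) / (2 * D)"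
      using D \<nu> by (simp add: x_def z_def abs_mult field_simps)
    also have "\<dots> \<le> \<bar>r\<bar> * sqrt l / (2 * D)"
      using abs_mult_add_le_sqrt[of \<nu> y\<^sub>1 y\<^sub>2] \<nu> D by (intro divide_right_mono mult_left_mono) (auto simp: l_def)
    also have "\<dots> = \<bar>r\<bar> * sqrt (a\<^sub>1 * a\<^sub>2)"
      unfolding aa using D by (simp add: real_sqrt_divide real_sqrt_mult)
    finally show "\<bar>x\<bar> + \<bar>z\<bar> \<le> \<bar>r\<bar> * sqrt (a\<^sub>1 * a\<^sub>2)" .
  qed
  have J1: "(\<integral>\<^sup>+w. ennreal (k\<^sub>1 w) \<partial>lborel) = ennreal j\<^sub>1" and j1: "0 \<le> j\<^sub>1"
    using nn_integral_hyp0F1_kernel[OF p(1) a _ _ _ _ fin[unfolded k\<^sub>1_def]] \<nu>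
    by (auto simp: k\<^sub>1_def j\<^sub>1_def)
  have J2: "(\<integral>\<^sup>+w. ennreal (2 * \<bar>x\<bar> * k\<^sub>2 w) \<partial>lborel) = ennreal (2 * \<bar>x\<bar> * j\<^sub>2)" and j2: "0 \<le> 2 * \<bar>x\<bar> * j\<^sub>2"
  proof -
    have m: "(\<integral>\<^sup>+w. ennreal (2 * \<bar>x\<bar> * k\<^sub>2 w) \<partial>lborel) = ennreal (2 * \<bar>x\<bar>) * (\<integral>\<^sup>+w. ennreal (k\<^sub>2 w) \<partial>lborel)"
      using k_nn by (simp add: ennreal_mult nn_integral_cmult)
    have "(\<integral>\<^sup>+w. ennreal (2 * \<bar>x\<bar> * k\<^sub>2 w) \<partial>lborel) \<le> (\<integral>\<^sup>+w. ennreal (k\<^sub>1 w) \<partial>lborel)"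
      using k_le by (intro nn_integral_mono) (simp add: ennreal_leI)
    then have f: "ennreal (2 * \<bar>x\<bar>) * (\<integral>\<^sup>+w. ennreal (k\<^sub>2 w) \<partial>lborel) \<noteq> \<top>"
      unfolding m J1 by (auto simp: top_unique)
    have "(\<integral>\<^sup>+w. ennreal (2 * \<bar>x\<bar> * k\<^sub>2 w) \<partial>lborel) = ennreal (2 * \<bar>x\<bar> * j\<^sub>2) \<and> 0 \<le> 2 * \<bar>x\<bar> * j\<^sub>2"
    \<comment> \<open>For x = 0 the comparison with \<open>k\<^sub>1\<close> says nothing about the
      integral of \<open>k\<^sub>2\<close>, but the whole term vanishes.\<close>
    proof (cases "x = 0")
      case False
      with f have f2: "(\<integral>\<^sup>+w. ennreal (k\<^sub>2 w) \<partial>lborel) \<noteq> \<top>" by (auto simp: ennreal_mult_eq_top_iff)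
      have "(\<integral>\<^sup>+w. ennreal (k\<^sub>2 w) \<partial>lborel) = ennreal j\<^sub>2" "0 \<le> j\<^sub>2"
        using nn_integral_hyp0F1_kernel[OF p(2) a _ _ _ _ f2[unfolded k\<^sub>2_def]] \<nu>
        by (auto simp: k\<^sub>2_def j\<^sub>2_def)
      then show ?thesis unfolding m by (simp add: ennreal_mult)
    qed simp
    then show "(\<integral>\<^sup>+w. ennreal (2 * \<bar>x\<bar> * k\<^sub>2 w) \<partial>lborel) = ennreal (2 * \<bar>x\<bar> * j\<^sub>2)" "0 \<le> 2 * \<bar>x\<bar> * j\<^sub>2" by auto
  qed
  have sum: "(\<integral>\<^sup>+w. ennreal (k\<^sub>1 w + 2 * x * k\<^sub>2 w) \<partial>lborel) = ennreal (j\<^sub>1 + 2 * x * j\<^sub>2) \<and> 0 \<le> j\<^sub>1 + 2 * x * j\<^sub>2"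
  proof (cases "x \<ge> 0")
    case True
    then have "(\<integral>\<^sup>+w. ennreal (k\<^sub>1 w + 2 * x * k\<^sub>2 w) \<partial>lborel) =
      (\<integral>\<^sup>+w. ennreal (k\<^sub>1 w) \<partial>lborel) + (\<integral>\<^sup>+w. ennreal (2 * \<bar>x\<bar> * k\<^sub>2 w) \<partial>lborel)"
      using k_nn by (subst nn_integral_add[symmetric]) (auto simp: ennreal_plus)
    then show ?thesis using True j1 j2 unfolding J1 J2 by (simp add: ennreal_plus)
  next
    case False
    \<comment> \<open>The odd term is negative here. It is moved to the other side, where every
      integrand is nonnegative, and cancelled there because all integrals are finite.\<close>
    define I where "I = (\<integral>\<^sup>+w. ennreal (k\<^sub>1 w + 2 * x * k\<^sub>2 w) \<partial>lborel)"
    have nn: "0 \<le> k\<^sub>1 w + 2 * x * k\<^sub>2 w" for w using k_le[of w] False by simp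
    have "I + (\<integral>\<^sup>+w. ennreal (2 * \<bar>x\<bar> * k\<^sub>2 w) \<partial>lborel) = (\<integral>\<^sup>+w. ennreal (k\<^sub>1 w) \<partial>lborel)"
      unfolding I_def
    proof (subst nn_integral_add[symmetric])
      have "ennreal (k\<^sub>1 w + 2 * x * k\<^sub>2 w) + ennreal (2 * \<bar>x\<bar> * k\<^sub>2 w) = ennreal (k\<^sub>1 w)" for w
        using False by (subst ennreal_plus[OF nn, symmetric]) (auto simp: mult_nonpos_nonneg k_nn)
      then show "(\<integral>\<^sup>+w. ennreal (k\<^sub>1 w + 2 * x * k\<^sub>2 w) + ennreal (2 * \<bar>x\<bar> * k\<^sub>2 w) \<partial>lborel) = (\<integral>\<^sup>+w. ennreal (k\<^sub>1 w) \<partial>lborel)"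
        by simp
    qed auto
    then have eq: "I + ennreal (2 * \<bar>x\<bar> * j\<^sub>2) = ennreal j\<^sub>1" unfolding J1 J2 .
    then have "I \<noteq> \<top>" by auto
    then obtain i where i: "I = ennreal i" "0 \<le> i" by (cases I) auto
    have "ennreal (i + 2 * \<bar>x\<bar> * j\<^sub>2) = ennreal j\<^sub>1" using eq i j2 by (simp add: ennreal_plus)
    then have "i + 2 * \<bar>x\<bar> * j\<^sub>2 = j\<^sub>1" using i j2 j1 by (subst (asm) ennreal_inj) auto
    then show ?thesis using i False unfolding I_def by auto
  qed
  have int: "(\<integral>\<^sup>+w. ennreal (bivariate_t_kernel \<nu> r y w) \<partial>lborel) = ennreal (C * (j\<^sub>1 + 2 * x * j\<^sub>2))"
    unfolding kernel ennreal_mult'[OF C] using sum by (simp add: nn_integral_cmult)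

  have args: "x\<^sup>2 / (a\<^sub>1 * a\<^sub>2) = r\<^sup>2 * y\<^sub>1\<^sup>2 * y\<^sub>2\<^sup>2 / l" "z\<^sup>2 / (a\<^sub>1 * a\<^sub>2) = \<nu>\<^sup>2 * r\<^sup>2 / l"
    unfolding aa using D l by (auto simp: x_def z_def power_mult_distrib power_divide)
  have aap: "1 / (a\<^sub>1 * a\<^sub>2) powr t = l powr (- t) * 2 powr (2 * t) * D powr (2 * t)" for t
  proof -
    have "4 * D\<^sup>2 = (2 * D) powr 2" using D by (simp add: power_mult_distrib)
    then have "(4 * D\<^sup>2) powr t = (2 * D) powr (2 * t)" by (simp only: powr_powr)
    also have "\<dots> = 2 powr (2 * t) * D powr (2 * t)" by (rule powr_mult)
    finally have "(a\<^sub>1 * a\<^sub>2) powr t = l powr t / (2 powr (2 * t) * D powr (2 * t))"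
      unfolding aa using l D by (simp only: powr_divide)
    moreover have "l powr (- t) = 1 / l powr t" by (rule powr_minus_divide)
    ultimately show ?thesis by simp
  qed
  have p': "p + 1 / 2 = \<nu> / 2 + 1" by (simp add: p_def field_simps)
  have Dpow: "1 / sqrt D * (1 / D powr (\<nu> / 2)) * D powr t = 1 / D powr (\<nu> / 2 + 1 / 2 - t)" for t
  proof -
    have "1 / sqrt D = D powr (- (1 / 2))"
      using D by (simp add: powr_minus_divide powr_half_sqrt)
    then have "1 / sqrt D * (1 / D powr (\<nu> / 2)) * D powr t = D powr (- (1 / 2) + - (\<nu> / 2) + t)"
      by (simp only: powr_add powr_minus_divide)
    also have "- (1 / 2) + - (\<nu> / 2) + t = - (\<nu> / 2 + 1 / 2 - t)" by simp
    finally show ?thesis by (simp only: powr_minus_divide)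
  qed
  \<comment> \<open>Separates the powers of 2, the powers of D and the remaining factors; both
    coefficients below are instances.\<close>
  have regroup: "1 / (2 * pi * sd) * (T * V / (G * d)) * (X * (L * T' * d')) =
    (T * T') * (1 / sd * (1 / d) * d') * (V * L * X / (2 * pi * G))" for sd T V G d X L T' d' :: real
    by (simp add: ac_simps)
  have c1: "C * ((Gamma p)\<^sup>2 / (a\<^sub>1 * a\<^sub>2) powr p) = \<nu> powr \<nu> * l powr (- (\<nu> + 1) / 2) * (Gamma ((\<nu> + 1) / 2))\<^sup>2 /
                 (pi * (Gamma (\<nu> / 2))\<^sup>2 * D powr (- (\<nu> + 1) / 2))"
  proof -
    \<comment> \<open>The factor 2 that is left turns 1 / (2 pi) into 1 / pi.\<close>
    have two: "2 powr (- \<nu>) * 2 powr (2 * p) = 2"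
    proof -
      have "- \<nu> + 2 * p = 1" unfolding p_def by (simp add: field_simps)
      then show ?thesis by (simp only: powr_add[symmetric]) simp
    qed
    have e: "\<nu> / 2 + 1 / 2 - 2 * p = - (\<nu> + 1) / 2" "- p = - (\<nu> + 1) / 2"
      unfolding p_def by (simp_all add: field_simps)
    have "C * ((Gamma p)\<^sup>2 / (a\<^sub>1 * a\<^sub>2) powr p) = C * ((Gamma p)\<^sup>2 * (1 / (a\<^sub>1 * a\<^sub>2) powr p))"
      by simp
    also have "\<dots> = (2 powr (- \<nu>) * 2 powr (2 * p)) * (1 / sqrt D * (1 / D powr (\<nu> / 2)) * D powr (2 * p)) *
        (\<nu> powr \<nu> * l powr (- p) * (Gamma p)\<^sup>2 / (2 * pi * (Gamma (\<nu> / 2))\<^sup>2))"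
      unfolding aap C_def by (rule regroup)
    also have "\<dots> = \<nu> powr \<nu> * l powr (- (\<nu> + 1) / 2) * (Gamma p)\<^sup>2 / (pi * (Gamma (\<nu> / 2))\<^sup>2 * D powr (- (\<nu> + 1) / 2))"
      unfolding two Dpow e by (simp add: ac_simps)
    finally show ?thesis by (simp only: p_def)
  qed
  have c2: "C * (2 * x * ((Gamma (p + 1 / 2))\<^sup>2 / (a\<^sub>1 * a\<^sub>2) powr (p + 1 / 2))) =
     r * y\<^sub>1 * y\<^sub>2 * \<nu> powr (\<nu> + 2) * l powr (- \<nu> / 2 - 1) / (2 * pi * D powr (- (\<nu> + 1) / 2))"
  proof -
    \<comment> \<open>The 4 cancels against the square of Gamma (\<nu> / 2 + 1) / Gamma (\<nu> / 2)
      = \<nu> / 2. What is left is \<nu>^2, so the second coefficient contains no Gamma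
      value.\<close>
    have two: "2 powr (- \<nu>) * 2 powr (2 * (\<nu> / 2 + 1)) = 4"
    proof -
      have "- \<nu> + 2 * (\<nu> / 2 + 1) = 2" by simp
      then show ?thesis by (simp only: powr_add[symmetric]) simp
    qed
    have e: "- (\<nu> / 2 + 1) = - \<nu> / 2 - 1" by simp
    \<comment> \<open>The leading 1 / D is contributed by 2 x; it brings the power of D to the same
      exponent as in the first coefficient.\<close>
    have dd: "1 / D * (1 / sqrt D * (1 / D powr (\<nu> / 2)) * D powr (2 * (\<nu> / 2 + 1))) = 1 / D powr (- (\<nu> + 1) / 2)"
    proof -
      have "1 / D * (1 / D powr (\<nu> / 2 + 1 / 2 - 2 * (\<nu> / 2 + 1))) = 1 / D powr (1 + (\<nu> / 2 + 1 / 2 - 2 * (\<nu> / 2 + 1)))"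
        using D by (simp only: powr_add powr_one') simp
      also have "1 + (\<nu> / 2 + 1 / 2 - 2 * (\<nu> / 2 + 1)) = - (\<nu> + 1) / 2" by (simp add: field_simps)
      finally show ?thesis unfolding Dpow .
    qed
    have "Gamma (\<nu> / 2) > 0"
      by (rule Gamma_real_pos) (use \<nu> in simp)
    then have G2: "Gamma (\<nu> / 2) \<noteq> 0" by (rule less_imp_neq[THEN not_sym])
    have G1: "Gamma (\<nu> / 2 + 1) = \<nu> / 2 * Gamma (\<nu> / 2)"
      using Gamma_plus_nat[of "\<nu> / 2" 1] \<nu> by simp
    have nn: "\<nu> powr (\<nu> + 2) = \<nu> powr \<nu> * \<nu>\<^sup>2" using \<nu> by (simp add: powr_add)
    have "C * (2 * x * ((Gamma (p + 1 / 2))\<^sup>2 / (a\<^sub>1 * a\<^sub>2) powr (p + 1 / 2))) =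
      2 * x * (C * ((Gamma (\<nu> / 2 + 1))\<^sup>2 * (1 / (a\<^sub>1 * a\<^sub>2) powr (\<nu> / 2 + 1))))"
      unfolding p' by simp
    also have "\<dots> = 2 * x * ((2 powr (- \<nu>) * 2 powr (2 * (\<nu> / 2 + 1))) *
      (1 / sqrt D * (1 / D powr (\<nu> / 2)) * D powr (2 * (\<nu> / 2 + 1))) *
        (\<nu> powr \<nu> * l powr (- (\<nu> / 2 + 1)) * (Gamma (\<nu> / 2 + 1))\<^sup>2 / (2 * pi * (Gamma (\<nu> / 2))\<^sup>2)))"
      unfolding aap C_def by (simp only: regroup)
    also have "\<dots> = (1 / D * (1 / sqrt D * (1 / D powr (\<nu> / 2)) * D powr (2 * (\<nu> / 2 + 1)))) *
      (r * y\<^sub>1 * y\<^sub>2 * (\<nu> powr \<nu> * \<nu>\<^sup>2) * l powr (- (\<nu> / 2 + 1)) / (2 * pi))"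
      unfolding two G1 x_def using G2 D by (simp add: power2_eq_square ac_simps)
    also have "\<dots> = r * y\<^sub>1 * y\<^sub>2 * \<nu> powr (\<nu> + 2) * l powr (- \<nu> / 2 - 1) / (2 * pi * D powr (- (\<nu> + 1) / 2))"
      unfolding dd nn e by simp
    finally show ?thesis .
  qed
  have f: "bivariate_t_density \<nu> r y = C * (j\<^sub>1 + 2 * x * j\<^sub>2)"
  proof -
    have "C * (j\<^sub>1 + 2 * x * j\<^sub>2) =
      C * ((Gamma p)\<^sup>2 / (a\<^sub>1 * a\<^sub>2) powr p) * appell_F4 p p (1 / 2) (\<nu> / 2) (x\<^sup>2 / (a\<^sub>1 * a\<^sub>2)) (z\<^sup>2 / (a\<^sub>1 * a\<^sub>2)) +
      C * (2 * x * ((Gamma (p + 1 / 2))\<^sup>2 / (a\<^sub>1 * a\<^sub>2) powr (p + 1 / 2))) *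
        appell_F4 (p + 1 / 2) (p + 1 / 2) (3 / 2) (\<nu> / 2) (x\<^sup>2 / (a\<^sub>1 * a\<^sub>2)) (z\<^sup>2 / (a\<^sub>1 * a\<^sub>2))"
      by (simp add: j\<^sub>1_def j\<^sub>2_def algebra_simps)
    also have "\<dots> = bivariate_t_density \<nu> r y"
      unfolding c1 c2 unfolding args p' unfolding bivariate_t_density_def y p_def l_def D_def Let_def by simp
    finally show ?thesis ..
  qed
  show "(\<integral>\<^sup>+w. ennreal (bivariate_t_kernel \<nu> r y w) \<partial>lborel) = ennreal (bivariate_t_density \<nu> r y)"
    unfolding int f ..
  show "0 \<le> bivariate_t_density \<nu> r y"
    unfolding f using C sum by simp
qed

section \<open>Squares of a binormal pair\<close>

text \<open>The factor 1 / sqrt u is singular at 0 and the half-line is not compact. The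
  substitution u = x^2 / q is therefore made on compact intervals exhausting the half-line, and
  monotone convergence does the rest.\<close>

lemma nn_integral_positive_square_substitution:
  fixes K :: "real \<Rightarrow> ennreal"
  assumes [measurable]: "K \<in> borel_measurable borel" and q: "q > 0"
  shows "(\<integral>\<^sup>+x. K x * indicator {0<..} x \<partial>lborel) =
    (\<integral>\<^sup>+u. K (sqrt (q * u)) * ennreal (sqrt q / (2 * sqrt u)) * indicator {0<..} u \<partial>lborel)"
proof -
  define f where "f u = K (sqrt (q * u)) * ennreal (sqrt q / (2 * sqrt u))" for u
  have [measurable]: "f \<in> borel_measurable borel" unfolding f_def[abs_def] by measurable
  \<comment> \<open>The shift by 2 gives a n < 1 < b n already for n = 0.\<close>
  define a b :: "nat \<Rightarrow> real" where "a n = 1 / (real n + 2)" and "b n = real n + 2" for n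
  have ab: "0 < a n" "a n < b n" for n
  proof -
    have "a n \<le> 1" "1 < b n" by (auto simp: a_def b_def)
    then show "a n < b n" by linarith
  qed (simp add: a_def)
  have a_mono: "a n \<le> a m" if "m \<le> n" for m n using that by (simp add: a_def frac_le)
  have b_mono: "b m \<le> b n" if "m \<le> n" for m n using that by (simp add: b_def)
  have exhaust: "\<exists>n. a n \<le> x \<and> x \<le> b n" if "x > 0" for x
  proof -
    obtain n where n: "max x (1 / x) < real n" using reals_Archimedean2 by blast
    then have "1 / x \<le> real n + 2" "x \<le> real n + 2" by linarith+
    then have "a n \<le> x" using that by (simp add: a_def field_simps)
    with \<open>x \<le> real n + 2\<close> show ?thesis by (auto simp: b_def)
  qed
  have lim: "(\<integral>\<^sup>+x. F x * indicator (\<Union>n. A n) x \<partial>lborel) = (SUP n. \<integral>\<^sup>+x. F x * indicator (A n) x \<partial>lborel)"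
    if "incseq A" "\<And>n. A n \<in> sets borel" and [measurable]: "F \<in> borel_measurable borel"
    for F :: "real \<Rightarrow> ennreal" and A
  proof -
    have [measurable]: "A n \<in> sets borel" for n using that by auto
    have "(SUP n. emeasure (density lborel F) (A n)) = emeasure (density lborel F) (\<Union>n. A n)"
      using that by (intro SUP_emeasure_incseq) auto
    then show ?thesis by (simp add: emeasure_density)
  qed
  have inner: "(\<integral>\<^sup>+u. f u * indicator {(a n)\<^sup>2 / q..(b n)\<^sup>2 / q} u \<partial>lborel) = (\<integral>\<^sup>+x. K x * indicator {a n..b n} x \<partial>lborel)" for n
  proof -
    have "(\<integral>\<^sup>+u. f u * indicator {(a n)\<^sup>2 / q..(b n)\<^sup>2 / q} u \<partial>lborel) =
      (\<integral>\<^sup>+x. f (x\<^sup>2 / q) * ennreal (2 * x / q) * indicator {a n..b n} x \<partial>lborel)"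
    proof (rule nn_integral_substitution_aux[where g = "\<lambda>x. x\<^sup>2 / q" and g' = "\<lambda>x. 2 * x / q"])
      show "((\<lambda>x. x\<^sup>2 / q) has_real_derivative 2 * x / q) (at x)" for x
        using q by (auto intro!: derivative_eq_intros)
      show "continuous_on {a n..b n} (\<lambda>x. 2 * x / q)" by (intro continuous_intros) (use q in auto)
      show "0 \<le> 2 * x / q" if "x \<in> {a n..b n}" for x using that ab[of n] q by auto
    qed (use ab in auto)
    also have "\<dots> = (\<integral>\<^sup>+x. K x * indicator {a n..b n} x \<partial>lborel)"
    proof (intro nn_integral_cong)
      fix x :: real
      show "f (x\<^sup>2 / q) * ennreal (2 * x / q) * indicator {a n..b n} x = K x * indicator {a n..b n} x"
      proof (cases "x \<in> {a n..b n}")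
        case True
        then have x: "x > 0" using ab[of n] by auto
        have "sqrt q / (2 * sqrt (x\<^sup>2 / q)) * (2 * x / q) = 1"
          using x q by (simp add: real_sqrt_divide real_sqrt_mult[symmetric] field_simps)
        then have "ennreal (sqrt q / (2 * sqrt (x\<^sup>2 / q))) * ennreal (2 * x / q) = 1"
          using x q by (simp add: ennreal_mult'[symmetric])
        moreover have "sqrt (q * (x\<^sup>2 / q)) = x" using x q by simp
        ultimately show ?thesis using True by (simp add: f_def mult.assoc)
      qed simp
    qed
    finally show ?thesis .
  qed
  have U1: "{0<..} = (\<Union>n. {a n..b n})"
  proof safe
    fix x :: real assume "0 < x"
    from exhaust[OF this] show "x \<in> (\<Union>n. {a n..b n})" by auto
  next
    fix x n assume "x \<in> {a n..b n}"
    then show "0 < x" using ab(1)[of n] by auto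
  qed
  have U2: "{0<..} = (\<Union>n. {(a n)\<^sup>2 / q..(b n)\<^sup>2 / q})"
  proof safe
    fix u :: real assume u: "0 < u"
    then obtain n where n: "a n \<le> sqrt (q * u)" "sqrt (q * u) \<le> b n" using exhaust[of "sqrt (q * u)"] q by auto
    have "(a n)\<^sup>2 \<le> (sqrt (q * u))\<^sup>2"
      by (rule power_mono) (use n ab[of n] in auto)
    moreover have "(sqrt (q * u))\<^sup>2 \<le> (b n)\<^sup>2"
      by (rule power_mono) (use n q u in auto)
    ultimately show "u \<in> (\<Union>n. {(a n)\<^sup>2 / q..(b n)\<^sup>2 / q})" using q u by (auto simp: field_simps)
  next
    fix u n assume "u \<in> {(a n)\<^sup>2 / q..(b n)\<^sup>2 / q}"
    moreover have "0 < (a n)\<^sup>2 / q" using ab[of n] q by simp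
    ultimately show "0 < u" by auto
  qed
  have i1: "incseq (\<lambda>n. {a n..b n})"
    unfolding incseq_def using a_mono b_mono by (auto intro: order_trans)
  have i2: "incseq (\<lambda>n. {(a n)\<^sup>2 / q..(b n)\<^sup>2 / q})"
    unfolding incseq_def
  proof (intro allI impI)
    fix m n :: nat assume mn: "m \<le> n"
    have "(a n)\<^sup>2 / q \<le> (a m)\<^sup>2 / q" "(b m)\<^sup>2 / q \<le> (b n)\<^sup>2 / q"
      using a_mono[OF mn] b_mono[OF mn] ab[of n] ab[of m] q by (auto intro!: divide_right_mono power_mono)
    then show "{(a m)\<^sup>2 / q..(b m)\<^sup>2 / q} \<subseteq> {(a n)\<^sup>2 / q..(b n)\<^sup>2 / q}" by auto
  qed
  have "(\<integral>\<^sup>+x. K x * indicator {0<..} x \<partial>lborel) = (\<integral>\<^sup>+u. f u * indicator {0<..} u \<partial>lborel)"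
  proof -
    have "(\<integral>\<^sup>+x. K x * indicator (\<Union>n. {a n..b n}) x \<partial>lborel) =
      (\<integral>\<^sup>+u. f u * indicator (\<Union>n. {(a n)\<^sup>2 / q..(b n)\<^sup>2 / q}) u \<partial>lborel)"
      by (simp add: lim[OF i1] lim[OF i2] inner)
    then show ?thesis unfolding U1[symmetric] U2[symmetric] .
  qed
  then show ?thesis by (simp add: f_def)
qed

text \<open>Squaring is two-to-one: the negative half-line is reflected onto the positive one, 0 is
  a null set, and both roots contribute to the weight \<open>h\<close>.\<close>

lemma nn_integral_square_substitution:
  fixes F h :: "real \<Rightarrow> ennreal"
  assumes [measurable]: "F \<in> borel_measurable borel" "h \<in> borel_measurable borel" and q: "q > 0"
  shows "(\<integral>\<^sup>+x. F (x\<^sup>2 / q) * h x \<partial>lborel) =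
    (\<integral>\<^sup>+u. F u * (ennreal (sqrt q / (2 * sqrt u)) * indicator {0<..} u) * (h (sqrt (q * u)) + h (- sqrt (q * u))) \<partial>lborel)"
proof -
  have half: "(\<integral>\<^sup>+x. F (x\<^sup>2 / q) * g x * indicator {0<..} x \<partial>lborel) =
    (\<integral>\<^sup>+u. F u * (ennreal (sqrt q / (2 * sqrt u)) * indicator {0<..} u) * g (sqrt (q * u)) \<partial>lborel)"
    if [measurable]: "g \<in> borel_measurable borel" for g
    using q
    by (subst nn_integral_positive_square_substitution[where q = q])
      (auto intro!: nn_integral_cong simp: ac_simps split: split_indicator)
  have "(\<integral>\<^sup>+x. F (x\<^sup>2 / q) * h x \<partial>lborel) =
    (\<integral>\<^sup>+x. F (x\<^sup>2 / q) * h x * indicator {0<..} x + F (x\<^sup>2 / q) * h x * indicator {..<0} x \<partial>lborel)"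
  proof (rule nn_integral_cong_AE)
    have "AE x in lborel. x \<noteq> (0::real)" by (rule AE_lborel_singleton)
    then show "AE x in lborel. F (x\<^sup>2 / q) * h x = F (x\<^sup>2 / q) * h x * indicator {0<..} x + F (x\<^sup>2 / q) * h x * indicator {..<0} x"
      by eventually_elim (auto split: split_indicator)
  qed
  also have "\<dots> = (\<integral>\<^sup>+x. F (x\<^sup>2 / q) * h x * indicator {0<..} x \<partial>lborel) + (\<integral>\<^sup>+x. F (x\<^sup>2 / q) * h x * indicator {..<0} x \<partial>lborel)"
    by (rule nn_integral_add) measurable
  also have "(\<integral>\<^sup>+x. F (x\<^sup>2 / q) * h x * indicator {..<0} x \<partial>lborel) = (\<integral>\<^sup>+x. F (x\<^sup>2 / q) * h (- x) * indicator {0<..} x \<partial>lborel)"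
    by (subst nn_integral_real_affine[where c = "-1" and t = 0])
      (auto intro!: nn_integral_cong split: split_indicator simp flip: one_ennreal_def)
  also have "(\<integral>\<^sup>+x. F (x\<^sup>2 / q) * h x * indicator {0<..} x \<partial>lborel) + (\<integral>\<^sup>+x. F (x\<^sup>2 / q) * h (- x) * indicator {0<..} x \<partial>lborel) =
    (\<integral>\<^sup>+u. F u * (ennreal (sqrt q / (2 * sqrt u)) * indicator {0<..} u) * (h (sqrt (q * u)) + h (- sqrt (q * u))) \<partial>lborel)"
    by (subst half, simp, subst half[where g = "\<lambda>x. h (- x)"], simp, subst nn_integral_add[symmetric])
      (auto simp: distrib_left)
  finally show ?thesis .
qed

text \<open>The left side is the density of (X^2 / q, Y^2 / q) for a binormal pair, with one summand
  for each choice of signs. The cross term is positive in two exponents and negative in two (up to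
  the sign of r), so the sum is four times a cosh, that is a 0F1 with parameter 1/2, and (Gamma
  (1/2))^2 = pi accounts for the constant. The right side is the closed form of
  \<open>kibble_density\<close> for shape 1/2.\<close>

lemma kibble_density_half:
  assumes r: "\<bar>r\<bar> < 1" and q: "q > 0" and uv: "0 < u" "0 < v"
  defines "s \<equiv> sqrt (q * u)" and "t \<equiv> sqrt (q * v)"
  shows "sqrt q / (2 * sqrt u) * (sqrt q / (2 * sqrt v)) *
     (binormal_density r (s, t) + binormal_density r (s, - t) + (binormal_density r (- s, t) + binormal_density r (- s, - t))) =
    (1 - r\<^sup>2) powr (1 / 2) * (q / (2 * (1 - r\<^sup>2))) powr (2 * (1 / 2)) / (Gamma (1 / 2))\<^sup>2 * (u * v) powr (1 / 2 - 1) *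
     exp (- (q / (2 * (1 - r\<^sup>2)) * (u + v))) * hyp0F1 (1 / 2) ((q / (2 * (1 - r\<^sup>2)))\<^sup>2 * r\<^sup>2 * (u * v))"
proof -
  define D where "D = 1 - r\<^sup>2"
  have D: "D > 0" using r by (simp add: D_def abs_square_less_1)
  define c where "c = q / (2 * D)"
  have c: "c > 0" using q D by (simp add: c_def)
  define w where "w = sqrt (u * v)"
  have w: "w > 0" "w\<^sup>2 = u * v" "sqrt u * sqrt v = w" using uv by (auto simp: w_def) (simp add: real_sqrt_mult)
  have st: "s\<^sup>2 = q * u" "t\<^sup>2 = q * v" using uv q by (auto simp: s_def t_def)
  have stw: "s * t = q * w" using uv q by (simp add: s_def t_def w_def real_sqrt_mult)
  define B where "B = 1 / (2 * pi * sqrt D) * exp (- (c * (u + v)))"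
  have plus: "1 / (2 * pi * sqrt D) * exp (- ((q * u - 2 * r * (q * w) + q * v) / (2 * D))) = B * exp (2 * (c * r * w))"
    unfolding B_def mult.assoc exp_add[symmetric] c_def using D by (simp add: field_simps)
  have minus: "1 / (2 * pi * sqrt D) * exp (- ((q * u + 2 * r * (q * w) + q * v) / (2 * D))) = B * exp (- (2 * (c * r * w)))"
    unfolding B_def mult.assoc exp_add[symmetric] c_def using D by (simp add: field_simps)
  have b: "binormal_density r (s, t) = B * exp (2 * (c * r * w))" "binormal_density r (- s, - t) = B * exp (2 * (c * r * w))"
    "binormal_density r (s, - t) = B * exp (- (2 * (c * r * w)))" "binormal_density r (- s, t) = B * exp (- (2 * (c * r * w)))"
    unfolding plus[symmetric] minus[symmetric] by (simp_all add: binormal_density_def D_def st stw mult.assoc)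
  have "sqrt q / (2 * sqrt u) * (sqrt q / (2 * sqrt v)) = q / (4 * w)"
    using q unfolding w(3)[symmetric] by simp
  then have "sqrt q / (2 * sqrt u) * (sqrt q / (2 * sqrt v)) *
     (binormal_density r (s, t) + binormal_density r (s, - t) + (binormal_density r (- s, t) + binormal_density r (- s, - t))) =
     q / (4 * w) * (B * (2 * (exp (2 * (c * r * w)) + exp (- (2 * (c * r * w))))))"
    unfolding b by (simp add: algebra_simps)
  also have "exp (2 * (c * r * w)) + exp (- (2 * (c * r * w))) = 2 * hyp0F1 (1 / 2) ((c * r * w)\<^sup>2)"
    unfolding hyp0F1_cosh by (simp add: cosh_def)
  also have "(c * r * w)\<^sup>2 = c\<^sup>2 * r\<^sup>2 * (u * v)" by (simp add: power_mult_distrib w(2))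
  also have "q / (4 * w) * (B * (2 * (2 * hyp0F1 (1 / 2) (c\<^sup>2 * r\<^sup>2 * (u * v))))) =
    sqrt D * c / pi * (1 / w) * exp (- (c * (u + v))) * hyp0F1 (1 / 2) (c\<^sup>2 * r\<^sup>2 * (u * v))"
  proof -
    have "q / (4 * w) * (1 / (2 * pi * sqrt D)) * 4 = sqrt D * c / pi * (1 / w)"
      using D w(1) by (simp add: c_def field_simps)
    then have "q / (4 * w) * (1 / (2 * pi * sqrt D)) * 4 * (exp (- (c * (u + v))) * hyp0F1 (1 / 2) (c\<^sup>2 * r\<^sup>2 * (u * v))) =
      sqrt D * c / pi * (1 / w) * (exp (- (c * (u + v))) * hyp0F1 (1 / 2) (c\<^sup>2 * r\<^sup>2 * (u * v)))" by (simp only:)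
    then show ?thesis unfolding B_def by (simp add: mult.assoc mult.left_commute)
  qed
  also have "1 / w = (u * v) powr (1 / 2 - 1)"
  proof -
    have "(u * v) powr (1 / 2 - 1) = (u * v) powr (- (1 / 2))" by simp
    also have "\<dots> = 1 / w" using uv by (simp only: powr_minus_divide) (simp add: powr_half_sqrt w_def)
    finally show ?thesis ..
  qed
  also have "sqrt D * c / pi = D powr (1 / 2) * c powr (2 * (1 / 2)) / (Gamma (1 / 2))\<^sup>2"
    using D c by (simp add: powr_half_sqrt Gamma_one_half_real)
  finally show ?thesis unfolding c_def D_def .
qed

lemma distributedI_indicator:
  fixes X :: "'a \<Rightarrow> 'b::euclidean_space"
  assumes X [measurable]: "X \<in> borel_measurable M" and f [measurable]: "f \<in> borel_measurable borel"
    and eq: "\<And>A. A \<in> sets borel \<Longrightarrow> (\<integral>\<^sup>+\<omega>. indicator A (X \<omega>) \<partial>M) = (\<integral>\<^sup>+x. f x * indicator A x \<partial>lborel)"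
  shows "distributed M lborel X f"
  unfolding distributed_def
proof (intro conjI measure_eqI)
  fix A assume "A \<in> sets (distr M lborel X)"
  then have A [measurable]: "A \<in> sets borel" by simp
  show "emeasure (distr M lborel X) A = emeasure (density lborel f) A"
    using eq[OF A] by (simp add: emeasure_distr_conv_nn_integral emeasure_density)
qed simp_all

text \<open>The one-dimensional substitution is applied to each coordinate in turn, with Fubini in
  between. The scale \<open>q\<close> becomes the number of copies, since the mixing process
  averages their squares.\<close>

lemma distributed_squares:
  assumes X: "distributed M lborel X (\<lambda>w. ennreal (binormal_density r w))" and r: "\<bar>r\<bar> < 1" and q: "q > 0"
  shows "distributed M lborel (\<lambda>\<omega>. ((fst (X \<omega>))\<^sup>2 / q, (snd (X \<omega>))\<^sup>2 / q)) (kibble_density (1 / 2) (q / (2 * (1 - r\<^sup>2))) r)"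
proof (rule distributedI_indicator)
  have X_meas [measurable]: "X \<in> borel_measurable M" using distributed_measurable[OF X] by simp
  have sq: "(\<lambda>w :: real \<times> real. ((fst w)\<^sup>2 / q, (snd w)\<^sup>2 / q)) \<in> borel_measurable borel"
    unfolding borel_prod[symmetric] by measurable
  from measurable_compose[OF X_meas this]
  show "(\<lambda>\<omega>. ((fst (X \<omega>))\<^sup>2 / q, (snd (X \<omega>))\<^sup>2 / q)) \<in> borel_measurable M" .
  fix A :: "(real \<times> real) set" assume "A \<in> sets borel"
  then have A [measurable]: "A \<in> sets (borel \<Otimes>\<^sub>M borel)" "A \<in> sets borel" unfolding borel_prod by simp_all
  define b where "b x y = ennreal (binormal_density r (x, y))" for x y
  have [measurable]: "case_prod b \<in> borel_measurable (borel \<Otimes>\<^sub>M borel)"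
  proof -
    have "case_prod b = (\<lambda>w. ennreal (binormal_density r w))" by (simp add: fun_eq_iff b_def)
    then show ?thesis by (simp add: borel_prod)
  qed
  have [measurable]: "(\<lambda>x. b (f x) (g x)) \<in> borel_measurable N" if [measurable]: "f \<in> borel_measurable N" "g \<in> borel_measurable N" for f g and N :: "'n measure"
    using measurable_compose[of "\<lambda>x. (f x, g x)" N "borel \<Otimes>\<^sub>M borel" "case_prod b" borel] by simp
  define k where "k u = ennreal (sqrt q / (2 * sqrt u)) * indicator {0<..} u" for u
  have [measurable]: "k \<in> borel_measurable borel" unfolding k_def[abs_def] by measurable
  let ?s = "\<lambda>u. sqrt (q * u)"
  have "(\<integral>\<^sup>+\<omega>. indicator A ((fst (X \<omega>))\<^sup>2 / q, (snd (X \<omega>))\<^sup>2 / q) \<partial>M) =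
    (\<integral>\<^sup>+w. ennreal (binormal_density r w) * indicator A ((fst w)\<^sup>2 / q, (snd w)\<^sup>2 / q) \<partial>lborel)"
    by (rule distributed_nn_integral[OF X, symmetric]) (use measurable_compose[OF sq, of "indicator A" borel] in simp)
  also have "\<dots> = (\<integral>\<^sup>+x. \<integral>\<^sup>+y. indicator A (x\<^sup>2 / q, y\<^sup>2 / q) * b x y \<partial>lborel \<partial>lborel)"
  proof -
    have "(\<lambda>w. ennreal (binormal_density r w) * indicator A ((fst w)\<^sup>2 / q, (snd w)\<^sup>2 / q)) \<in> borel_measurable borel"
      by (intro borel_measurable_times_ennreal measurable_compose[OF sq]) auto
    from nn_integral_lborel_iterated(1)[OF this] show ?thesis
      by (simp add: b_def mult.commute)
  qed
  also have "\<dots> = (\<integral>\<^sup>+x. \<integral>\<^sup>+v. indicator A (x\<^sup>2 / q, v) * k v * (b x (?s v) + b x (- ?s v)) \<partial>lborel \<partial>lborel)"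
  proof (rule nn_integral_cong)
    fix x :: real
    show "(\<integral>\<^sup>+y. indicator A (x\<^sup>2 / q, y\<^sup>2 / q) * b x y \<partial>lborel) =
      (\<integral>\<^sup>+v. indicator A (x\<^sup>2 / q, v) * k v * (b x (?s v) + b x (- ?s v)) \<partial>lborel)"
      unfolding k_def by (rule nn_integral_square_substitution[where F = "\<lambda>v. indicator A (x\<^sup>2 / q, v)", OF _ _ q]) measurable
  qed
  also have "\<dots> = (\<integral>\<^sup>+v. \<integral>\<^sup>+x. indicator A (x\<^sup>2 / q, v) * k v * (b x (?s v) + b x (- ?s v)) \<partial>lborel \<partial>lborel)"
    by (rule lborel_pair.Fubini') measurable
  also have "\<dots> = (\<integral>\<^sup>+v. \<integral>\<^sup>+u. indicator A (u, v) * k u * (k v * (b (?s u) (?s v) + b (?s u) (- ?s v)) + k v * (b (- ?s u) (?s v) + b (- ?s u) (- ?s v))) \<partial>lborel \<partial>lborel)"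
  proof (rule nn_integral_cong)
    fix v :: real
    show "(\<integral>\<^sup>+x. indicator A (x\<^sup>2 / q, v) * k v * (b x (?s v) + b x (- ?s v)) \<partial>lborel) =
      (\<integral>\<^sup>+u. indicator A (u, v) * k u * (k v * (b (?s u) (?s v) + b (?s u) (- ?s v)) + k v * (b (- ?s u) (?s v) + b (- ?s u) (- ?s v))) \<partial>lborel)"
      using nn_integral_square_substitution[where F = "\<lambda>u. indicator A (u, v)" and h = "\<lambda>x. k v * (b x (?s v) + b x (- ?s v))", OF _ _ q]
      unfolding k_def[symmetric] by (simp add: mult.assoc)
  qed
  also have "\<dots> = (\<integral>\<^sup>+v. \<integral>\<^sup>+u. kibble_density (1 / 2) (q / (2 * (1 - r\<^sup>2))) r (u, v) * indicator A (u, v) \<partial>lborel \<partial>lborel)"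
  proof (intro nn_integral_cong)
    fix u v :: real
    show "indicator A (u, v) * k u * (k v * (b (?s u) (?s v) + b (?s u) (- ?s v)) + k v * (b (- ?s u) (?s v) + b (- ?s u) (- ?s v))) =
      kibble_density (1 / 2) (q / (2 * (1 - r\<^sup>2))) r (u, v) * indicator A (u, v)"
    proof (cases "0 < u \<and> 0 < v")
      case True
      have D: "1 - r\<^sup>2 > 0" using r by (simp add: abs_square_less_1)
      have "k u * (k v * (b (?s u) (?s v) + b (?s u) (- ?s v)) + k v * (b (- ?s u) (?s v) + b (- ?s u) (- ?s v))) =
        ennreal (sqrt q / (2 * sqrt u) * (sqrt q / (2 * sqrt v)) *
     (binormal_density r (?s u, ?s v) + binormal_density r (?s u, - ?s v) + (binormal_density r (- ?s u, ?s v) + binormal_density r (- ?s u, - ?s v))))"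
      proof -
        have *: "ennreal \<alpha> * (ennreal \<beta> * (ennreal b1 + ennreal b2) + ennreal \<beta> * (ennreal b3 + ennreal b4)) =
            ennreal (\<alpha> * \<beta> * (b1 + b2 + (b3 + b4)))"
          if "0 \<le> \<alpha>" "0 \<le> \<beta>" "0 \<le> b1" "0 \<le> b2" "0 \<le> b3" "0 \<le> b4" for \<alpha> \<beta> b1 b2 b3 b4
        proof -
          have "ennreal \<alpha> * (ennreal \<beta> * (ennreal b1 + ennreal b2) + ennreal \<beta> * (ennreal b3 + ennreal b4)) =
            ennreal (\<alpha> * (\<beta> * (b1 + b2) + \<beta> * (b3 + b4)))"
            using that by (simp add: ennreal_mult'[symmetric] ennreal_plus[symmetric] del: ennreal_plus)
          then show ?thesis by (simp add: distrib_left mult.assoc)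
        qed
        have "k u = ennreal (sqrt q / (2 * sqrt u))" "k v = ennreal (sqrt q / (2 * sqrt v))"
          using True by (auto simp: k_def)
        then show ?thesis
          using True q r unfolding b_def by (simp only:, intro *) (auto intro!: binormal_density_nonneg)
      qed
      also have "\<dots> = kibble_density (1 / 2) (q / (2 * (1 - r\<^sup>2))) r (u, v)"
        using True q D kibble_density_eq[of "1 / 2" "q / (2 * (1 - r\<^sup>2))" u v r]
        by (subst kibble_density_half[OF r q]) (auto simp: r)
      finally show ?thesis
        by (subst mult.assoc) (simp only: mult.commute)
    next
      case False
      then show ?thesis by (auto simp: k_def kibble_density_eq_0)
    qed
  qed
  also have "\<dots> = (\<integral>\<^sup>+w. kibble_density (1 / 2) (q / (2 * (1 - r\<^sup>2))) r w * indicator A w \<partial>lborel)"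
    by (rule nn_integral_lborel_iterated(2)[symmetric]) simp
  finally show "(\<integral>\<^sup>+\<omega>. indicator A ((fst (X \<omega>))\<^sup>2 / q, (snd (X \<omega>))\<^sup>2 / q) \<partial>M) =
    (\<integral>\<^sup>+w. kibble_density (1 / 2) (q / (2 * (1 - r\<^sup>2))) r w * indicator A w \<partial>lborel)" .
qed simp

section \<open>The law of the mixing variables\<close>

lemma nn_integral_lborel_translate:
  fixes h :: "'a::euclidean_space \<Rightarrow> ennreal"
  assumes [measurable]: "h \<in> borel_measurable borel"
  shows "(\<integral>\<^sup>+x. h (x + y) \<partial>lborel) = (\<integral>\<^sup>+x. h x \<partial>lborel)"
proof -
  have "(\<integral>\<^sup>+x. h x \<partial>lborel) = (\<integral>\<^sup>+x. h x \<partial>distr lborel borel ((+) y))"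
    by (simp add: lborel_distr_plus)
  also have "\<dots> = (\<integral>\<^sup>+x. h (y + x) \<partial>lborel)"
    by (rule nn_integral_distr) auto
  finally show ?thesis by (simp add: add.commute)
qed

context prob_space
begin

lemma nn_integral_indep_distributed:
  fixes X Y :: "'a \<Rightarrow> 'b::euclidean_space"
  assumes ind: "indep_var borel X borel Y" and X: "distributed M lborel X f" and Y: "distributed M lborel Y g"
    and F [measurable]: "case_prod F \<in> borel_measurable (borel \<Otimes>\<^sub>M borel)"
  shows "(\<integral>\<^sup>+\<omega>. F (X \<omega>) (Y \<omega>) \<partial>M) = (\<integral>\<^sup>+x. f x * (\<integral>\<^sup>+y. g y * F x y \<partial>lborel) \<partial>lborel)"
proof -
  have [measurable]: "f \<in> borel_measurable borel" "g \<in> borel_measurable borel"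
    using distributed_borel_measurable[OF X] distributed_borel_measurable[OF Y] by simp_all
  have [measurable]: "random_variable borel X" "random_variable borel Y"
    using distributed_measurable[OF X] distributed_measurable[OF Y] by simp_all
  interpret X: prob_space "distr M borel X" by (rule prob_space_distr) simp
  interpret Y: prob_space "distr M borel Y" by (rule prob_space_distr) simp
  have dX: "distr M borel X = density lborel f" and dY: "distr M borel Y = density lborel g"
    using distributed_distr_eq_density[OF X] distributed_distr_eq_density[OF Y] by (simp_all cong: distr_cong)
  have "(\<integral>\<^sup>+\<omega>. F (X \<omega>) (Y \<omega>) \<partial>M) = (\<integral>\<^sup>+z. case_prod F z \<partial>distr M (borel \<Otimes>\<^sub>M borel) (\<lambda>\<omega>. (X \<omega>, Y \<omega>)))"
    by (subst nn_integral_distr) auto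
  also have "distr M (borel \<Otimes>\<^sub>M borel) (\<lambda>\<omega>. (X \<omega>, Y \<omega>)) = distr M borel X \<Otimes>\<^sub>M distr M borel Y"
    using ind by (simp add: indep_var_distribution_eq)
  also have "(\<integral>\<^sup>+z. case_prod F z \<partial>(distr M borel X \<Otimes>\<^sub>M distr M borel Y)) = (\<integral>\<^sup>+x. \<integral>\<^sup>+y. F x y \<partial>distr M borel Y \<partial>distr M borel X)"
    by (subst Y.nn_integral_fst[symmetric]) auto
  also have "\<dots> = (\<integral>\<^sup>+x. f x * (\<integral>\<^sup>+y. g y * F x y \<partial>lborel) \<partial>lborel)"
    unfolding dX dY by (simp add: nn_integral_density)
  finally show ?thesis .
qed

text \<open>For a fixed value y of the second summand the integral over the plane is translated by
  y.\<close>

lemma distributed_indep_add: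
  fixes X Y :: "'a \<Rightarrow> real \<times> real"
  assumes ind: "indep_var borel X borel Y" and X: "distributed M lborel X f" and Y: "distributed M lborel Y g"
  shows "distributed M lborel (\<lambda>\<omega>. X \<omega> + Y \<omega>) (\<lambda>x. \<integral>\<^sup>+y. f (x - y) * g y \<partial>lborel)"
proof (rule distributedI_indicator)
  have [measurable]: "f \<in> borel_measurable borel" "g \<in> borel_measurable borel"
    using distributed_borel_measurable[OF X] distributed_borel_measurable[OF Y] by simp_all
  have [measurable]: "random_variable borel X" "random_variable borel Y"
    using distributed_measurable[OF X] distributed_measurable[OF Y] by simp_all
  show "(\<lambda>\<omega>. X \<omega> + Y \<omega>) \<in> borel_measurable M" by simp
  show "(\<lambda>x. \<integral>\<^sup>+y. f (x - y) * g y \<partial>lborel) \<in> borel_measurable borel"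
    by measurable
  fix A :: "(real \<times> real) set" assume [measurable]: "A \<in> sets borel"
  have "(\<integral>\<^sup>+\<omega>. indicator A (X \<omega> + Y \<omega>) \<partial>M) = (\<integral>\<^sup>+x. f x * (\<integral>\<^sup>+y. g y * indicator A (x + y) \<partial>lborel) \<partial>lborel)"
    by (rule nn_integral_indep_distributed[OF ind X Y, where F = "\<lambda>x y. indicator A (x + y)"]) measurable
  also have "\<dots> = (\<integral>\<^sup>+x. \<integral>\<^sup>+y. f x * (g y * indicator A (x + y)) \<partial>lborel \<partial>lborel)"
    by (intro nn_integral_cong nn_integral_cmult[symmetric]) measurable
  also have "\<dots> = (\<integral>\<^sup>+y. \<integral>\<^sup>+x. f x * (g y * indicator A (x + y)) \<partial>lborel \<partial>lborel)"
    by (rule lborel_pair.Fubini'[symmetric]) measurable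
  also have "\<dots> = (\<integral>\<^sup>+y. \<integral>\<^sup>+x. f (x - y) * (g y * indicator A x) \<partial>lborel \<partial>lborel)"
  proof (rule nn_integral_cong)
    fix y :: "real \<times> real"
    have "(\<lambda>x. f (x - y) * (g y * indicator A x)) \<in> borel_measurable borel" by measurable
    from nn_integral_lborel_translate[OF this, of y]
    show "(\<integral>\<^sup>+x. f x * (g y * indicator A (x + y)) \<partial>lborel) = (\<integral>\<^sup>+x. f (x - y) * (g y * indicator A x) \<partial>lborel)"
      by simp
  qed
  also have "\<dots> = (\<integral>\<^sup>+x. \<integral>\<^sup>+y. f (x - y) * (g y * indicator A x) \<partial>lborel \<partial>lborel)"
    by (rule lborel_pair.Fubini') measurable
  also have "\<dots> = (\<integral>\<^sup>+x. (\<integral>\<^sup>+y. f (x - y) * g y \<partial>lborel) * indicator A x \<partial>lborel)"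
    by (intro nn_integral_cong, subst nn_integral_multc[symmetric]) (measurable, simp add: mult.assoc)
  finally show "(\<integral>\<^sup>+\<omega>. indicator A (X \<omega> + Y \<omega>) \<partial>M) = (\<integral>\<^sup>+x. (\<integral>\<^sup>+y. f (x - y) * g y \<partial>lborel) * indicator A x \<partial>lborel)" .
qed

lemma indep_var_sum:
  fixes X :: "'i \<Rightarrow> 'a \<Rightarrow> 'b::euclidean_space"
  assumes I: "finite I" "i \<notin> I" and indep: "indep_vars (\<lambda>_. borel) X (insert i I)"
  shows "indep_var borel (X i) borel (\<lambda>\<omega>. \<Sum>i\<in>I. X i \<omega>)"
proof -
  have "indep_var borel ((\<lambda>f. f i) \<circ> (\<lambda>\<omega>. restrict (\<lambda>i. X i \<omega>) {i}))
      borel ((\<lambda>f. \<Sum>i\<in>I. f i) \<circ> (\<lambda>\<omega>. restrict (\<lambda>i. X i \<omega>) I))"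
    using I by (intro indep_var_compose[OF indep_var_restrict[OF indep]]) auto
  also have "((\<lambda>f. f i) \<circ> (\<lambda>\<omega>. restrict (\<lambda>i. X i \<omega>) {i})) = X i"
    by auto
  also have "((\<lambda>f. \<Sum>i\<in>I. f i) \<circ> (\<lambda>\<omega>. restrict (\<lambda>i. X i \<omega>) I)) = (\<lambda>\<omega>. \<Sum>i\<in>I. X i \<omega>)"
    by auto
  finally show ?thesis .
qed

text \<open>Each further summand adds \<alpha> to the shape, while \<open>c\<close> and
  \<open>r\<close> stay fixed. The induction starts from one summand, because the empty sum is
  constantly 0 and has no density.\<close>

lemma distributed_sum_kibble:
  fixes Q :: "'i \<Rightarrow> 'a \<Rightarrow> real \<times> real"
  assumes I: "finite I" "I \<noteq> {}" and ind: "indep_vars (\<lambda>_. borel) Q I"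
    and Q: "\<And>i. i \<in> I \<Longrightarrow> distributed M lborel (Q i) (kibble_density \<alpha> c r)"
    and \<alpha>: "\<alpha> > 0" and c: "c > 0"
  shows "distributed M lborel (\<lambda>\<omega>. \<Sum>i\<in>I. Q i \<omega>) (kibble_density (real (card I) * \<alpha>) c r)"
  using I ind Q
proof (induction I rule: finite_ne_induct)
  case (singleton i)
  then show ?case by simp
next
  case (insert i I)
  have "indep_vars (\<lambda>_. borel) Q I" using insert.prems(1) by (rule indep_vars_subset) auto
  then have IH: "distributed M lborel (\<lambda>\<omega>. \<Sum>i\<in>I. Q i \<omega>) (kibble_density (real (card I) * \<alpha>) c r)"
    using insert by simp
  have "card I > 0" using insert by (simp add: card_gt_0_iff)
  then have pos: "real (card I) * \<alpha> > 0" using \<alpha> by simp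
  have "distributed M lborel (\<lambda>\<omega>. Q i \<omega> + (\<Sum>i\<in>I. Q i \<omega>))
    (\<lambda>x. \<integral>\<^sup>+y. kibble_density \<alpha> c r (x - y) * kibble_density (real (card I) * \<alpha>) c r y \<partial>lborel)"
    using insert.hyps insert.prems by (intro distributed_indep_add indep_var_sum IH) auto
  also have "(\<lambda>x. \<integral>\<^sup>+y. kibble_density \<alpha> c r (x - y) * kibble_density (real (card I) * \<alpha>) c r y \<partial>lborel) =
    kibble_density (real (card (insert i I)) * \<alpha>) c r"
    using insert.hyps by (simp add: kibble_density_convolution[OF \<alpha> pos c] fun_eq_iff distrib_right)
  finally show ?case using insert.hyps by simp
qed

end

section \<open>Integer and non-integer degrees of freedom\<close>

lemma measurable_pair_borel_eval:
  assumes "s \<in> A" "t \<in> A"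
  shows "(\<lambda>h. (h s, h t)) \<in> borel_measurable (PiM A (\<lambda>_. borel :: real measure))"
  unfolding borel_prod[symmetric] using assms by measurable

text \<open>Each pair of scaled squares has shape 1/2 and rate n / (2 (1 - r^2)), and n of them add
  up to shape n / 2 at the same rate. \<open>W\<close> is prescribed on the sample space only, so
  the conclusion speaks of a pair \<open>V\<close> that agrees with it there.\<close>

lemma chi_square_mixing_law:
  fixes A :: "'s::euclidean_space set"
  assumes M: "prob_space M" and G: "parent_process M A \<rho> G" and st: "s \<in> A" "t \<in> A" "s \<noteq> t"
    and r: "\<bar>\<rho> (s - t)\<bar> < 1" and n: "n > 0" and W: "chi_square_mixing M A n G W"
  shows "\<exists>V. (\<forall>\<omega>\<in>space M. (W s \<omega>, W t \<omega>) = V \<omega>) \<and>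
    prob_space.indep_var M borel V borel (\<lambda>\<omega>. (G s \<omega>, G t \<omega>)) \<and>
    distributed M lborel V (\<lambda>w. ennreal (bivariate_gamma_density (real n) (\<rho> (s - t)) w))"
proof -
  interpret prob_space M by fact
  define r where "r = \<rho> (s - t)"
  have r1: "\<bar>r\<bar> < 1" using r by (simp add: r_def)
  then have D: "1 - r\<^sup>2 > 0" by (simp add: abs_square_less_1)
  obtain H where H0: "H 0 = G"
    and ind: "indep_vars (\<lambda>_. PiM A (\<lambda>_. borel)) (\<lambda>i. sample_path A (H i)) {0..n}"
    and law: "\<And>i. i \<in> {1..n} \<Longrightarrow> distr M (PiM A (\<lambda>_. borel)) (sample_path A (H i)) =
                     distr M (PiM A (\<lambda>_. borel)) (sample_path A G)"
    and Weq: "\<And>u \<omega>. u \<in> A \<Longrightarrow> \<omega> \<in> space M \<Longrightarrow> W u \<omega> = (1 / real n) * (\<Sum>i=1..n. (H i u \<omega>)\<^sup>2)"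
    using W unfolding chi_square_mixing_def by blast
  define P where "P i \<omega> = (H i s \<omega>, H i t \<omega>)" for i \<omega>
  note eval = measurable_pair_borel_eval[OF st(1,2)]
  have P: "P i = (\<lambda>\<omega>. (sample_path A (H i) \<omega> s, sample_path A (H i) \<omega> t))" for i
    using st by (simp add: P_def sample_path_def fun_eq_iff)
  \<comment> \<open>Independence is given for whole sample paths; evaluation at the two sites is
    measurable and passes it on to the pairs.\<close>
  have P_ind: "indep_vars (\<lambda>_. borel) P {0..n}"
    unfolding P[abs_def] by (rule indep_vars_compose2[OF ind]) (rule eval)
  have paths: "sample_path A (H i) \<in> measurable M (PiM A (\<lambda>_. borel))" if "i \<in> {0..n}" for i
    using ind that by (auto simp: indep_vars_def)
  have P0: "distributed M lborel (P 0) (\<lambda>w. ennreal (binormal_density r w))"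
    using parent_process_distributed[OF M G st r] unfolding P_def H0 r_def .
  have P_distr: "distr M lborel (P i) = distr (distr M (PiM A (\<lambda>_. borel)) (sample_path A (H i))) lborel (\<lambda>h. (h s, h t))"
    if "i \<in> {0..n}" for i
    unfolding P using distr_distr[of "\<lambda>h. (h s, h t)" "PiM A (\<lambda>_. borel)" lborel "sample_path A (H i)" M] paths[OF that] eval
    by (simp add: o_def)
  have P_meas: "P i \<in> borel_measurable M" if "i \<in> {0..n}" for i
    using P_ind that by (auto simp: indep_vars_def)
  \<comment> \<open>The copies have the path law of \<open>G\<close>, which is the copy with index
    0, hence also its pair law.\<close>
  have Pi: "distributed M lborel (P i) (\<lambda>w. ennreal (binormal_density r w))" if "i \<in> {1..n}" for i
    using P0 P_meas[of i] that unfolding distributed_def P_distr[of 0, simplified]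
    by (simp add: P_distr law H0)
  define sq where "sq w = ((fst w)\<^sup>2 / real n, (snd w)\<^sup>2 / real n)" for w :: "real \<times> real"
  have sq: "sq \<in> borel_measurable borel"
    unfolding sq_def[abs_def] borel_prod[symmetric] by measurable
  define V where "V \<omega> = (\<Sum>i\<in>{1..n}. sq (P i \<omega>))" for \<omega>
  have Q_ind: "indep_vars (\<lambda>_. borel) (\<lambda>i \<omega>. sq (P i \<omega>)) {1..n}"
    by (rule indep_vars_compose2[OF indep_vars_subset[OF P_ind]]) (use sq in auto)
  have Q: "distributed M lborel (\<lambda>\<omega>. sq (P i \<omega>)) (kibble_density (1 / 2) (real n / (2 * (1 - r\<^sup>2))) r)"
    if "i \<in> {1..n}" for i
    unfolding sq_def by (rule distributed_squares[OF Pi[OF that] r1]) (use n in simp)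
  have "distributed M lborel V (kibble_density (real (card {1..n}) * (1 / 2)) (real n / (2 * (1 - r\<^sup>2))) r)"
    unfolding V_def by (rule distributed_sum_kibble[OF _ _ Q_ind Q]) (use n D r1 in auto)
  moreover have "kibble_density (real (card {1..n}) * (1 / 2)) (real n / (2 * (1 - r\<^sup>2))) r =
    (\<lambda>w. ennreal (bivariate_gamma_density (real n) r w))"
    using kibble_density_bivariate_gamma_density[of "real n" r] n r1 by (simp add: fun_eq_iff)
  ultimately have V_law: "distributed M lborel V (\<lambda>w. ennreal (bivariate_gamma_density (real n) (\<rho> (s - t)) w))"
    by (simp add: r_def)
  \<comment> \<open>The blocks \<open>{1..n}\<close> and \<open>{0}\<close> are disjoint:
    \<open>V\<close> uses the copies only, the Gaussian pair only index 0.\<close>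
  have "indep_var borel ((\<lambda>f. \<Sum>i\<in>{1..n}. sq (f i)) \<circ> (\<lambda>\<omega>. restrict (\<lambda>i. P i \<omega>) {1..n}))
      borel ((\<lambda>f. f 0) \<circ> (\<lambda>\<omega>. restrict (\<lambda>i. P i \<omega>) {0}))"
  proof (intro indep_var_compose[OF indep_var_restrict[OF P_ind]])
    show "(\<lambda>f. \<Sum>i\<in>{1..n}. sq (f i)) \<in> borel_measurable (PiM {1..n} (\<lambda>_. borel))"
      by (intro borel_measurable_sum measurable_compose[OF _ sq]) auto
  qed auto
  also have "((\<lambda>f. \<Sum>i\<in>{1..n}. sq (f i)) \<circ> (\<lambda>\<omega>. restrict (\<lambda>i. P i \<omega>) {1..n})) = V"
    by (simp add: fun_eq_iff V_def)
  also have "((\<lambda>f. f 0) \<circ> (\<lambda>\<omega>. restrict (\<lambda>i. P i \<omega>) {0})) = (\<lambda>\<omega>. (G s \<omega>, G t \<omega>))"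
    by (simp add: fun_eq_iff P_def H0)
  finally have V_ind: "indep_var borel V borel (\<lambda>\<omega>. (G s \<omega>, G t \<omega>))" .
  have "(W s \<omega>, W t \<omega>) = V \<omega>" if "\<omega> \<in> space M" for \<omega>
    using Weq[OF st(1) that] Weq[OF st(2) that]
    by (simp add: V_def sq_def P_def prod_eq_iff fst_sum snd_sum sum_divide_distrib)
  with V_ind V_law show ?thesis by (intro exI[of _ V] conjI ballI)
qed

text \<open>Brings both cases to the same conclusion. For non-integer \<nu> the density is given,
  and it remains to pass from independence of the whole path of \<open>G\<close> to independence of
  its values at two sites.\<close>

lemma gamma_mixing_law:
  fixes A :: "'s::euclidean_space set"
  assumes M: "prob_space M" and \<nu>: "\<nu> > 0" and G: "parent_process M A \<rho> G" and st: "s \<in> A" "t \<in> A" "s \<noteq> t"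
    and r: "\<bar>\<rho> (s - t)\<bar> < 1" and W: "gamma_mixing M A \<rho> \<nu> G W s t"
  shows "\<exists>V. (\<forall>\<omega>\<in>space M. (W s \<omega>, W t \<omega>) = V \<omega>) \<and>
    prob_space.indep_var M borel V borel (\<lambda>\<omega>. (G s \<omega>, G t \<omega>)) \<and>
    distributed M lborel V (\<lambda>w. ennreal (bivariate_gamma_density \<nu> (\<rho> (s - t)) w))"
proof (cases "\<nu> \<in> \<nat>")
  case True
  then obtain n where n: "\<nu> = real n" "chi_square_mixing M A n G W"
    using W by (auto simp: gamma_mixing_def)
  from n \<nu> have "n > 0" by simp
  from chi_square_mixing_law[OF M G st r this n(2)] show ?thesis unfolding n(1) .
next
  case False
  interpret prob_space M by fact
  let ?V = "\<lambda>\<omega>. (W s \<omega>, W t \<omega>)" and ?G = "\<lambda>\<omega>. (G s \<omega>, G t \<omega>)"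
  have ind: "indep_set (sets (vimage_algebra (space M) ?V borel))
          (sets (vimage_algebra (space M) (sample_path A G) (PiM A (\<lambda>_. borel))))"
    and law: "distributed M lborel ?V (\<lambda>w. ennreal (bivariate_gamma_density \<nu> (\<rho> (s - t)) w))"
    using W False by (auto simp: gamma_mixing_def)
  have V_meas: "?V \<in> borel_measurable M" using distributed_measurable[OF law] by simp
  have G_meas: "?G \<in> borel_measurable M"
    using distributed_measurable[OF parent_process_distributed[OF M G st r]] by simp
  have "indep_var borel ?V borel ?G"
    unfolding indep_var_eq
  proof (intro conjI V_meas G_meas)
    let ?SV = "{?V -` B \<inter> space M |B. B \<in> sets borel}" and ?SG = "{?G -` B \<inter> space M |B. B \<in> sets borel}"
    have V: "sigma_sets (space M) ?SV = sets (vimage_algebra (space M) ?V borel)"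
      by (simp add: sets_vimage_algebra)
    \<comment> \<open>The two values are measurable functions of the path and so generate a smaller
      sigma-algebra.\<close>
    have G: "sigma_sets (space M) ?SG \<subseteq> sets (vimage_algebra (space M) (sample_path A G) (PiM A (\<lambda>_. borel)))"
    proof -
      have path: "sample_path A G \<in> measurable (vimage_algebra (space M) (sample_path A G) (PiM A (\<lambda>_. borel))) (PiM A (\<lambda>_. borel))"
        by (rule measurable_vimage_algebra1) (auto simp: sample_path_def space_PiM)
      have "(\<lambda>\<omega>. (sample_path A G \<omega> s, sample_path A G \<omega> t)) \<in>
        borel_measurable (vimage_algebra (space M) (sample_path A G) (PiM A (\<lambda>_. borel)))"
        by (rule measurable_compose[OF path measurable_pair_borel_eval[OF st(1,2)]])
      then have "?G \<in> borel_measurable (vimage_algebra (space M) (sample_path A G) (PiM A (\<lambda>_. borel)))"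
        using st by (simp add: sample_path_def)
      from measurable_sets[OF this] have "?SG \<subseteq> sets (vimage_algebra (space M) (sample_path A G) (PiM A (\<lambda>_. borel)))"
        by auto
      from sets.sigma_sets_subset[OF this] show ?thesis by simp
    qed
    show "indep_set (sigma_sets (space M) ?SV) (sigma_sets (space M) ?SG)"
      using ind unfolding V indep_set_def by (rule indep_sets_mono_sets) (use G in \<open>auto split: bool.split\<close>)
  qed
  with law show ?thesis by (intro exI[of _ ?V] conjI ballI) auto
qed

section \<open>From the mixing law to the law of the pair of t variables\<close>

lemma nn_integral_lborel_scale:
  fixes K :: "real \<times> real \<Rightarrow> ennreal"
  assumes K: "K \<in> borel_measurable borel" and ab: "a > 0" "b > 0"
  shows "(\<integral>\<^sup>+z. K z \<partial>lborel) = ennreal (a * b) * (\<integral>\<^sup>+y. K (a * fst y, b * snd y) \<partial>lborel)"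
proof -
  have "(\<integral>\<^sup>+z. K z \<partial>lborel) = ennreal (1 / \<bar>1 / (a * b)\<bar>) *
    (\<integral>\<^sup>+w. K ((1 / b * fst w - 0 * snd w) / (1 / (a * b)), (1 / a * snd w - 0 * fst w) / (1 / (a * b))) \<partial>lborel)"
    by (rule nn_integral_lborel_linear[OF K]) (use ab in auto)
  also have "\<dots> = ennreal (a * b) * (\<integral>\<^sup>+y. K (a * fst y, b * snd y) \<partial>lborel)"
    using ab by (simp add: abs_mult ac_simps)
  finally show ?thesis .
qed

lemma bivariate_t_kernel_measurable [measurable]:
  "case_prod (bivariate_t_kernel \<nu> r) \<in> borel_measurable (borel \<Otimes>\<^sub>M borel)"
proof -
  have [measurable]: "bivariate_gamma_density \<nu> r \<in> borel_measurable (borel \<Otimes>\<^sub>M borel)" "binormal_density r \<in> borel_measurable (borel \<Otimes>\<^sub>M borel)"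
    by (simp_all add: borel_prod)
  show ?thesis
    unfolding bivariate_t_kernel_def[abs_def] case_prod_beta' borel_prod[symmetric] by measurable
qed

text \<open>For fixed mixing values w the substitution g = (sqrt (fst w) y_1, sqrt (snd w) y_2)
  undoes the scaling by \<open>T w\<close>. Its Jacobian sqrt (fst w * snd w) is the leading factor
  of \<open>bivariate_t_kernel\<close>, and after exchanging the integrals the one over w is the
  density in y.\<close>

lemma distributed_t_process_pair:
  fixes A :: "'s::euclidean_space set"
  assumes M: "prob_space M" and \<nu>: "\<nu> \<ge> 1" and G: "parent_process M A \<rho> G" and st: "s \<in> A" "t \<in> A" "s \<noteq> t"
    and r: "\<bar>\<rho> (s - t)\<bar> < 1" and W: "gamma_mixing M A \<rho> \<nu> G W s t"
  shows "distributed M lborel (\<lambda>\<omega>. (t_process W G s \<omega>, t_process W G t \<omega>))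
    (\<lambda>y. ennreal (bivariate_t_density \<nu> (\<rho> (s - t)) y))"
proof (rule distributedI_indicator)
  interpret prob_space M by fact
  define r where "r = \<rho> (s - t)"
  have r1: "\<bar>r\<bar> < 1" using r by (simp add: r_def)
  have \<nu>0: "\<nu> > 0" using \<nu> by simp
  obtain V where V_eq: "\<forall>\<omega>\<in>space M. (W s \<omega>, W t \<omega>) = V \<omega>"
    and V_ind: "indep_var borel V borel (\<lambda>\<omega>. (G s \<omega>, G t \<omega>))"
    and V_law: "distributed M lborel V (\<lambda>w. ennreal (bivariate_gamma_density \<nu> r w))"
    using gamma_mixing_law[OF M \<nu>0 G st r W] unfolding r_def by blast
  have G_law: "distributed M lborel (\<lambda>\<omega>. (G s \<omega>, G t \<omega>)) (\<lambda>w. ennreal (binormal_density r w))"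
    unfolding r_def by (rule parent_process_distributed[OF M G st r])
  have V_meas: "V \<in> borel_measurable M" and G_meas: "(\<lambda>\<omega>. (G s \<omega>, G t \<omega>)) \<in> borel_measurable M"
    using distributed_measurable[OF V_law] distributed_measurable[OF G_law] by simp_all
  define T where "T w g = (fst w powr (- 1 / 2) * fst g, snd w powr (- 1 / 2) * snd g)" for w g :: "real \<times> real"
  have T_meas: "case_prod T \<in> borel_measurable (borel \<Otimes>\<^sub>M borel)"
    unfolding T_def[abs_def] case_prod_beta' borel_prod[symmetric] by measurable
  have T_eq: "(t_process W G s \<omega>, t_process W G t \<omega>) = T (V \<omega>) (G s \<omega>, G t \<omega>)" if "\<omega> \<in> space M" for \<omega>
    unfolding V_eq[rule_format, OF that, symmetric] by (simp add: T_def t_process_def)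
  have "(\<lambda>\<omega>. case_prod T (V \<omega>, (G s \<omega>, G t \<omega>))) \<in> borel_measurable M"
    by (rule measurable_compose[OF measurable_Pair[OF V_meas G_meas] T_meas])
  then show "(\<lambda>\<omega>. (t_process W G s \<omega>, t_process W G t \<omega>)) \<in> borel_measurable M"
    by (subst measurable_cong[OF T_eq]) simp_all
  note t_int = nn_integral_bivariate_t_kernel(1)[OF \<nu> r1]
  have [measurable]: "(\<lambda>(y, w). ennreal (bivariate_t_kernel \<nu> r y w)) \<in> borel_measurable (lborel \<Otimes>\<^sub>M lborel)"
    using measurable_compose[OF bivariate_t_kernel_measurable[of \<nu> r] measurable_ennreal] by (simp add: case_prod_beta')
  \<comment> \<open>Measurability of the density comes from its form as a parameter integral, not
    from the F4 series.\<close>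
  have "(\<lambda>y. \<integral>\<^sup>+w. ennreal (bivariate_t_kernel \<nu> r y w) \<partial>lborel) \<in> borel_measurable lborel"
    by measurable
  then show "(\<lambda>y. ennreal (bivariate_t_density \<nu> (\<rho> (s - t)) y)) \<in> borel_measurable borel"
    unfolding t_int unfolding r_def by simp
  fix A :: "(real \<times> real) set" assume A [measurable]: "A \<in> sets borel"
  have "(\<integral>\<^sup>+\<omega>. indicator A (t_process W G s \<omega>, t_process W G t \<omega>) \<partial>M) = (\<integral>\<^sup>+\<omega>. indicator A (T (V \<omega>) (G s \<omega>, G t \<omega>)) \<partial>M)"
    by (intro nn_integral_cong) (simp only: T_eq)
  also have "\<dots> = (\<integral>\<^sup>+w. ennreal (bivariate_gamma_density \<nu> r w) * (\<integral>\<^sup>+g. ennreal (binormal_density r g) * indicator A (T w g) \<partial>lborel) \<partial>lborel)"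
  proof (rule nn_integral_indep_distributed[OF V_ind V_law G_law])
    show "(\<lambda>(w, g). indicator A (T w g) :: ennreal) \<in> borel_measurable (borel \<Otimes>\<^sub>M borel)"
      using measurable_compose[OF T_meas borel_measurable_indicator[OF A]] by (simp add: case_prod_beta')
  qed
  also have "\<dots> = (\<integral>\<^sup>+w. \<integral>\<^sup>+y. ennreal (bivariate_t_kernel \<nu> r y w) * indicator A y \<partial>lborel \<partial>lborel)"
  proof (rule nn_integral_cong)
    fix w :: "real \<times> real"
    show "ennreal (bivariate_gamma_density \<nu> r w) * (\<integral>\<^sup>+g. ennreal (binormal_density r g) * indicator A (T w g) \<partial>lborel) =
      (\<integral>\<^sup>+y. ennreal (bivariate_t_kernel \<nu> r y w) * indicator A y \<partial>lborel)"
    proof (cases "0 < fst w \<and> 0 < snd w")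
      case True
      define a b where "a = sqrt (fst w)" and "b = sqrt (snd w)"
      have ab: "a > 0" "b > 0" "a * b = sqrt (fst w * snd w)" using True by (auto simp: a_def b_def real_sqrt_mult)
      have inv: "fst w powr (- 1 / 2) * a = 1" "snd w powr (- 1 / 2) * b = 1"
        using True by (simp_all add: a_def b_def powr_half_sqrt[symmetric] powr_add[symmetric] del: powr_half_sqrt)
      have Ta: "T w (a * fst y, b * snd y) = y" for y
        using inv by (simp add: T_def mult.assoc[symmetric])
      have Tw: "T w \<in> borel_measurable borel"
        unfolding T_def[abs_def] borel_prod[symmetric] by measurable
      have "(\<lambda>g. ennreal (binormal_density r g) * indicator A (T w g)) \<in> borel_measurable borel"
        by (intro borel_measurable_times_ennreal measurable_compose[OF Tw]) auto
      from nn_integral_lborel_scale[OF this ab(1,2)]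
      have "(\<integral>\<^sup>+g. ennreal (binormal_density r g) * indicator A (T w g) \<partial>lborel) =
        ennreal (a * b) * (\<integral>\<^sup>+y. ennreal (binormal_density r (a * fst y, b * snd y)) * indicator A y \<partial>lborel)"
        by (simp only: Ta)
      moreover have m: "(\<lambda>y. ennreal (binormal_density r (a * fst y, b * snd y)) * indicator A y) \<in> borel_measurable borel"
      proof -
        have "(\<lambda>y::real \<times> real. (a * fst y, b * snd y)) \<in> borel_measurable borel"
          unfolding borel_prod[symmetric] by measurable
        from measurable_compose[OF this binormal_density_measurable] show ?thesis by measurable
      qed
      ultimately have "ennreal (bivariate_gamma_density \<nu> r w) * (\<integral>\<^sup>+g. ennreal (binormal_density r g) * indicator A (T w g) \<partial>lborel) =
        (\<integral>\<^sup>+y. ennreal (bivariate_gamma_density \<nu> r w) * ennreal (a * b) * (ennreal (binormal_density r (a * fst y, b * snd y)) * indicator A y) \<partial>lborel)"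
        by (simp add: nn_integral_cmult mult.assoc)
      also have "\<dots> = (\<integral>\<^sup>+y. ennreal (bivariate_t_kernel \<nu> r y w) * indicator A y \<partial>lborel)"
      proof (rule nn_integral_cong)
        fix y :: "real \<times> real"
        have "bivariate_t_kernel \<nu> r y w = bivariate_gamma_density \<nu> r w * (a * b) * binormal_density r (a * fst y, b * snd y)"
          unfolding bivariate_t_kernel_def ab(3)[symmetric] a_def[symmetric] b_def[symmetric] by (simp only: ac_simps)
        moreover have nn: "0 \<le> bivariate_gamma_density \<nu> r w" "0 \<le> a * b"
          using True ab bivariate_gamma_density_nonneg[OF \<nu>0 r1] by simp_all
        ultimately have "ennreal (bivariate_t_kernel \<nu> r y w) =
          ennreal (bivariate_gamma_density \<nu> r w) * ennreal (a * b) * ennreal (binormal_density r (a * fst y, b * snd y))"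
          by (simp only: ennreal_mult'[OF mult_nonneg_nonneg[OF nn]] ennreal_mult'[OF nn(1)])
        then show "ennreal (bivariate_gamma_density \<nu> r w) * ennreal (a * b) * (ennreal (binormal_density r (a * fst y, b * snd y)) * indicator A y) =
          ennreal (bivariate_t_kernel \<nu> r y w) * indicator A y" by (simp add: mult.assoc)
      qed
      finally show ?thesis .
    next
      case False
      then have "bivariate_gamma_density \<nu> r w = 0"
        by (auto simp: bivariate_gamma_density_def case_prod_beta)
      then show ?thesis by (simp add: bivariate_t_kernel_def)
    qed
  qed
  also have "\<dots> = (\<integral>\<^sup>+y. \<integral>\<^sup>+w. ennreal (bivariate_t_kernel \<nu> r y w) * indicator A y \<partial>lborel \<partial>lborel)"
    by (rule lborel_pair.Fubini') measurable
  also have "\<dots> = (\<integral>\<^sup>+y. ennreal (bivariate_t_density \<nu> r y) * indicator A y \<partial>lborel)"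
    unfolding t_int[symmetric] by (intro nn_integral_cong nn_integral_multc) measurable
  finally show "(\<integral>\<^sup>+\<omega>. indicator A (t_process W G s \<omega>, t_process W G t \<omega>) \<partial>M) =
    (\<integral>\<^sup>+y. ennreal (bivariate_t_density \<nu> (\<rho> (s - t)) y) * indicator A y \<partial>lborel)" by (simp add: r_def)
qed

theorem theorem2p3:
  fixes M :: "'w measure" and A :: "(real ^ 'd) set"
    and G W :: "real ^ 'd \<Rightarrow> 'w \<Rightarrow> real"
    and \<rho> :: "real ^ 'd \<Rightarrow> real" and \<nu> :: real and s\<^sub>i s\<^sub>j :: "real ^ 'd"
  assumes "prob_space M"
    and "\<nu> > 2"
    and "parent_process M A \<rho> G"
    and "s\<^sub>i \<in> A" and "s\<^sub>j \<in> A" and "s\<^sub>i \<noteq> s\<^sub>j"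
    and "\<bar>\<rho> (s\<^sub>i - s\<^sub>j)\<bar> < 1"
    and "gamma_mixing M A \<rho> \<nu> G W s\<^sub>i s\<^sub>j"
  shows "let r = \<rho> (s\<^sub>i - s\<^sub>j);
             f = (\<lambda>(y\<^sub>i, y\<^sub>j). let l = (y\<^sub>i\<^sup>2 + \<nu>) * (y\<^sub>j\<^sup>2 + \<nu>) in
               \<nu> powr \<nu> * l powr (- (\<nu> + 1) / 2) * (Gamma ((\<nu> + 1) / 2))\<^sup>2 /
                 (pi * (Gamma (\<nu> / 2))\<^sup>2 * (1 - r\<^sup>2) powr (- (\<nu> + 1) / 2)) *
                 appell_F4 ((\<nu> + 1) / 2) ((\<nu> + 1) / 2) (1 / 2) (\<nu> / 2)
                   (r\<^sup>2 * y\<^sub>i\<^sup>2 * y\<^sub>j\<^sup>2 / l) (\<nu>\<^sup>2 * r\<^sup>2 / l)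
               + r * y\<^sub>i * y\<^sub>j * \<nu> powr (\<nu> + 2) * l powr (- \<nu> / 2 - 1) /
                 (2 * pi * (1 - r\<^sup>2) powr (- (\<nu> + 1) / 2)) *
                 appell_F4 (\<nu> / 2 + 1) (\<nu> / 2 + 1) (3 / 2) (\<nu> / 2)
                   (r\<^sup>2 * y\<^sub>i\<^sup>2 * y\<^sub>j\<^sup>2 / l) (\<nu>\<^sup>2 * r\<^sup>2 / l))
         in (\<forall>y. 0 \<le> f y) \<and>
            distributed M lborel
              (\<lambda>\<omega>. (t_process W G s\<^sub>i \<omega>, t_process W G s\<^sub>j \<omega>)) (\<lambda>y. ennreal (f y))"
proof -
  have \<nu>: "1 \<le> \<nu>" using assms(2) by simp
  have "distributed M lborel (\<lambda>\<omega>. (t_process W G s\<^sub>i \<omega>, t_process W G s\<^sub>j \<omega>))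
      (\<lambda>y. ennreal (bivariate_t_density \<nu> (\<rho> (s\<^sub>i - s\<^sub>j)) y))"
    by (rule distributed_t_process_pair[OF assms(1) \<nu> assms(3-8)])
  \<comment> \<open>\<open>ennreal\<close> sends negative numbers to 0, so nonnegativity of the
    real-valued function is a claim of its own.\<close>
  moreover have "\<forall>y. 0 \<le> bivariate_t_density \<nu> (\<rho> (s\<^sub>i - s\<^sub>j)) y"
    using nn_integral_bivariate_t_kernel(2)[OF \<nu> assms(7)] by blast
  \<comment> \<open>Only the binding of the correlation is expanded at the start: the inner
    \<open>let\<close> over \<open>l\<close> has to survive until the defining equation of
    \<open>bivariate_t_density\<close> has been folded.\<close>
  ultimately show ?thesis
    unfolding Let_def[of "\<rho> (s\<^sub>i - s\<^sub>j)"] bivariate_t_density_def[symmetric]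
    unfolding Let_def by blast
qed

end
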